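(* Let $p>1$ and let $X,Y\in\mathcal{B}_p(\mathcal{H})$ with $X\neq 0$ and $Y\neq 0$. Then the $p$-angle $\angle_p(X,Y)=\arccos\left(\frac{|\alpha_{Y,X}|+|\alpha_{X,Y}|}{2}\right)$ satisfies the following: (1) $0\leq \angle_p(X,Y)\leq \frac{\pi}{2}$. (2) $\angle_p(X,Y)=\angle_p(Y,X)$. (3) $\angle_p(aX,bY)=\angle_p(X,Y)$ for any nonzero scalars $a,b\in\mathbb{C}$. (4) $\angle_p(X,Y)=\frac{\pi}{2}$ if and only if $X\perp^p Y$ and $Y\perp^p X$. (5) If $X\parallel^p Y$ (or equivalently $Y\parallel^p X$), then $\angle_p(X,Y)=0$; in particular, if $X$ and $Y$ are linearly dependent, then $\angle_p(X,Y)=0$. (6) $\angle_p(X,Y)\leq\angle_{gg}(X,Y)$.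
   Context: $\mathcal{H}$ is a separable complex Hilbert space, and $\mathcal{B}_p(\mathcal{H})$ is the Schatten $p$-class, i.e. the compact operators $X$ on $\mathcal{H}$ whose singular values satisfy $\|X\|_p=\left(\sum_n s_n(X)^p\right)^{1/p}<\infty$. Write $|X|=(X^*X)^{1/2}$ and let $X=U|X|$ be a polar decomposition with $U$ a partial isometry. For $p>1$ and $X,Y\in\mathcal{B}_p(\mathcal{H})$, $X\neq 0$, the semi-inner product is $$[Y,X]_p=\|X\|_p^{2-p}\operatorname{tr}\left(|X|^{p-1}U^*Y\right)$$ (for $p>1$ this does not depend on the choice of polar decomposition). For nonzero $X,Y\in\mathcal{B}_p(\mathcal{H})$ put $$\alpha_{Y,X}=\frac{[Y,X]_p}{\|X\|_p\|Y\|_p},\qquad \beta_{Y,X}=\operatorname{Re}(\alpha_{Y,X}).$$ The $gg$-angle is $\angle_{gg}(X,Y)=\arccos\left(\sqrt{|\beta_{Y,X}|\,|\beta_{X,Y}|}\right)$. Here $\arccos$ takes values in $[0,\pi]$. Birkhoff–James orthogonality: $X\perp^p Y$ means $\|X+\gamma Y\|_p\geq\|X\|_p$ for all $\gamma\in\mathbb{C}$. Norm-parallelism: $X\parallel^p Y$ means there exists $\lambda\in\mathbb{C}$ with $|\lambda|=1$ such that $\|X+\lambda Y\|_p=\|X\|_p+\|Y\|_p$. *)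

theory Defs
  imports "HOL-Analysis.Analysis"
begin

text \<open>
  Complex Hilbert spaces.  The scalar product is linear in its first argument, and the real
  inner product (hence the norm) of the underlying real space is its real part.
\<close>

class complex_hilbert = real_inner + complete_space +
  fixes scaleC :: "complex \<Rightarrow> 'a \<Rightarrow> 'a"  (infixr "*\<^sub>C" 75)
    and cinner :: "'a \<Rightarrow> 'a \<Rightarrow> complex"
  assumes scaleC_add_right: "c *\<^sub>C (x + y) = c *\<^sub>C x + c *\<^sub>C y"
    and scaleC_add_left: "(c + d) *\<^sub>C x = c *\<^sub>C x + d *\<^sub>C x"
    and scaleC_scaleC: "c *\<^sub>C d *\<^sub>C x = (c * d) *\<^sub>C x"
    and scaleC_of_real: "complex_of_real r *\<^sub>C x = r *\<^sub>R x"
    and cinner_commute: "cinner x y = cnj (cinner y x)"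
    and cinner_add_left: "cinner (x + y) z = cinner x z + cinner y z"
    and cinner_scaleC_left: "cinner (c *\<^sub>C x) y = c * cinner x y"
    and inner_eq_Re_cinner: "inner x y = Re (cinner x y)"

instantiation complex :: complex_hilbert
begin

definition scaleC_complex :: "complex \<Rightarrow> complex \<Rightarrow> complex"
  where "scaleC_complex c x = c * x"

definition cinner_complex :: "complex \<Rightarrow> complex \<Rightarrow> complex"
  where "cinner_complex x y = x * cnj y"

instance
  by standard (simp_all add: scaleC_complex_def cinner_complex_def algebra_simps
      scaleR_conv_of_real inner_complex_def)

end

global_interpretation complex_vector:
  vector_space "scaleC :: complex \<Rightarrow> 'a \<Rightarrow> 'a::complex_hilbert"
proof
  show "1 *\<^sub>C x = x" for x :: 'a
    using scaleC_of_real[of 1 x] by simp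
qed (simp_all add: scaleC_add_right scaleC_add_left scaleC_scaleC)

definition bounded_clinear :: "('a::complex_hilbert \<Rightarrow> 'a) \<Rightarrow> bool"
  where "bounded_clinear A \<longleftrightarrow> bounded_linear A \<and> (\<forall>c v. A (c *\<^sub>C v) = c *\<^sub>C A v)"

definition compact_operator :: "('a::complex_hilbert \<Rightarrow> 'a) \<Rightarrow> bool"
  where "compact_operator A \<longleftrightarrow> bounded_clinear A \<and> compact (closure (A ` cball 0 1))"

definition cadjoint :: "('a::complex_hilbert \<Rightarrow> 'a) \<Rightarrow> 'a \<Rightarrow> 'a"
  where "cadjoint A = (THE B. \<forall>x y. cinner (A x) y = cinner x (B y))"

definition eigenspace :: "('a::complex_hilbert \<Rightarrow> 'a) \<Rightarrow> real \<Rightarrow> 'a set"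
  where "eigenspace A t = {v. A v = t *\<^sub>R v}"

text \<open>
  The power \<open>A\<^sup>r\<close>, \<open>r > 0\<close>, of a positive \<^emph>\<open>compact\<close> operator \<open>A\<close> (functional calculus):
  the bounded operator acting as \<open>t\<^sup>r\<close> on the eigenspace of each eigenvalue \<open>t\<close>.  It is unique
  because the eigenvectors of \<open>A\<close> span a dense subspace.  Note \<open>0 powr r = 0\<close>.
\<close>

definition op_powr :: "('a::complex_hilbert \<Rightarrow> 'a) \<Rightarrow> real \<Rightarrow> 'a \<Rightarrow> 'a"
  where "op_powr A r = (THE B. bounded_clinear B \<and>
           (\<forall>t\<ge>0. \<forall>v\<in>eigenspace A t. B v = (t powr r) *\<^sub>R v))"

definition op_abs :: "('a::complex_hilbert \<Rightarrow> 'a) \<Rightarrow> 'a \<Rightarrow> 'a"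
  where "op_abs X = op_powr (cadjoint X \<circ> X) (1/2)"

text \<open>
  The singular values of a compact operator \<open>X\<close>: the nonzero eigenvalues of \<open>|X|\<close> in decreasing
  order, repeated according to their multiplicity, padded with zeros if there are only finitely
  many of them.
\<close>

definition singular_value :: "('a::complex_hilbert \<Rightarrow> 'a) \<Rightarrow> nat \<Rightarrow> real"
  where "singular_value X = (THE s. decseq s \<and> s \<longlonglongrightarrow> 0 \<and>
           (\<forall>t>0. card {n. s n = t} = complex_vector.dim (eigenspace (op_abs X) t)))"

definition schatten_class :: "real \<Rightarrow> ('a::complex_hilbert \<Rightarrow> 'a) set"
  where "schatten_class p =
           {X. compact_operator X \<and> summable (\<lambda>n. singular_value X n powr p)}"

definition schatten_norm :: "real \<Rightarrow> ('a::complex_hilbert \<Rightarrow> 'a) \<Rightarrow> real"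
  where "schatten_norm p X = (\<Sum>n. singular_value X n powr p) powr (1/p)"

definition orthonormal_basis :: "'a::complex_hilbert set \<Rightarrow> bool"
  where "orthonormal_basis E \<longleftrightarrow>
           (\<forall>e\<in>E. \<forall>f\<in>E. cinner e f = (if e = f then 1 else 0)) \<and>
           closure (complex_vector.span E) = UNIV"

text \<open>On trace class operators the value does not depend on the chosen orthonormal basis.\<close>

definition trace_op :: "('a::complex_hilbert \<Rightarrow> 'a) \<Rightarrow> complex"
  where "trace_op A = (\<Sum>\<^sub>\<infinity>e\<in>(SOME E. orthonormal_basis E). cinner (A e) e)"

definition partial_isometry :: "('a::complex_hilbert \<Rightarrow> 'a) \<Rightarrow> bool"
  where "partial_isometry U \<longleftrightarrow> bounded_clinear U \<and>
           (\<forall>v. (\<forall>w. U w = 0 \<longrightarrow> cinner v w = 0) \<longrightarrow> norm (U v) = norm v)"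

text \<open>
  The partial isometry of some polar decomposition \<open>X = U|X|\<close>.  It is not required that \<open>U\<close> and
  \<open>X\<close> have the same kernel; the semi-inner product below does not depend on the choice.
\<close>

definition polar_isometry :: "('a::complex_hilbert \<Rightarrow> 'a) \<Rightarrow> 'a \<Rightarrow> 'a"
  where "polar_isometry X = (SOME U. partial_isometry U \<and> X = U \<circ> op_abs X)"

text \<open>\<open>semi_inner p Y X\<close> is \<open>[Y, X]\<^sub>p\<close>, and \<open>alpha p Y X\<close> is the number with index \<open>Y, X\<close>.\<close>

definition semi_inner :: "real \<Rightarrow> ('a::complex_hilbert \<Rightarrow> 'a) \<Rightarrow> ('a \<Rightarrow> 'a) \<Rightarrow> complex"
  where "semi_inner p Y X = complex_of_real (schatten_norm p X powr (2 - p)) *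
           trace_op (op_powr (op_abs X) (p - 1) \<circ> cadjoint (polar_isometry X) \<circ> Y)"

definition alpha :: "real \<Rightarrow> ('a::complex_hilbert \<Rightarrow> 'a) \<Rightarrow> ('a \<Rightarrow> 'a) \<Rightarrow> complex"
  where "alpha p Y X =
           semi_inner p Y X / complex_of_real (schatten_norm p X * schatten_norm p Y)"

definition beta :: "real \<Rightarrow> ('a::complex_hilbert \<Rightarrow> 'a) \<Rightarrow> ('a \<Rightarrow> 'a) \<Rightarrow> real"
  where "beta p Y X = Re (alpha p Y X)"

definition gg_angle :: "real \<Rightarrow> ('a::complex_hilbert \<Rightarrow> 'a) \<Rightarrow> ('a \<Rightarrow> 'a) \<Rightarrow> real"
  where "gg_angle p X Y = arccos (sqrt (\<bar>beta p Y X\<bar> * \<bar>beta p X Y\<bar>))"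

definition p_angle :: "real \<Rightarrow> ('a::complex_hilbert \<Rightarrow> 'a) \<Rightarrow> ('a \<Rightarrow> 'a) \<Rightarrow> real"
  where "p_angle p X Y = arccos ((cmod (alpha p Y X) + cmod (alpha p X Y)) / 2)"

definition op_scale :: "complex \<Rightarrow> ('a::complex_hilbert \<Rightarrow> 'a) \<Rightarrow> 'a \<Rightarrow> 'a"
  where "op_scale c X = (\<lambda>v. c *\<^sub>C X v)"

definition op_add :: "('a::complex_hilbert \<Rightarrow> 'a) \<Rightarrow> ('a \<Rightarrow> 'a) \<Rightarrow> 'a \<Rightarrow> 'a"
  where "op_add X Y = (\<lambda>v. X v + Y v)"

definition birkhoff_james :: "real \<Rightarrow> ('a::complex_hilbert \<Rightarrow> 'a) \<Rightarrow> ('a \<Rightarrow> 'a) \<Rightarrow> bool"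
  where "birkhoff_james p X Y \<longleftrightarrow>
           (\<forall>\<gamma>. schatten_norm p (op_add X (op_scale \<gamma> Y)) \<ge> schatten_norm p X)"

definition norm_parallel :: "real \<Rightarrow> ('a::complex_hilbert \<Rightarrow> 'a) \<Rightarrow> ('a \<Rightarrow> 'a) \<Rightarrow> bool"
  where "norm_parallel p X Y \<longleftrightarrow>
           (\<exists>\<gamma>. cmod \<gamma> = 1 \<and>
              schatten_norm p (op_add X (op_scale \<gamma> Y)) = schatten_norm p X + schatten_norm p Y)"

end

theory Submission
  imports Defs
begin

text \<open>Every compact \<open>X\<close> has a decomposition \<open>X = \<Sum>s\<^sub>n \<langle>\<cdot>, v\<^sub>n\<rangle> u\<^sub>n\<close>, and \<open>tr(|X|\<^bsup>p-1\<^esup> U\<^sup>* Y)\<close> is the absolutely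
  convergent sum \<open>\<Sum>s\<^sub>n\<^bsup>p-1\<^esup> \<langle>Y v\<^sub>n, u\<^sub>n\<rangle>\<close>.  If \<open>Y = \<Sum>t\<^sub>m \<langle>\<cdot>, f\<^sub>m\<rangle> g\<^sub>m\<close>, expanding it produces the weights
  \<open>|\<langle>v\<^sub>n, f\<^sub>m\<rangle>| |\<langle>g\<^sub>m, u\<^sub>n\<rangle>|\<close>, which are doubly substochastic, so the scalar Hoelder inequality bounds the
  pairing by \<open>\<parallel>X\<parallel>\<^sub>p\<^bsup>p-1\<^esup> \<parallel>Y\<parallel>\<^sub>p\<close>.  Hence \<open>|\<alpha>| \<le> 1\<close>.  Since \<open>X \<mapsto> U|X|\<^bsup>p-1\<^esup>\<close> is continuous, the norm is smooth and
  the pairing is its only support functional at \<open>X\<close>.  Therefore \<open>X\<close> is Birkhoff-James orthogonal to \<open>Y\<close> exactly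
  when the pairing vanishes, and norm-parallelism forces equality in Hoelder's inequality, i.e. \<open>|\<alpha>| = 1\<close>.\<close>

section \<open>Complex inner products and Bessel systems\<close>

\<comment> \<open>The definitions describe their objects indirectly: adjoint, powers and singular
  values by unique existence, the basis of the trace and the polar isometry by choice. In series
  form all of them become coefficient sequences against orthogonal systems, once it is shown that
  the indirect description has exactly that solution. The main obstacle is continuity in X: singular
  vectors may jump where singular values coincide. It is met in two ways. U|X|^(p-1) is approximated
  by operators X h(X*X), in which neither singular vectors nor a polar isometry occur; oddness of
  the polynomial is what allows this. The pairing is then expanded along the fixed operator Y
  instead of X, so that strong convergence suffices term by term, while Hoelder's inequality
  controls the tails. No derivative of the norm is computed: an inequality between the difference
  quotient and the pairing at the perturbed operator, combined with this continuity, serves both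
  orthogonality and parallelism.\<close>
subclass (in complex_hilbert) banach ..

lemma cinner_add_right: "cinner x (y + z) = cinner x y + cinner x (z::'a::complex_hilbert)"
  by (metis cinner_add_left cinner_commute complex_cnj_add)

lemma cinner_scaleC_right: "cinner x (c *\<^sub>C y) = cnj c * cinner x (y::'a::complex_hilbert)"
  by (metis cinner_commute cinner_scaleC_left complex_cnj_mult)

lemma cinner_scaleR_left: "cinner (r *\<^sub>R x) (y::'a::complex_hilbert) = of_real r * cinner x y"
  by (metis cinner_scaleC_left scaleC_of_real)

lemma cinner_scaleR_right: "cinner x (r *\<^sub>R (y::'a::complex_hilbert)) = of_real r * cinner x y"
  by (metis cinner_scaleC_right scaleC_of_real complex_cnj_complex_of_real)

lemma cinner_self: "cinner x x = complex_of_real ((norm (x::'a::complex_hilbert))\<^sup>2)"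
proof -
  have "Im (cinner x x) = 0"
    using arg_cong[OF cinner_commute[of x x], of Im] by simp
  moreover have "Re (cinner x x) = (norm x)\<^sup>2"
    by (simp add: inner_eq_Re_cinner[symmetric] power2_norm_eq_inner)
  ultimately show ?thesis
    by (simp add: complex_eq_iff)
qed

lemma norm_scaleC: "norm (c *\<^sub>C x) = cmod c * norm (x::'a::complex_hilbert)"
proof -
  have "complex_of_real ((norm (c *\<^sub>C x))\<^sup>2) = complex_of_real ((cmod c * norm x)\<^sup>2)"
    unfolding cinner_self[symmetric, of "c *\<^sub>C x"] cinner_scaleC_left cinner_scaleC_right cinner_self[of x]
    by (simp add: power_mult_distrib mult.assoc[symmetric] mult.commute[of "cnj _"]
        complex_norm_square[symmetric, unfolded of_real_power])
  then have "(norm (c *\<^sub>C x))\<^sup>2 = (cmod c * norm x)\<^sup>2"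
    using of_real_eq_iff by blast
  then show ?thesis
    by (simp add: power2_eq_iff_nonneg)
qed

text \<open>Rotating \<open>x\<close> by a phase makes the complex product real and nonnegative, so
  the real Cauchy-Schwarz inequality applies.\<close>

lemma cinner_norm_le: "cmod (cinner x y) \<le> norm x * norm (y::'a::complex_hilbert)"
proof (cases "cinner x y = 0")
  case False
  define c where "c = cnj (cinner x y) / cmod (cinner x y)"
  have c: "cmod c = 1"
    using False by (simp add: c_def norm_divide)
  have "cinner (c *\<^sub>C x) y = complex_of_real (cmod (cinner x y))"
    using False by (simp add: cinner_scaleC_left c_def field_simps complex_norm_square[symmetric] power2_eq_square)
  then have "cmod (cinner x y) = inner (c *\<^sub>C x) y"
    by (simp add: inner_eq_Re_cinner)
  also have "\<dots> \<le> norm (c *\<^sub>C x) * norm y"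
    by (rule norm_cauchy_schwarz)
  finally show ?thesis
    by (simp add: norm_scaleC c)
qed simp

lemma bounded_linear_cinner_left: "bounded_linear (\<lambda>x. cinner x (y::'a::complex_hilbert))"
  by (rule bounded_linear_intro[where K = "norm y"])
     (auto simp: cinner_add_left cinner_scaleR_left scaleR_conv_of_real cinner_norm_le)

lemma bounded_linear_cinner_right: "bounded_linear (cinner (x::'a::complex_hilbert))"
proof (rule bounded_linear_intro[where K = "norm x"])
  show "norm (cinner x y) \<le> norm y * norm x" for y
    using cinner_norm_le[of x y] by (simp add: mult.commute)
qed (simp_all add: cinner_add_right cinner_scaleR_right scaleR_conv_of_real)

lemma bounded_linear_scaleC_right: "bounded_linear (\<lambda>x::'a::complex_hilbert. c *\<^sub>C x)"
proof (rule bounded_linear_intro[where K = "cmod c"])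
  show "c *\<^sub>C (r *\<^sub>R x) = r *\<^sub>R (c *\<^sub>C x)" for r and x :: 'a
    by (simp only: scaleC_of_real[symmetric] scaleC_scaleC mult.commute)
qed (auto simp: scaleC_add_right norm_scaleC mult.commute)

lemma bounded_linear_scaleC_left: "bounded_linear (\<lambda>c. c *\<^sub>C (x::'a::complex_hilbert))"
proof (rule bounded_linear_intro[where K = "norm x"])
  show "(r *\<^sub>R c) *\<^sub>C x = r *\<^sub>R (c *\<^sub>C x)" for r and c :: complex
    by (simp only: scaleR_conv_of_real scaleC_scaleC[symmetric] scaleC_of_real)
qed (auto simp: scaleC_add_left norm_scaleC)

lemmas cinner_zero_left [simp] = linear_0[OF bounded_linear.linear[OF bounded_linear_cinner_left]]
lemmas cinner_zero_right [simp] = linear_0[OF bounded_linear.linear[OF bounded_linear_cinner_right]]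
lemmas cinner_diff_left = linear_diff[OF bounded_linear.linear[OF bounded_linear_cinner_left]]
lemmas cinner_diff_right = linear_diff[OF bounded_linear.linear[OF bounded_linear_cinner_right]]
lemmas cinner_sum_left = linear_sum[OF bounded_linear.linear[OF bounded_linear_cinner_left]]
lemmas cinner_sum_right = linear_sum[OF bounded_linear.linear[OF bounded_linear_cinner_right]]
lemmas tendsto_cinner_left = bounded_linear.tendsto[OF bounded_linear_cinner_left]

lemma cinner_eq_0_iff [simp]: "cinner x x = 0 \<longleftrightarrow> x = (0::'a::complex_hilbert)"
  by (simp add: cinner_self)

lemma cinner_right_eqI:
  fixes x y :: "'a::complex_hilbert"
  assumes "\<And>z. cinner z x = cinner z y"
  shows "x = y"
proof -
  have "cinner (x - y) (x - y) = 0"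
    unfolding cinner_diff_right by (simp add: assms)
  then show ?thesis by simp
qed

lemma cinner_eq_0_commute: "cinner x y = 0 \<longleftrightarrow> cinner y (x::'a::complex_hilbert) = 0"
  by (metis cinner_commute complex_cnj_zero)

lemma cmod_cinner_commute: "cmod (cinner x y) = cmod (cinner y (x::'a::complex_hilbert))"
  by (metis cinner_commute complex_mod_cnj)

lemma norm_diff_sqr:
  "(norm (x - y))\<^sup>2 = (norm x)\<^sup>2 - 2 * Re (cinner x y) + (norm (y::'a::complex_hilbert))\<^sup>2"
  by (simp add: power2_norm_eq_inner inner_diff_left inner_diff_right inner_commute
      flip: inner_eq_Re_cinner)

lemma norm_add_sqr:
  "(norm (x + y))\<^sup>2 = (norm x)\<^sup>2 + 2 * Re (cinner x y) + (norm (y::'a::complex_hilbert))\<^sup>2"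
  by (simp add: power2_norm_eq_inner inner_add_left inner_add_right inner_commute
      flip: inner_eq_Re_cinner)

section \<open>Bounded complex-linear operators and uniqueness of adjoints\<close>

lemma bounded_clinearD:
  assumes "bounded_clinear A"
  shows "bounded_linear A" "A (c *\<^sub>C x) = c *\<^sub>C A x" "A (x + y) = A x + A y" "A (x - y) = A x - A y" "A 0 = 0"
    "A (r *\<^sub>R x) = r *\<^sub>R A x"
  using assms linear_simps[of A] by (auto simp: bounded_clinear_def bounded_linear.linear)

lemma bounded_clinear_onorm:
  assumes "bounded_clinear A"
  shows "norm (A x) \<le> onorm A * norm x"
  using onorm bounded_clinearD(1)[OF assms] by blast

lemma bounded_clinear_add:
  "bounded_clinear A \<Longrightarrow> bounded_clinear B \<Longrightarrow> bounded_clinear (\<lambda>x. A x + B x)"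
  unfolding bounded_clinear_def by (auto intro: bounded_linear_add simp: scaleC_add_right)

lemma bounded_clinear_scaleC: "bounded_clinear A \<Longrightarrow> bounded_clinear (\<lambda>x. c *\<^sub>C A x)"
  unfolding bounded_clinear_def
  by (auto intro: bounded_linear_compose[OF bounded_linear_scaleC_right] simp: scaleC_scaleC mult.commute)

lemma cadjoint_eqI:
  assumes "\<And>x y. cinner (A x) y = cinner x (B y)"
  shows "cadjoint A = B"
  unfolding cadjoint_def
proof (rule the_equality)
  fix B' assume "\<forall>x y. cinner (A x) y = cinner x (B' y)"
  then show "B' = B"
    by (intro ext) (rule cinner_right_eqI, simp flip: assms)
qed (use assms in blast)

text \<open>Zero vectors are allowed, so that finite systems can be padded to sequences.\<close>

definition orthosys :: "'i set \<Rightarrow> ('i \<Rightarrow> 'a::complex_hilbert) \<Rightarrow> bool"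
  where "orthosys I v \<longleftrightarrow>
    (\<forall>i\<in>I. \<forall>j\<in>I. cinner (v i) (v j) = (if i = j \<and> v i \<noteq> 0 then 1 else 0))"

text \<open>Only Bessel's inequality is kept, because it survives a projection of the vectors,
  whereas orthogonality does not.\<close>

definition bessel_system :: "('i \<Rightarrow> 'a::complex_hilbert) \<Rightarrow> bool"
  where "bessel_system a \<longleftrightarrow> (\<forall>x F. finite F \<longrightarrow> (\<Sum>i\<in>F. (cmod (cinner x (a i)))\<^sup>2) \<le> (norm x)\<^sup>2)"

lemma orthosysD:
  assumes "orthosys I v" "i \<in> I" "j \<in> I"
  shows "cinner (v i) (v j) = (if i = j \<and> v i \<noteq> 0 then 1 else 0)"
  using assms by (auto simp: orthosys_def)

lemma orthosys_norm:
  assumes "orthosys I v" "i \<in> I"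
  shows "norm (v i) = (if v i = 0 then 0 else 1)"
proof -
  have "complex_of_real ((norm (v i))\<^sup>2) = of_real (if v i = 0 then 0 else 1)"
    using orthosysD[OF assms(1,2,2)] by (simp add: cinner_self del: of_real_power)
  then have "(norm (v i))\<^sup>2 = (if v i = 0 then 0 else 1)"
    using of_real_eq_iff by blast
  then show ?thesis
    by (metis norm_ge_zero norm_zero power2_eq_1_iff zero_neq_one neg_0_le_iff_le not_one_le_zero)
qed

lemma orthosys_norm_sum:
  assumes v: "orthosys I v" and F: "finite F" "F \<subseteq> I"
  shows "(norm (\<Sum>i\<in>F. c i *\<^sub>C v i))\<^sup>2 = (\<Sum>i\<in>F. (cmod (c i) * norm (v i))\<^sup>2)"
proof -
  have "cinner (\<Sum>i\<in>F. c i *\<^sub>C v i) (\<Sum>j\<in>F. c j *\<^sub>C v j)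
      = (\<Sum>i\<in>F. \<Sum>j\<in>F. c i * (cnj (c j) * cinner (v i) (v j)))"
    unfolding cinner_sum_left cinner_scaleC_left cinner_sum_right cinner_scaleC_right sum_distrib_left
    by (subst sum.swap) (simp add: mult.left_commute)
  also have "\<dots> = (\<Sum>i\<in>F. \<Sum>j\<in>F. if i = j then c i * (cnj (c i) * cinner (v i) (v i)) else 0)"
    by (intro sum.cong) (use F orthosysD[OF v] in \<open>auto simp: subset_iff\<close>)
  also have "\<dots> = complex_of_real (\<Sum>i\<in>F. (cmod (c i) * norm (v i))\<^sup>2)"
    using F by (simp add: cinner_self power_mult_distrib mult.assoc[symmetric] complex_norm_square[symmetric, unfolded of_real_power])
  finally show ?thesis
    unfolding cinner_self using of_real_eq_iff by blast
qed

lemma orthosys_bessel: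
  assumes v: "orthosys I v" and F: "finite F" "F \<subseteq> I"
  shows "(norm (x - (\<Sum>i\<in>F. cinner x (v i) *\<^sub>C v i)))\<^sup>2 = (norm x)\<^sup>2 - (\<Sum>i\<in>F. (cmod (cinner x (v i)))\<^sup>2)"
proof -
  let ?P = "\<Sum>i\<in>F. cinner x (v i) *\<^sub>C v i"
  have "cinner x ?P = complex_of_real (\<Sum>i\<in>F. (cmod (cinner x (v i)))\<^sup>2)"
    by (simp add: cinner_sum_right cinner_scaleC_right mult.commute[of "cnj _"]
        flip: complex_norm_square del: of_real_power)
  moreover have "(norm ?P)\<^sup>2 = (\<Sum>i\<in>F. (cmod (cinner x (v i)))\<^sup>2)"
    unfolding orthosys_norm_sum[OF v F]
    by (intro sum.cong refl) (use F orthosys_norm[OF v] in \<open>auto simp: subset_iff\<close>)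
  ultimately show ?thesis
    unfolding norm_diff_sqr by simp
qed

lemma orthosys_imp_bessel_system: "orthosys UNIV (v :: 'i \<Rightarrow> 'a::complex_hilbert) \<Longrightarrow> bessel_system v"
  unfolding bessel_system_def
proof (intro allI impI)
  fix x and F :: "'i set"
  assume "orthosys UNIV v" "finite F"
  from orthosys_bessel[OF this subset_UNIV, of x]
  show "(\<Sum>i\<in>F. (cmod (cinner x (v i)))\<^sup>2) \<le> (norm x)\<^sup>2"
    by (metis diff_ge_0_iff_ge zero_le_power2)
qed

lemma bessel_system_norm:
  assumes "bessel_system a"
  shows "norm (a i) \<le> 1"
proof (rule ccontr)
  assume "\<not> norm (a i) \<le> 1"
  then have *: "1 < (norm (a i))\<^sup>2"
    by (simp add: one_less_power)
  have "(\<Sum>j\<in>{i}. (cmod (cinner (a i) (a j)))\<^sup>2) \<le> (norm (a i))\<^sup>2"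
    using assms unfolding bessel_system_def by blast
  then have "((norm (a i))\<^sup>2)\<^sup>2 \<le> (norm (a i))\<^sup>2"
    by (simp add: cinner_self norm_power)
  with * show False
    by (metis mult_le_cancel_left2 not_le power2_eq_square zero_less_one order_less_trans)
qed

lemma bessel_system_summable:
  fixes a :: "nat \<Rightarrow> 'a::complex_hilbert"
  assumes "bessel_system a"
  shows "summable (\<lambda>n. (cmod (cinner x (a n)))\<^sup>2)"
  using assms unfolding bessel_system_def
  by (intro summableI_nonneg_bounded[where x = "(norm x)\<^sup>2"]) auto

text \<open>Pythagoras bounds each block of the series by the same block of the square sum, so the
  partial sums are Cauchy. The norm estimate is only an inequality since zero vectors drop their
  coefficients.\<close>

lemma orthosys_series:
  assumes u: "orthosys UNIV (u::nat \<Rightarrow> 'a::complex_hilbert)" and c: "summable (\<lambda>n. (cmod (c n))\<^sup>2)"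
  shows "summable (\<lambda>n. c n *\<^sub>C u n)"
    and "(norm (\<Sum>n. c n *\<^sub>C u n))\<^sup>2 \<le> (\<Sum>n. (cmod (c n))\<^sup>2)"
proof -
  have *: "(norm (\<Sum>n\<in>F. c n *\<^sub>C u n))\<^sup>2 \<le> (\<Sum>n\<in>F. (cmod (c n))\<^sup>2)" if "finite F" for F
  proof -
    have "(cmod (c n) * norm (u n))\<^sup>2 \<le> (cmod (c n))\<^sup>2" for n
      using orthosys_norm[OF u, of n] by (auto split: if_splits)
    then show ?thesis
      unfolding orthosys_norm_sum[OF u that subset_UNIV] by (intro sum_mono)
  qed
  show s: "summable (\<lambda>n. c n *\<^sub>C u n)"
    unfolding summable_Cauchy
  proof (intro allI impI)
    fix e :: real assume "0 < e"
    then obtain N where N: "\<And>m n. m \<ge> N \<Longrightarrow> norm (\<Sum>n=m..<n. (cmod (c n))\<^sup>2) < e\<^sup>2"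
      using c unfolding summable_Cauchy by (meson zero_less_power)
    have "norm (\<Sum>n=m..<n. c n *\<^sub>C u n) < e" if "m \<ge> N" for m n
    proof -
      have "(norm (\<Sum>n=m..<n. c n *\<^sub>C u n))\<^sup>2 < e\<^sup>2"
        using *[of "{m..<n}"] N[OF that, of n] by (simp add: sum_nonneg)
      then show ?thesis
        using \<open>0 < e\<close> by (simp add: power2_less_imp_less)
    qed
    then show "\<exists>N. \<forall>m\<ge>N. \<forall>n. norm (\<Sum>n=m..<n. c n *\<^sub>C u n) < e"
      by blast
  qed
  have "(\<lambda>N. (norm (\<Sum>n<N. c n *\<^sub>C u n))\<^sup>2) \<longlonglongrightarrow> (norm (\<Sum>n. c n *\<^sub>C u n))\<^sup>2"
    using summable_LIMSEQ[OF s] by (intro tendsto_intros)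
  then show "(norm (\<Sum>n. c n *\<^sub>C u n))\<^sup>2 \<le> (\<Sum>n. (cmod (c n))\<^sup>2)"
  proof (rule LIMSEQ_le_const2)
    show "\<exists>N. \<forall>n\<ge>N. (norm (\<Sum>i<n. c i *\<^sub>C u i))\<^sup>2 \<le> (\<Sum>n. (cmod (c n))\<^sup>2)"
      using *[OF finite_lessThan] sum_le_suminf[OF c] by (meson finite_lessThan order_trans zero_le_power2)
  qed
qed

section \<open>Riesz representation and orthonormal bases\<close>

text \<open>The first-order condition at an extremum: near 0 the linear term dominates the quadratic
  one. It is applied to the Riesz minimiser and to the norm maximiser.\<close>

lemma quadratic_nonneg_imp_zero:
  fixes a b :: real
  assumes "\<And>r. 0 \<le> a * r\<^sup>2 + 2 * b * r"
  shows "b = 0"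
proof (rule ccontr)
  assume "b \<noteq> 0"
  define c where "c = \<bar>a\<bar> + 1"
  have c: "c > 0" "a \<le> c" "a < 2 * c"
    by (auto simp: c_def)
  \<comment> \<open>The test point -b/c yields (b^2/c)(a/c - 2), which is negative because a <
    2c.\<close>
  have "0 \<le> a * (- b / c)\<^sup>2 + 2 * b * (- b / c)"
    by (rule assms)
  also have "\<dots> = (b\<^sup>2 / c) * (a / c - 2)"
    using c by (simp add: field_simps power2_eq_square)
  finally have "0 \<le> a / c - 2"
    using c \<open>b \<noteq> 0\<close> by (subst (asm) zero_le_mult_iff) (auto simp: divide_le_0_iff)
  then show False
    using c by (simp add: field_simps)
qed

text \<open>The minimiser of \<open>\<parallel>x\<parallel>\<^sup>2 - 2 \<phi> x\<close> over the subspace represents \<open>\<phi>\<close> there.  Taking the whole space gives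
  Riesz representation, taking \<open>\<phi> = \<langle>\<cdot>, z\<rangle>\<close> gives the orthogonal projection of \<open>z\<close>.\<close>

lemma riesz_closed_subspace:
  fixes S :: "'a::complex_hilbert set" and \<phi> :: "'a \<Rightarrow> real"
  assumes S: "subspace S" "closed S" and \<phi>: "bounded_linear \<phi>"
  obtains z where "z \<in> S" "\<And>h. h \<in> S \<Longrightarrow> \<phi> h = inner h z"
proof -
  interpret \<phi>: bounded_linear \<phi> by (rule \<phi>)
  define J where "J x = (norm x)\<^sup>2 - 2 * \<phi> x" for x
  define m where "m = Inf (J ` S)"
  obtain K where K: "\<And>x. norm (\<phi> x) \<le> norm x * K"
    using \<phi>.bounded by blast
  have "- K\<^sup>2 \<le> J x" for x
  proof -
    have "0 \<le> (norm x - K)\<^sup>2" by simp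
    then show ?thesis
      using K[of x] unfolding J_def by (simp add: power2_diff algebra_simps abs_le_iff)
  qed
  then have "bdd_below (J ` S)" by (rule bdd_belowI2)
  then have m_le: "m \<le> J x" if "x \<in> S" for x
    unfolding m_def using that by (simp add: cInf_lower)
  have "\<exists>x\<in>S. J x < m + 1 / Suc n" for n
  proof -
    have "J ` S \<noteq> {}" using subspace_0[OF S(1)] by blast
    from cInf_lessD[OF this, of "m + 1 / Suc n"] show ?thesis
      unfolding m_def by auto
  qed
  then obtain x where x: "\<And>n. x n \<in> S" "\<And>n. J (x n) < m + 1 / Suc n"
    by metis
  \<comment> \<open>In 2 J y + 2 J z minus four times the value at the midpoint the linear terms
    cancel and the parallelogram law remains. Hence near-minimisers are close to each other and a
    minimising sequence is Cauchy.\<close>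
  have parallelogram: "(norm (y - z))\<^sup>2 \<le> 2 * (J y - m) + 2 * (J z - m)" if "y \<in> S" "z \<in> S" for y z
  proof -
    let ?w = "(1/2) *\<^sub>R (y + z)"
    have "?w \<in> S" using that S(1) by (simp add: subspace_add subspace_scale)
    from m_le[OF this] have "m \<le> J ?w" .
    moreover have "(norm (y - z))\<^sup>2 = 2 * J y + 2 * J z - 4 * J ?w"
      unfolding J_def \<phi>.scaleR \<phi>.add power2_norm_eq_inner
      by (simp add: inner_add_left inner_add_right inner_diff_left inner_diff_right inner_commute field_simps)
    ultimately show ?thesis by simp
  qed
  have "Cauchy x"
  proof (rule metric_CauchyI)
    fix e :: real assume "0 < e"
    then obtain N :: nat where N: "4 / e\<^sup>2 < real N"
      using reals_Archimedean2 by blast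
    have "dist (x i) (x j) < e" if "i \<ge> N" "j \<ge> N" for i j
    proof -
      have *: "1 / real (Suc k) \<le> 1 / real (Suc N)" if "k \<ge> N" for k
        using that by (simp add: field_simps)
      have "(norm (x i - x j))\<^sup>2 \<le> 2 * (J (x i) - m) + 2 * (J (x j) - m)"
        by (rule parallelogram[OF x(1) x(1)])
      also have "\<dots> < 4 * (1 / real (Suc N))"
      proof -
        have "J (x i) - m < 1 / real (Suc N)" "J (x j) - m < 1 / real (Suc N)"
          using x(2)[of i] x(2)[of j] *[OF that(1)] *[OF that(2)] by simp_all
        then show ?thesis by (simp only: mult_2 flip: numeral_Bit0)
      qed
      also have "\<dots> \<le> e\<^sup>2"
        using N \<open>0 < e\<close> by (simp add: field_simps) (smt (verit) zero_le_power2)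
      finally show ?thesis
        unfolding dist_norm using \<open>0 < e\<close> by (simp add: power2_less_imp_less)
    qed
    then show "\<exists>N. \<forall>i\<ge>N. \<forall>j\<ge>N. dist (x i) (x j) < e" by blast
  qed
  then obtain z where z: "x \<longlonglongrightarrow> z"
    using Cauchy_convergent convergentD by blast
  have zS: "z \<in> S"
    using closed_sequentially[OF S(2) _ z] x(1) by blast
  have "(\<lambda>n. J (x n)) \<longlonglongrightarrow> J z"
    unfolding J_def by (intro tendsto_intros z \<phi>.tendsto)
  moreover have "(\<lambda>n. m + 1 / real (Suc n)) \<longlonglongrightarrow> m + 0"
    by (intro tendsto_intros LIMSEQ_Suc[OF lim_1_over_n])
  ultimately have Jz: "J z \<le> m"
    using x(2) by (intro LIMSEQ_le[of _ _ _ m]) (auto intro: less_imp_le)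
  have "\<phi> h = inner h z" if h: "h \<in> S" for h
  proof -
    have "inner h z - \<phi> h = 0"
    proof (rule quadratic_nonneg_imp_zero)
      fix r
      have "J z \<le> J (z + r *\<^sub>R h)"
        using Jz m_le[of "z + r *\<^sub>R h"] zS h S(1) by (simp add: subspace_add subspace_scale)
      then show "0 \<le> (norm h)\<^sup>2 * r\<^sup>2 + 2 * (inner h z - \<phi> h) * r"
        unfolding J_def \<phi>.scaleR \<phi>.add power2_norm_eq_inner
        by (simp add: inner_add_left inner_add_right inner_commute power2_eq_square algebra_simps)
    qed
    then show ?thesis by simp
  qed
  with zS show ?thesis using that by blast
qed

text \<open>Applying a real argument to \<open>\<i> *\<^sub>C x\<close> as well as to
  \<open>x\<close> thus yields the complex statement; Riesz representation and projections are
  lifted this way.\<close>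

lemma inner_imaginary: "Im (cinner x y) = - inner (\<i> *\<^sub>C x) (y::'a::complex_hilbert)"
  by (simp add: inner_eq_Re_cinner cinner_scaleC_left)

text \<open>Existence for the \<open>THE\<close> in \<open>cadjoint\<close>: Riesz represents the
  real functional \<open>inner (A h) y\<close>, and complex linearity of \<open>A\<close> extends
  the identity to the imaginary part.\<close>

lemma cinner_cadjoint:
  fixes A :: "'a::complex_hilbert \<Rightarrow> 'a"
  assumes A: "bounded_clinear A"
  shows "cinner (A x) y = cinner x (cadjoint A y)"
proof -
  have "\<exists>z. \<forall>h. cinner (A h) y = cinner h z" for y
  proof -
    have "bounded_linear (\<lambda>h. inner (A h) y)"
      using bounded_clinearD(1)[OF A] bounded_linear_inner_left_comp by blast
    then obtain z where "\<And>h. inner (A h) y = inner h z"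
      using riesz_closed_subspace[of UNIV "\<lambda>h. inner (A h) y"] by auto
    then have "cinner (A h) y = cinner h z" for h
      by (simp add: complex_eq_iff inner_imaginary bounded_clinearD(2)[OF A, symmetric] flip: inner_eq_Re_cinner)
    then show ?thesis by blast
  qed
  then obtain B where "\<And>h y. cinner (A h) y = cinner h (B y)"
    by metis
  then show ?thesis
    using cadjoint_eqI[of A B] by simp
qed

text \<open>The vector is the difference between a point outside the closure and its projection onto
  it. Real orthogonality to both \<open>h\<close> and \<open>\<i> *\<^sub>C h\<close> gives complex
  orthogonality.\<close>

lemma orthogonal_to_proper_subspace:
  fixes S :: "'a::complex_hilbert set"
  assumes S: "complex_vector.subspace S" and "closure S \<noteq> UNIV"
  obtains z where "z \<noteq> 0" "\<And>h. h \<in> S \<Longrightarrow> cinner h z = 0"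
proof -
  from assms(2) obtain x where x: "x \<notin> closure S" by blast
  have "subspace S"
    using S unfolding complex_vector.subspace_def subspace_def by (metis scaleC_of_real)
  have "subspace (closure S)"
  proof (rule subspaceI)
    show "0 \<in> closure S"
      using subspace_0[OF \<open>subspace S\<close>] closure_subset by blast
    show "x + y \<in> closure S" if xy: "x \<in> closure S" "y \<in> closure S" for x y
    proof -
      obtain f g where "\<And>n::nat. f n \<in> S" "f \<longlonglongrightarrow> x" "\<And>n::nat. g n \<in> S" "g \<longlonglongrightarrow> y"
        using xy unfolding closure_sequential by blast
      then have "\<And>n. f n + g n \<in> S" "(\<lambda>n. f n + g n) \<longlonglongrightarrow> x + y"
        by (auto intro: subspace_add[OF \<open>subspace S\<close>] tendsto_add)
      then show ?thesis unfolding closure_sequential by (intro exI[of _ "\<lambda>n. f n + g n"]) auto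
    qed
    show "c *\<^sub>R x \<in> closure S" if x: "x \<in> closure S" for c x
    proof -
      obtain f where "\<And>n::nat. f n \<in> S" "f \<longlonglongrightarrow> x"
        using x unfolding closure_sequential by blast
      then have "\<And>n. c *\<^sub>R f n \<in> S" "(\<lambda>n. c *\<^sub>R f n) \<longlonglongrightarrow> c *\<^sub>R x"
        by (auto intro: subspace_scale[OF \<open>subspace S\<close>] tendsto_intros)
      then show ?thesis unfolding closure_sequential by (intro exI[of _ "\<lambda>n. c *\<^sub>R f n"]) auto
    qed
  qed
  then obtain p where p: "p \<in> closure S" "\<And>h. h \<in> closure S \<Longrightarrow> inner h x = inner h p"
    using riesz_closed_subspace[of "closure S" "\<lambda>h. inner h x"] bounded_linear_inner_left by auto
  have in_S: "inner h (x - p) = 0" if "h \<in> S" for h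
    using p(2)[of h] that closure_subset by (auto simp: inner_diff_right)
  show thesis
  proof
    show "x - p \<noteq> 0" using p(1) x by auto
    show "cinner h (x - p) = 0" if "h \<in> S" for h
      using in_S[OF that] in_S[of "\<i> *\<^sub>C h"] S that
      by (simp add: complex_eq_iff inner_imaginary complex_vector.subspace_def flip: inner_eq_Re_cinner)
  qed
qed

text \<open>The \<open>SOME\<close> in \<open>trace_op\<close> needs a basis. Zorn's lemma gives a
  maximal orthonormal set; were its span not dense, a unit vector orthogonal to the span could be
  added.\<close>

lemma orthonormal_basis_exists: "\<exists>E::'a::complex_hilbert set. orthonormal_basis E"
proof -
  define A where "A = {E::'a set. \<forall>e\<in>E. \<forall>f\<in>E. cinner e f = (if e = f then 1 else 0)}"
  have "\<exists>M\<in>A. \<forall>X\<in>A. M \<subseteq> X \<longrightarrow> X = M"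
  proof (rule subset_Zorn')
    fix C assume C: "subset.chain A C"
    have "cinner e f = (if e = f then 1 else 0)" if "e \<in> \<Union>C" "f \<in> \<Union>C" for e f
    proof -
      from that obtain X Y where "e \<in> X" "X \<in> C" "f \<in> Y" "Y \<in> C" by blast
      then obtain Z where "Z \<in> C" "e \<in> Z" "f \<in> Z"
        using C unfolding subset_chain_def by (metis subsetD)
      then show ?thesis
        using C unfolding subset_chain_def A_def by blast
    qed
    then show "\<Union>C \<in> A" unfolding A_def by blast
  qed
  then obtain M where M: "M \<in> A" and max: "\<And>X. X \<in> A \<Longrightarrow> M \<subseteq> X \<Longrightarrow> X = M" by blast
  have "closure (complex_vector.span M) = UNIV"
  proof (rule ccontr)
    assume "\<not> ?thesis"
    then obtain z where z: "z \<noteq> 0" "\<And>h. h \<in> complex_vector.span M \<Longrightarrow> cinner h z = 0"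
      using orthogonal_to_proper_subspace[OF complex_vector.subspace_span] by metis
    define e where "e = (1 / norm z) *\<^sub>R z"
    have e: "cinner e e = 1"
      using z(1) by (simp add: cinner_self e_def)
    have ortho: "cinner h e = 0" "cinner e h = 0" if "h \<in> M" for h
      using z(2)[of h] that cinner_eq_0_commute[of h e]
      by (auto simp: e_def cinner_scaleR_right complex_vector.span_base)
    have "insert e M \<in> A"
      using M e ortho by (auto simp: A_def)
    then have "e \<in> M" using max by blast
    then show False using ortho e by force
  qed
  then show ?thesis
    using M unfolding orthonormal_basis_def A_def by blast
qed

lemma orthonormal_basis_orthosys: "orthonormal_basis E \<Longrightarrow> orthosys E (\<lambda>e. e)"
  unfolding orthonormal_basis_def orthosys_def by (metis cinner_zero_left zero_neq_one)

text \<open>Density provides one approximation \<open>y\<close> from the span of a finite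
  \<open>T\<close>. For every finite \<open>F\<close> containing \<open>T\<close> the Fourier sum is
  the best approximation from the span of \<open>F\<close>, hence at least as good as
  \<open>y\<close>.\<close>

lemma orthonormal_basis_expansion:
  fixes E :: "'a::complex_hilbert set"
  assumes E: "orthonormal_basis E"
  shows "((\<lambda>F. \<Sum>e\<in>F. cinner x e *\<^sub>C e) \<longlongrightarrow> x) (finite_subsets_at_top E)"
proof (rule tendstoI)
  fix \<epsilon> :: real assume "0 < \<epsilon>"
  have "x \<in> closure (complex_vector.span E)"
    using E by (simp add: orthonormal_basis_def)
  then obtain y where "y \<in> complex_vector.span E" and dist: "dist y x < \<epsilon>"
    using \<open>0 < \<epsilon>\<close> closure_approachable by blast
  then obtain T c where T: "finite T" "T \<subseteq> E" and y: "y = (\<Sum>e\<in>T. c e *\<^sub>C e)"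
    unfolding complex_vector.span_explicit by blast
  note sys = orthonormal_basis_orthosys[OF E]
  have "dist (\<Sum>e\<in>F. cinner x e *\<^sub>C e) x < \<epsilon>" if F: "finite F" "T \<subseteq> F" "F \<subseteq> E" for F
  proof -
    define P where "P = (\<Sum>e\<in>F. cinner x e *\<^sub>C e)"
    define d where "d e = cinner x e - (if e \<in> T then c e else 0)" for e
    have ortho: "cinner (x - P) e = 0" if "e \<in> F" for e
    proof -
      have "cinner P e = (\<Sum>f\<in>F. if f = e then cinner x e else 0)"
        unfolding P_def cinner_sum_left
        by (intro sum.cong refl)
           (use F E that in \<open>auto simp: cinner_scaleC_left orthonormal_basis_def subset_iff\<close>)
      then show ?thesis
        using F that by (simp add: cinner_diff_left)
    qed
    have "y = (\<Sum>e\<in>F. (if e \<in> T then c e else 0) *\<^sub>C e)"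
      unfolding y by (rule sum.mono_neutral_cong_left) (use F in auto)
    then have diff: "P - y = (\<Sum>e\<in>F. d e *\<^sub>C e)"
      unfolding P_def d_def by (simp add: complex_vector.scale_left_diff_distrib sum_subtractf)
    have "cinner (x - P) (P - y) = 0"
      unfolding diff cinner_sum_right cinner_scaleC_right using ortho by simp
    then have "(norm (x - y))\<^sup>2 = (norm (x - P))\<^sup>2 + (norm (P - y))\<^sup>2"
      using norm_add_sqr[of "x - P" "P - y"] by simp
    then have "(norm (x - P))\<^sup>2 \<le> (norm (x - y))\<^sup>2"
      using zero_le_power2[of "norm (P - y)"] by linarith
    then have "norm (x - P) \<le> norm (x - y)"
      by (rule power2_le_imp_le) simp
    then show ?thesis
      using dist unfolding P_def by (simp add: dist_norm norm_minus_commute)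
  qed
  then show "\<forall>\<^sub>F F in finite_subsets_at_top E. dist (\<Sum>e\<in>F. cinner x e *\<^sub>C e) x < \<epsilon>"
    unfolding eventually_finite_subsets_at_top using T by (intro exI[of _ T]) simp
qed

section \<open>Singular value decomposition\<close>

text \<open>A diagonal operator between two orthogonal systems. One formula covers \<open>X\<close>,
  its adjoint, the powers of |X|, the partial isometry (all coefficients 1) and U|X|^r.\<close>

definition dop :: "(nat \<Rightarrow> real) \<Rightarrow> (nat \<Rightarrow> 'a::complex_hilbert) \<Rightarrow> (nat \<Rightarrow> 'a) \<Rightarrow> 'a \<Rightarrow> 'a"
  where "dop c v u x = (\<Sum>n. (of_real (c n) * cinner x (v n)) *\<^sub>C u n)"

context
  fixes c :: "nat \<Rightarrow> real" and v u :: "nat \<Rightarrow> 'a::complex_hilbert" and C :: real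
  assumes v: "orthosys UNIV v" and u: "orthosys UNIV u" and c: "\<forall>n. \<bar>c n\<bar> \<le> C"
begin

lemma dop_coeff_le: "(cmod (of_real (c n) * cinner x (v n)))\<^sup>2 \<le> C\<^sup>2 * (cmod (cinner x (v n)))\<^sup>2"
  using spec[OF c, of n] by (auto simp: norm_mult power_mult_distrib intro!: mult_right_mono power_mono[of "\<bar>c n\<bar>" C 2, simplified])

lemma dop_coeff_summable: "summable (\<lambda>n. (cmod (of_real (c n) * cinner x (v n)))\<^sup>2)"
  by (rule summable_comparison_test'[OF summable_mult[OF bessel_system_summable[OF orthosys_imp_bessel_system[OF v]]], of 0])
     (use dop_coeff_le in simp)

lemma dop_sums: "(\<lambda>n. (of_real (c n) * cinner x (v n)) *\<^sub>C u n) sums dop c v u x"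
  unfolding dop_def by (intro summable_sums orthosys_series(1)[OF u dop_coeff_summable])

lemma norm_dop_le: "norm (dop c v u x) \<le> C * norm x"
proof (rule power2_le_imp_le)
  note b = orthosys_imp_bessel_system[OF v]
  have "(norm (dop c v u x))\<^sup>2 \<le> (\<Sum>n. (cmod (of_real (c n) * cinner x (v n)))\<^sup>2)"
    unfolding dop_def by (rule orthosys_series(2)[OF u dop_coeff_summable])
  also have "\<dots> \<le> (\<Sum>n. C\<^sup>2 * (cmod (cinner x (v n)))\<^sup>2)"
    by (intro suminf_le dop_coeff_le dop_coeff_summable summable_mult bessel_system_summable b)
  also have "\<dots> = C\<^sup>2 * (\<Sum>n. (cmod (cinner x (v n)))\<^sup>2)"
    by (intro suminf_mult bessel_system_summable b)
  also have "\<dots> \<le> C\<^sup>2 * (norm x)\<^sup>2"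
    using b unfolding bessel_system_def
    by (intro mult_left_mono suminf_le_const bessel_system_summable[OF b]) auto
  finally show "(norm (dop c v u x))\<^sup>2 \<le> (C * norm x)\<^sup>2"
    by (simp add: power_mult_distrib)
  show "0 \<le> C * norm x"
    using spec[OF c, of 0] by simp
qed

lemma dop_clinear: "bounded_clinear (dop c v u)"
  unfolding bounded_clinear_def
proof (intro conjI allI)
  have add: "dop c v u (x + y) = dop c v u x + dop c v u y" for x y
    using sums_add[OF dop_sums[of x] dop_sums[of y]] dop_sums[of "x + y"]
    by (intro sums_unique2[of _ "dop c v u (x + y)"])
       (simp_all add: cinner_add_left ring_distribs scaleC_add_left)
  show scale: "dop c v u (a *\<^sub>C x) = a *\<^sub>C dop c v u x" for a x
    using bounded_linear.sums[OF bounded_linear_scaleC_right dop_sums[of x], of a] dop_sums[of "a *\<^sub>C x"]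
    by (intro sums_unique2[of _ "dop c v u (a *\<^sub>C x)"])
       (simp_all add: cinner_scaleC_left scaleC_scaleC mult_ac)
  show "bounded_linear (dop c v u)"
    using norm_dop_le
    by (intro bounded_linear_intro[where K = C])
       (simp_all add: add scale scaleC_of_real[symmetric] mult.commute)
qed

lemma dop_cinner_sums:
  "(\<lambda>n. of_real (c n) * cinner x (v n) * cinner (u n) y) sums cinner (dop c v u x) y"
  using bounded_linear.sums[OF bounded_linear_cinner_left dop_sums[of x], of y]
  by (simp add: cinner_scaleC_left)

lemma cinner_dop_sums:
  "(\<lambda>n. of_real (c n) * cinner (v n) x * cinner y (u n)) sums cinner y (dop c v u x)"
  using bounded_linear.sums[OF bounded_linear_cinner_right dop_sums[of x], of y]
  by (simp add: cinner_scaleC_right cinner_commute[of x, symmetric] cinner_commute[of "v _" x, symmetric])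

lemma dop_cinner_basis:
  "cinner (dop c v u x) (u n) = (if u n = 0 then 0 else of_real (c n) * cinner x (v n))"
proof -
  have "(\<lambda>k. of_real (c k) * cinner x (v k) * cinner (u k) (u n)) sums
      (if u n = 0 then 0 else of_real (c n) * cinner x (v n))"
  proof -
    have "(\<lambda>k. of_real (c k) * cinner x (v k) * cinner (u k) (u n)) =
       (\<lambda>k. if k = n then (if u n = 0 then 0 else of_real (c n) * cinner x (v n)) else 0)"
      by (auto simp: orthosysD[OF u])
    then show ?thesis
      using sums_single[of n "\<lambda>_. if u n = 0 then 0 else of_real (c n) * cinner x (v n)"] by simp
  qed
  then show ?thesis
    using dop_cinner_sums sums_unique2 by blast
qed

lemma dop_basis: "dop c v u (v n) = (if v n = 0 then 0 else c n *\<^sub>R u n)"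
proof -
  have "(\<lambda>k. (of_real (c k) * cinner (v n) (v k)) *\<^sub>C u k) =
       (\<lambda>k. if k = n then (if v n = 0 then 0 else c n *\<^sub>R u n) else 0)"
    by (auto simp: orthosysD[OF v] scaleC_of_real)
  then show ?thesis
    using sums_single[of n "\<lambda>_. if v n = 0 then 0 else c n *\<^sub>R u n"] dop_sums[of "v n"]
    by (simp add: sums_unique2)
qed

end

section \<open>Adjoints and products of diagonal operators\<close>

lemma dop_adjoint:
  assumes "orthosys UNIV v" "orthosys UNIV u" "\<forall>n. \<bar>c n\<bar> \<le> C"
  shows "cinner (dop c v u x) y = cinner x (dop c u v y)"
  using dop_cinner_sums[OF assms] cinner_dop_sums[OF assms(2,1,3)]
  by (intro sums_unique2[of _ "cinner (dop c v u x) y"]) (simp_all add: mult_ac)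

text \<open>Where \<open>u n\<close> is zero the coefficient of the inner operator is lost, so
  \<open>w n\<close> has to vanish there too.\<close>

lemma dop_dop:
  assumes v: "orthosys UNIV v" and u: "orthosys UNIV u" and "\<forall>n. \<bar>d n\<bar> \<le> C"
    and "\<And>n. u n = 0 \<Longrightarrow> w n = 0"
  shows "dop c u w (dop d v u x) = dop (\<lambda>n. c n * d n) v w x"
  unfolding dop_def[of c] dop_def[of "\<lambda>n. c n * d n"]
  using assms by (intro suminf_cong) (auto simp: dop_cinner_basis[OF v u, of d C] mult_ac)

text \<open>A singular value decomposition. Finite rank is covered by padding with zeros, and the
  vectors vanish at exactly the padded indices, so that \<open>dop (\<lambda>n. 1) v u\<close> is
  the partial isometry between the supports.\<close>

definition svd :: "('a::complex_hilbert \<Rightarrow> 'a) \<Rightarrow> (nat \<Rightarrow> real) \<Rightarrow> (nat \<Rightarrow> 'a) \<Rightarrow> (nat \<Rightarrow> 'a) \<Rightarrow> bool"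
  where "svd X s v u \<longleftrightarrow> orthosys UNIV v \<and> orthosys UNIV u \<and> (\<forall>n. 0 \<le> s n) \<and> decseq s \<and> s \<longlonglongrightarrow> 0 \<and>
    (\<forall>n. v n = 0 \<longleftrightarrow> s n = 0) \<and> (\<forall>n. u n = 0 \<longleftrightarrow> s n = 0) \<and> X = dop s v u"

text \<open>Compactness makes the images of a maximising sequence converge along a subsequence, but
  not yet the vectors. If two images are near the same vector of norm \<open>k\<close>, then
  \<open>norm (X (w i + w j))\<close> is near \<open>2 * k\<close>, which forces
  \<open>norm (w i + w j)\<close> near 2; by the parallelogram law the vectors are close. When
  \<open>X\<close> vanishes on \<open>M\<close>, the value 0 is returned, which later supplies the
  padding.\<close>

lemma compact_operator_attains_norm:
  fixes X :: "'a::complex_hilbert \<Rightarrow> 'a"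
  assumes X: "compact_operator X" and M: "subspace M" "closed M"
  obtains r where "r \<in> M" "r \<noteq> 0 \<Longrightarrow> norm r = 1" "\<And>x. x \<in> M \<Longrightarrow> norm (X x) \<le> norm (X r) * norm x"
    "X r = 0 \<Longrightarrow> r = 0"
proof (cases "\<forall>x\<in>M. X x = 0")
  case True
  then show thesis
    using that[of 0] subspace_0[OF M(1)] by auto
next
  case False
  have lin: "bounded_clinear X" and comp: "compact (closure (X ` cball 0 1))"
    using X by (auto simp: compact_operator_def)
  note X = bounded_clinearD[OF lin]
  define S where "S = {x\<in>M. norm x = 1}"
  define k where "k = Sup ((\<lambda>x. norm (X x)) ` S)"
  have unit: "(1 / norm x) *\<^sub>R x \<in> S" if "x \<in> M" "x \<noteq> 0" for x
    using that subspace_scale[OF M(1)] by (simp add: S_def)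
  have "norm (X x) \<le> onorm X" if "x \<in> S" for x
    using bounded_clinear_onorm[OF lin, of x] that by (simp add: S_def)
  then have bdd: "bdd_above ((\<lambda>x. norm (X x)) ` S)"
    by (rule bdd_aboveI2)
  have k: "norm (X x) \<le> k * norm x" if "x \<in> M" for x
  proof (cases "x = 0")
    case False
    have "norm (X ((1 / norm x) *\<^sub>R x)) \<le> k"
      unfolding k_def by (rule cSUP_upper[OF unit[OF that False] bdd])
    with False show ?thesis
      by (simp add: X(6) field_simps)
  qed (simp add: X(5))
  obtain x0 where x0: "x0 \<in> M" "X x0 \<noteq> 0" using False by blast
  then have "x0 \<noteq> 0" using X(5) by auto
  then have "S \<noteq> {}" using unit x0(1) by blast
  have "0 < k"
    using k[OF x0(1)] x0(2) by (smt (verit) mult_nonpos_nonneg norm_ge_zero zero_less_norm_iff)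
  have "\<exists>x\<in>S. k - 1 / Suc n < norm (X x)" for n
    using less_cSUP_iff[OF \<open>S \<noteq> {}\<close> bdd, of "k - 1 / Suc n"] unfolding k_def by simp
  then obtain x where x: "\<And>n. x n \<in> S" "\<And>n. k - 1 / Suc n < norm (X (x n))"
    by metis
  have "X (x n) \<in> closure (X ` cball 0 1)" for n
    using x(1)[of n] closure_subset by (fastforce simp: S_def)
  then obtain y \<phi> where \<phi>: "strict_mono \<phi>" and y: "((\<lambda>n. X (x n)) \<circ> \<phi>) \<longlonglongrightarrow> y"
    using compact_imp_seq_compact[OF comp] unfolding seq_compact_def by metis
  define w where "w n = x (\<phi> n)" for n
  have Xw: "(\<lambda>n. X (w n)) \<longlonglongrightarrow> y"
    using y by (simp add: w_def o_def)
  have w: "w n \<in> M" "norm (w n) = 1" for n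
    using x(1)[of "\<phi> n"] by (auto simp: w_def S_def)
  have norm_y: "norm y = k"
  proof (rule LIMSEQ_unique)
    show "(\<lambda>n. norm (X (w n))) \<longlonglongrightarrow> norm y"
      by (intro tendsto_norm Xw)
    have "(\<lambda>n. k - 1 / real (Suc n)) \<longlonglongrightarrow> k - 0"
      by (intro tendsto_intros LIMSEQ_Suc[OF lim_1_over_n])
    note LIMSEQ_subseq_LIMSEQ[OF this \<phi>]
    then have "(\<lambda>n. k - 1 / real (Suc (\<phi> n))) \<longlonglongrightarrow> k" by (simp add: o_def)
    show "(\<lambda>n. norm (X (w n))) \<longlonglongrightarrow> k"
    proof (rule tendsto_sandwich[OF _ _ \<open>(\<lambda>n. k - 1 / real (Suc (\<phi> n))) \<longlonglongrightarrow> k\<close> tendsto_const])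
      show "\<forall>\<^sub>F n in sequentially. k - 1 / real (Suc (\<phi> n)) \<le> norm (X (w n))"
        using x(2) by (intro always_eventually) (auto simp: w_def intro: less_imp_le)
      show "\<forall>\<^sub>F n in sequentially. norm (X (w n)) \<le> k"
        using k[OF w(1)] w(2) by (intro always_eventually) simp
    qed
  qed
  have "Cauchy w"
  proof (rule metric_CauchyI)
    fix e :: real assume "0 < e"
    \<comment> \<open>The 16 makes the product of the two later factors, 2\<delta> and 4k, equal to
      k^2 e^2 / 2.\<close>
    define \<delta> where "\<delta> = k * e\<^sup>2 / 16"
    have "0 < \<delta>" using \<open>0 < e\<close> \<open>0 < k\<close> by (simp add: \<delta>_def)
    then obtain N where N: "\<And>n. n \<ge> N \<Longrightarrow> dist (X (w n)) y < \<delta>"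
      using Xw by (meson lim_sequentially)
    have "dist (w i) (w j) < e" if "i \<ge> N" "j \<ge> N" for i j
    proof -
      let ?z = "X (w i) + X (w j)"
      have "norm (2 *\<^sub>R y) \<le> norm ?z + norm (y - X (w i)) + norm (y - X (w j))"
        by (rule order_trans[OF _ add_mono[OF norm_triangle_ineq order_refl]],
            rule order_trans[OF _ norm_triangle_ineq]) (simp add: scaleR_2)
      then have lower: "2 * k - norm ?z \<le> 2 * \<delta>"
        using N[OF that(1)] N[OF that(2)] norm_y by (simp add: dist_norm norm_minus_commute)
      have upper: "norm ?z \<le> 2 * k"
        using norm_triangle_ineq[of "X (w i)" "X (w j)"] k[OF w(1)[of i]] k[OF w(1)[of j]] w(2) by simp
      have "(norm ?z)\<^sup>2 \<le> (k * norm (w i + w j))\<^sup>2"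
        using k[of "w i + w j"] subspace_add[OF M(1) w(1) w(1)] by (intro power_mono) (auto simp: X(3))
      also have "\<dots> = k\<^sup>2 * (4 - (norm (w i - w j))\<^sup>2)"
        unfolding power_mult_distrib norm_add_sqr norm_diff_sqr by (simp add: w(2))
      finally have "k\<^sup>2 * (norm (w i - w j))\<^sup>2 \<le> (2 * k)\<^sup>2 - (norm ?z)\<^sup>2"
        by (simp add: algebra_simps power2_eq_square)
      also have "\<dots> = (2 * k - norm ?z) * (2 * k + norm ?z)"
        by (simp add: algebra_simps power2_eq_square)
      also have "\<dots> \<le> (2 * \<delta>) * (4 * k)"
        using lower upper \<open>0 < \<delta>\<close> \<open>0 < k\<close> by (intro mult_mono) auto
      also have "\<dots> = k\<^sup>2 * (e\<^sup>2 / 2)"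
        by (simp add: \<delta>_def power2_eq_square)
      finally have "(norm (w i - w j))\<^sup>2 \<le> e\<^sup>2 / 2"
        using \<open>0 < k\<close> by (simp add: mult_le_cancel_left)
      also have "\<dots> < e\<^sup>2" using \<open>0 < e\<close> by simp
      finally show ?thesis
        unfolding dist_norm using \<open>0 < e\<close> by (simp add: power2_less_imp_less)
    qed
    then show "\<exists>N. \<forall>i\<ge>N. \<forall>j\<ge>N. dist (w i) (w j) < e" by blast
  qed
  then obtain r where r: "w \<longlonglongrightarrow> r"
    using Cauchy_convergent convergentD by blast
  have "X r = y"
    using bounded_linear.tendsto[OF X(1) r] Xw LIMSEQ_unique by blast
  moreover have "r \<in> M"
    using closed_sequentially[OF M(2) _ r] w(1) by blast
  moreover have "norm r = 1"
    using tendsto_norm[OF r] by (simp add: w(2) LIMSEQ_const_iff)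
  ultimately show thesis
    using that[of r] k norm_y \<open>0 < k\<close> by auto
qed

text \<open>Comparing \<open>r\<close> with \<open>r - t *\<^sub>R x\<close> gives a nonnegative
  quadratic in \<open>t\<close>, whose linear coefficient is the real part in question;
  \<open>\<i> *\<^sub>C x\<close> supplies the imaginary part.\<close>

lemma norm_maximiser_orthogonal:
  fixes X :: "'a::complex_hilbert \<Rightarrow> 'a"
  assumes X: "bounded_clinear X" and M: "complex_vector.subspace M" "r \<in> M" "norm r = 1"
    and max: "\<And>x. x \<in> M \<Longrightarrow> norm (X x) \<le> norm (X r) * norm x"
    and x: "x \<in> M" "cinner x r = 0"
  shows "cinner (X x) (X r) = 0"
proof -
  note X = bounded_clinearD[OF X]
  have Re: "Re (cinner (X x) (X r)) = 0" if x: "x \<in> M" "cinner x r = 0" for x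
  proof (rule quadratic_nonneg_imp_zero)
    fix t :: real
    have x': "inner x r = 0" using x(2) by (simp add: inner_eq_Re_cinner)
    have "(norm (X (r - t *\<^sub>R x)))\<^sup>2 \<le> (norm (X r) * norm (r - t *\<^sub>R x))\<^sup>2"
      using M x(1) max[of "r - t *\<^sub>R x"]
      by (intro power_mono) (auto simp: complex_vector.subspace_diff complex_vector.subspace_scale simp flip: scaleC_of_real)
    also have "\<dots> = (norm (X r))\<^sup>2 * (1 + t\<^sup>2 * (norm x)\<^sup>2)"
      using M(3) x' unfolding power_mult_distrib norm_diff_sqr inner_eq_Re_cinner[symmetric]
      by (simp add: inner_commute power_mult_distrib)
    finally have "(norm (X r - t *\<^sub>R X x))\<^sup>2 \<le> (norm (X r))\<^sup>2 * (1 + t\<^sup>2 * (norm x)\<^sup>2)"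
      by (simp add: X)
    then show "0 \<le> ((norm (X r))\<^sup>2 * (norm x)\<^sup>2 - (norm (X x))\<^sup>2) * t\<^sup>2 + 2 * Re (cinner (X x) (X r)) * t"
      unfolding norm_diff_sqr inner_eq_Re_cinner[symmetric]
      by (simp add: inner_commute power_mult_distrib algebra_simps)
  qed
  have "Re (cinner (X (\<i> *\<^sub>C x)) (X r)) = 0"
    using Re[of "\<i> *\<^sub>C x"] x M by (simp add: cinner_scaleC_left complex_vector.subspace_scale)
  then show ?thesis
    using Re[OF x] by (simp add: X(2) cinner_scaleC_left complex_eq_iff)
qed

text \<open>Each \<open>v n\<close> maximises the norm of the image on the orthogonal complement of
  its predecessors. Maximality makes the images orthogonal too, so normalising them gives
  \<open>u\<close>.\<close>

theorem compact_operator_svd: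
  fixes X :: "'a::complex_hilbert \<Rightarrow> 'a"
  assumes comp: "compact_operator X"
  obtains s v u where "svd X s v u"
proof -
  have lin: "bounded_clinear X" and compact: "compact (closure (X ` cball 0 1))"
    using comp by (auto simp: compact_operator_def)
  note X = bounded_clinearD[OF lin]
  \<comment> \<open>The complement of the first \<open>n\<close> vectors depends on \<open>f\<close>
    only below \<open>n\<close>, as the well-founded choice requires.\<close>
  define M where "M f n = {x. \<forall>m<n. cinner x (f m :: 'a) = 0}" for f and n :: nat
  define P where "P f n r \<longleftrightarrow> r \<in> M f n \<and> (r \<noteq> 0 \<longrightarrow> norm r = 1) \<and>
    (\<forall>x\<in>M f n. norm (X x) \<le> norm (X r) * norm x) \<and> (X r = 0 \<longrightarrow> r = 0)" for f n r
  have sub: "complex_vector.subspace (M f n)" for f n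
    unfolding M_def complex_vector.subspace_def by (auto simp: cinner_add_left cinner_scaleC_left)
  have "\<exists>v. \<forall>n. P v n (v n)"
  proof (rule dependent_wf_choice[OF wf_less_than])
    show "P f n r = P g n r" if "\<And>m. (m, n) \<in> less_than \<Longrightarrow> f m = g m" for f g n r
    proof -
      have "M f n = M g n" using that by (auto simp: M_def)
      then show ?thesis by (simp add: P_def)
    qed
    show "\<exists>r. P f n r" for n f
    proof -
      have "subspace (M f n)"
        using sub[of f n] unfolding complex_vector.subspace_def subspace_def by (metis scaleC_of_real)
      moreover have "closed (M f n)"
      proof -
        have "M f n = (\<Inter>m\<in>{..<n}. (\<lambda>x. cinner x (f m)) -` {0})"
          by (auto simp: M_def)
        then show ?thesis
          by (auto intro!: closed_INT continuous_closed_vimage linear_continuous_at bounded_linear_cinner_left)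
      qed
      ultimately obtain r where "r \<in> M f n" "r \<noteq> 0 \<Longrightarrow> norm r = 1"
        "\<And>x. x \<in> M f n \<Longrightarrow> norm (X x) \<le> norm (X r) * norm x" "X r = 0 \<Longrightarrow> r = 0"
        using compact_operator_attains_norm[OF comp] by blast
      then show ?thesis unfolding P_def by blast
    qed
  qed
  then obtain v where Pv: "\<And>n. P v n (v n)" by blast
  define s where "s n = norm (X (v n))" for n
  define u where "u n = (1 / s n) *\<^sub>R X (v n)" for n
  have vM: "v n \<in> M v n" and v1: "v n \<noteq> 0 \<Longrightarrow> norm (v n) = 1" and Xv0: "X (v n) = 0 \<Longrightarrow> v n = 0"
    and max: "x \<in> M v n \<Longrightarrow> norm (X x) \<le> s n * norm x" for n x
    using Pv[of n] unfolding P_def s_def by auto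
  have M_mono: "M v n \<subseteq> M v m" if "m \<le> n" for m n
    using that by (auto simp: M_def)
  have v_le: "norm (v n) \<le> 1" for n
    using v1[of n] by (cases "v n = 0") auto
  have s0: "s n = 0 \<longleftrightarrow> v n = 0" for n
    using Xv0 X(5) by (auto simp: s_def)
  have v_ortho: "cinner (v n) (v m) = 0" if "n \<noteq> m" for n m
  proof (cases "m < n")
    case True then show ?thesis using vM[of n] by (simp add: M_def)
  next
    case False
    then have "cinner (v m) (v n) = 0" using vM[of m] that by (simp add: M_def)
    then show ?thesis using cinner_eq_0_commute by blast
  qed
  have v: "orthosys UNIV v"
    unfolding orthosys_def using v_ortho v1 by (auto simp: cinner_self)
  have Xv_ortho': "cinner (X (v n)) (X (v m)) = 0" if "m < n" for n m
  proof (cases "v m = 0")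
    case False
    show ?thesis
      by (rule norm_maximiser_orthogonal[OF lin sub[of v m] vM v1[OF False]])
         (use max[of _ m] M_mono[of m n] vM[of n] that v_ortho[of n m] in \<open>auto simp: s_def\<close>)
  qed (simp add: X(5))
  have Xv_ortho: "cinner (X (v n)) (X (v m)) = 0" if "n \<noteq> m" for n m
    using Xv_ortho'[of m n] Xv_ortho'[of n m] cinner_eq_0_commute that by (metis nat_neq_iff)
  have u: "orthosys UNIV u"
    unfolding orthosys_def u_def using Xv_ortho
    by (auto simp: cinner_scaleR_left cinner_scaleR_right cinner_self s_def power2_eq_square)
  have dec: "decseq s"
  proof (rule decseq_SucI)
    fix n
    have "v (Suc n) \<in> M v n" using M_mono[of n "Suc n"] vM by auto
    from max[OF this] have "s (Suc n) \<le> s n * norm (v (Suc n))" by (simp add: s_def)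
    also have "\<dots> \<le> s n" using v_le by (simp add: s_def mult_left_le)
    finally show "s (Suc n) \<le> s n" .
  qed
  \<comment> \<open>If the values stayed above some L > 0, the orthogonal images would be at
    distance at least L from each other and no subsequence of them could converge.\<close>
  have lim: "s \<longlonglongrightarrow> 0"
  proof (rule ccontr)
    assume contr: "\<not> s \<longlonglongrightarrow> 0"
    obtain L where L: "s \<longlonglongrightarrow> L" "\<And>n. L \<le> s n"
      using decseq_convergent[OF dec, of 0] by (auto simp: s_def)
    then have "L \<noteq> 0" using contr by blast
    moreover have "0 \<le> L" using LIMSEQ_le_const[OF L(1)] by (auto simp: s_def)
    ultimately have "0 < L" by simp
    have "X (v n) \<in> closure (X ` cball 0 1)" for n
      using v_le[of n] closure_subset by fastforce
    then obtain y \<phi> where \<phi>: "strict_mono \<phi>" and y: "((\<lambda>n. X (v n)) \<circ> \<phi>) \<longlonglongrightarrow> y"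
      using compact_imp_seq_compact[OF compact] unfolding seq_compact_def by metis
    from y have "Cauchy ((\<lambda>n. X (v n)) \<circ> \<phi>)"
      using LIMSEQ_imp_Cauchy by blast
    then obtain N where N: "dist (X (v (\<phi> N))) (X (v (\<phi> (Suc N)))) < L"
      using \<open>0 < L\<close> unfolding Cauchy_def by (metis comp_apply le_SucI order_refl)
    have ne: "\<phi> N \<noteq> \<phi> (Suc N)"
      using \<phi> by (metis n_not_Suc_n strict_mono_eq)
    have "(norm (X (v (\<phi> N)) - X (v (\<phi> (Suc N)))))\<^sup>2 = (s (\<phi> N))\<^sup>2 + (s (\<phi> (Suc N)))\<^sup>2"
      unfolding norm_diff_sqr Xv_ortho[OF ne] by (simp add: s_def)
    then have "L\<^sup>2 \<le> (norm (X (v (\<phi> N)) - X (v (\<phi> (Suc N)))))\<^sup>2"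
      using power_mono[OF L(2)[of "\<phi> N"], of 2] \<open>0 < L\<close>
      by (simp add: add_increasing2)
    then have "L \<le> norm (X (v (\<phi> N)) - X (v (\<phi> (Suc N))))"
      by (rule power2_le_imp_le) simp
    with N show False by (simp add: dist_norm)
  qed
  have bound: "\<forall>n. \<bar>s n\<bar> \<le> s 0"
    using decseqD[OF dec, of 0] by (simp add: s_def)
  have "X x = dop s v u x" for x
  proof -
    have "(\<lambda>n. cinner x (v n) *\<^sub>C X (v n)) sums dop s v u x"
    proof -
      have "(of_real (s n) * cinner x (v n)) *\<^sub>C u n = cinner x (v n) *\<^sub>C X (v n)" for n
      proof (cases "s n = 0")
        case False
        then show ?thesis
          unfolding u_def by (simp flip: scaleC_of_real)
      qed (use s0[of n] X(5) in simp)
      then show ?thesis using dop_sums[OF v u bound, where x = x] by simp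
    qed
    moreover have "(\<lambda>n. cinner x (v n) *\<^sub>C X (v n)) sums X x"
    proof -
      \<comment> \<open>The remainder of the expansion of \<open>x\<close> is orthogonal to the
        first \<open>N\<close> vectors, so \<open>X\<close> maps it to norm at most
        \<open>s N * norm x\<close>, which tends to 0.\<close>
      define y where "y N = x - (\<Sum>n<N. cinner x (v n) *\<^sub>C v n)" for N
      have yM: "y N \<in> M v N" for N
      proof -
        have "cinner (y N) (v m) = 0" if "m < N" for m
        proof -
          have "(\<Sum>n<N. cinner x (v n) * cinner (v n) (v m)) = (\<Sum>n<N. if n = m then cinner x (v m) else 0)"
            by (intro sum.cong) (auto simp: orthosysD[OF v])
          then show ?thesis using that
            by (simp add: y_def cinner_diff_left cinner_sum_left cinner_scaleC_left)
        qed
        then show ?thesis by (simp add: M_def)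
      qed
      have y_le: "norm (y N) \<le> norm x" for N
      proof (rule power2_le_imp_le)
        show "(norm (y N))\<^sup>2 \<le> (norm x)\<^sup>2"
          unfolding y_def using orthosys_bessel[OF v finite_lessThan[of N] subset_UNIV, of x] by (simp add: sum_nonneg)
      qed simp
      have "(\<lambda>N. X (y N)) \<longlonglongrightarrow> 0"
      proof (rule tendsto_norm_zero_cancel, rule tendsto_sandwich[OF _ _ tendsto_const])
        show "(\<lambda>N. s N * norm x) \<longlonglongrightarrow> 0"
          by (rule tendsto_mult_left_zero[OF lim])
        show "\<forall>\<^sub>F N in sequentially. norm (X (y N)) \<le> s N * norm x"
          by (intro always_eventually allI order_trans[OF max[OF yM]] mult_left_mono y_le) (simp add: s_def)
      qed simp
      then have "(\<lambda>N. X x - X (y N)) \<longlonglongrightarrow> X x - 0"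
        by (rule tendsto_diff[OF tendsto_const])
      moreover have "X x - X (y N) = (\<Sum>n<N. cinner x (v n) *\<^sub>C X (v n))" for N
        using linear_sum[OF bounded_linear.linear[OF X(1)], of "\<lambda>n. cinner x (v n) *\<^sub>C v n" "{..<N}"]
        by (simp add: y_def X)
      ultimately show ?thesis
        unfolding sums_def by simp
    qed
    ultimately show ?thesis using sums_unique2 by blast
  qed
  then have "svd X s v u"
    unfolding svd_def using v u dec lim s0 Xv0 by (auto simp: s_def u_def X(5))
  then show thesis by (rule that)
qed

section \<open>Functional calculus and polar decomposition\<close>

lemma svdD:
  assumes "svd X s v u"
  shows "orthosys UNIV v" "orthosys UNIV u" "0 \<le> s n" "decseq s" "s \<longlonglongrightarrow> 0"
    "v n = 0 \<longleftrightarrow> s n = 0" "u n = 0 \<longleftrightarrow> s n = 0" "X = dop s v u"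
    "\<forall>n. \<bar>s n\<bar> \<le> s 0" "0 \<le> r \<Longrightarrow> \<forall>n. \<bar>s n powr r\<bar> \<le> s 0 powr r" "bounded_clinear X"
proof -
  show "orthosys UNIV v" "orthosys UNIV u" "0 \<le> s n" "decseq s" "s \<longlonglongrightarrow> 0"
    "v n = 0 \<longleftrightarrow> s n = 0" "u n = 0 \<longleftrightarrow> s n = 0" "X = dop s v u"
    using assms by (auto simp: svd_def)
  show b: "\<forall>n. \<bar>s n\<bar> \<le> s 0"
    using assms by (auto simp: svd_def decseq_def)
  show "0 \<le> r \<Longrightarrow> \<forall>n. \<bar>s n powr r\<bar> \<le> s 0 powr r"
    using assms b by (auto simp: svd_def intro!: powr_mono2)
  show "bounded_clinear X"
    unfolding \<open>X = dop s v u\<close> by (rule dop_clinear[OF \<open>orthosys UNIV v\<close> \<open>orthosys UNIV u\<close> b])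
qed

text \<open>Uniqueness for the \<open>THE\<close>: \<open>B\<close> is prescribed on every
  \<open>v n\<close>, and a vector orthogonal to all of them lies in the eigenspace of 0, where
  \<open>B\<close> acts as \<open>0 powr r = 0\<close>. Since this also holds for
  \<open>r = 0\<close>, the zeroth power is the support projection.\<close>

lemma op_powr_dop:
  assumes v: "orthosys UNIV v" and a: "\<And>n. 0 \<le> a n" "\<forall>n. \<bar>a n\<bar> \<le> C" and r: "0 \<le> r"
  shows "op_powr (dop a v v) r = dop (\<lambda>n. a n powr r) v v"
  unfolding op_powr_def
proof (rule the_equality)
  have ar: "\<forall>n. \<bar>a n powr r\<bar> \<le> C powr r"
    using a r by (auto intro!: powr_mono2)
  have one: "\<forall>n::nat. \<bar>1\<bar> \<le> (1::real)" by simp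
  show "bounded_clinear (dop (\<lambda>n. a n powr r) v v) \<and>
    (\<forall>t\<ge>0. \<forall>w\<in>eigenspace (dop a v v) t. dop (\<lambda>n. a n powr r) v v w = t powr r *\<^sub>R w)"
  proof (intro conjI allI impI ballI dop_clinear[OF v v ar])
    fix t :: real and w assume t: "0 \<le> t" and w: "w \<in> eigenspace (dop a v v) t"
    then have eq: "dop a v v w = t *\<^sub>R w" by (simp add: eigenspace_def)
    have coeff: "a n = t \<or> cinner w (v n) = 0" for n
      using dop_cinner_basis[OF v v a(2), of w n]
      unfolding eq by (auto simp: cinner_scaleR_left split: if_splits)
    \<comment> \<open>For t \<noteq> 0 an eigenvector has coefficients only where
      \<open>a n = t\<close>, so there \<open>f (a n)\<close> equals
      \<open>(f t / t) * a n\<close>.\<close>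
    have *: "dop (\<lambda>n. f (a n)) v v w = (f t / t) *\<^sub>R dop a v v w" if "t \<noteq> 0" "\<forall>n. \<bar>f (a n)\<bar> \<le> K" for f K
    proof -
      have "(of_real (f (a n)) * cinner w (v n)) *\<^sub>C v n = (f t / t) *\<^sub>R ((of_real (a n) * cinner w (v n)) *\<^sub>C v n)" for n
        using coeff[of n] that by (auto simp: scaleC_scaleC simp flip: scaleC_of_real)
      then have "(\<lambda>n. (of_real (f (a n)) * cinner w (v n)) *\<^sub>C v n) sums ((f t / t) *\<^sub>R dop a v v w)"
        using sums_scaleR_right[OF dop_sums[OF v v a(2), of w], of "f t / t"] by simp
      then show ?thesis
        using dop_sums[OF v v that(2), of w] sums_unique2 by blast
    qed
    show "dop (\<lambda>n. a n powr r) v v w = t powr r *\<^sub>R w"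
    proof (cases "t = 0")
      case False
      then show ?thesis using *[OF False ar] eq by simp
    next
      case True
      have "(of_real (a n powr r) * cinner w (v n)) *\<^sub>C v n = 0" for n
        using coeff[of n] True by auto
      then show ?thesis unfolding dop_def True by (simp only: suminf_zero) simp
    qed
  qed
  fix B assume "bounded_clinear B \<and> (\<forall>t\<ge>0. \<forall>w\<in>eigenspace (dop a v v) t. B w = t powr r *\<^sub>R w)"
  then have B: "bounded_clinear B" and eig: "\<And>t w. 0 \<le> t \<Longrightarrow> dop a v v w = t *\<^sub>R w \<Longrightarrow> B w = t powr r *\<^sub>R w"
    by (auto simp: eigenspace_def)
  note B = bounded_clinearD[OF B]
  have Bv: "B (v n) = a n powr r *\<^sub>R v n" for n
    by (rule eig) (use a(1) dop_basis[OF v v a(2), of n] in auto)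
  show "B = dop (\<lambda>n. a n powr r) v v"
  proof
    fix x
    \<comment> \<open>\<open>y\<close> is the projection of \<open>x\<close> onto the closed span of
      the \<open>v n\<close>; the rest of \<open>x\<close> is in the kernel.\<close>
    define y where "y = dop (\<lambda>n. 1) v v x"
    have "cinner (x - y) (v n) = 0" for n
      unfolding y_def cinner_diff_left dop_cinner_basis[OF v v one] by simp
    then have "dop a v v (x - y) = 0"
      unfolding dop_def by simp
    then have "B (x - y) = 0"
      using eig[of 0 "x - y"] by simp
    then have "B x = B y" by (simp add: B)
    have "(\<lambda>n. B ((of_real 1 * cinner x (v n)) *\<^sub>C v n)) sums B y"
      unfolding y_def by (rule bounded_linear.sums[OF B(1) dop_sums[OF v v one]])
    then have "(\<lambda>n. (of_real (a n powr r) * cinner x (v n)) *\<^sub>C v n) sums B y"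
      by (simp add: B(2) Bv scaleC_scaleC mult.commute flip: scaleC_of_real)
    with dop_sums[OF v v ar, of x] \<open>B x = B y\<close> show "B x = dop (\<lambda>n. a n powr r) v v x"
      using sums_unique2 by metis
  qed
qed

lemma op_abs_svd:
  assumes "svd X s v u"
  shows "op_abs X = dop s v v"
proof -
  note X = svdD[OF assms]
  have "cadjoint X = dop s u v"
    unfolding X(8) by (rule cadjoint_eqI) (rule dop_adjoint[OF X(1,2,9)])
  then have "cadjoint X \<circ> X = dop (\<lambda>n. s n * s n) v v"
    unfolding X(8) by (intro ext) (use dop_dop[OF X(1,2,9)] X(6,7) in simp)
  moreover have "\<forall>n. \<bar>s n * s n\<bar> \<le> s 0 * s 0"
    using X(3,9) by (auto intro!: mult_mono)
  ultimately show ?thesis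
    unfolding op_abs_def using X(3)
    by (simp add: op_powr_dop[OF X(1)] powr_half_sqrt)
qed

lemma op_powr_op_abs_svd:
  assumes "svd X s v u" "0 \<le> r"
  shows "op_powr (op_abs X) r = dop (\<lambda>n. s n powr r) v v"
  unfolding op_abs_svd[OF assms(1)]
  by (rule op_powr_dop) (use svdD[OF assms(1)] assms(2) in auto)

text \<open>At the first disagreement, say \<open>b n < a n\<close>, the sequence \<open>b\<close>
  takes the value \<open>a n\<close> only before \<open>n\<close>, where it agrees with
  \<open>a\<close>; so its level set is strictly smaller. Convergence to 0 makes the level sets
  finite, without which \<open>card\<close> would carry no information.\<close>

lemma decseq_determined_by_level_sizes:
  fixes s t :: "nat \<Rightarrow> real"
  assumes s: "decseq s" "s \<longlonglongrightarrow> 0" and t: "decseq t" "t \<longlonglongrightarrow> 0"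
    and eq: "\<And>x. 0 < x \<Longrightarrow> card {n. s n = x} = card {n. t n = x}"
  shows "s = t"
proof -
  have not_less: "\<not> b n < a n"
    if a: "decseq a" "a \<longlonglongrightarrow> 0" and b: "decseq b" "b \<longlonglongrightarrow> 0"
      and eq: "\<And>x. 0 < x \<Longrightarrow> card {n. a n = x} = card {n. b n = x}"
      and before: "\<And>m. m < n \<Longrightarrow> a m = b m" for a b :: "nat \<Rightarrow> real" and n
  proof
    assume less: "b n < a n"
    have "0 \<le> b n" using decseq_ge[OF b] .
    with less have "0 < a n" by simp
    have "finite {m. a m = a n}"
    proof -
      from order_tendstoD(2)[OF a(2) \<open>0 < a n\<close>] obtain N where "\<And>m. m \<ge> N \<Longrightarrow> a m < a n"
        by (auto simp: eventually_sequentially)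
      then have "{m. a m = a n} \<subseteq> {..<N}" by (force simp: not_le[symmetric])
      then show ?thesis using finite_subset by blast
    qed
    moreover have "{m. b m = a n} \<subset> {m. a m = a n}"
    proof -
      have "m < n" if "b m = a n" for m
        using decseqD[OF b(1), of n m] that less by (cases "m < n") auto
      then have "{m. b m = a n} \<subseteq> {m. a m = a n}" using before by force
      moreover have "n \<notin> {m. b m = a n}" using less by simp
      ultimately show ?thesis by blast
    qed
    ultimately have "card {m. b m = a n} < card {m. a m = a n}"
      by (rule psubset_card_mono)
    with eq[OF \<open>0 < a n\<close>] show False by simp
  qed
  show ?thesis
  proof
    fix n show "s n = t n"
    proof (induction n rule: less_induct)
      case (less n)
      have "\<not> t n < s n" by (rule not_less[OF s t eq less])
      moreover have "\<not> s n < t n" by (rule not_less[OF t s eq[symmetric] less[symmetric]])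
      ultimately show ?case by simp
    qed
  qed
qed

text \<open>The \<open>v n\<close> with \<open>s n = t\<close> are orthonormal, hence independent.
  They span because an eigenvector is 1/t times its image, whose series has terms only at these
  indices; t > 0 excludes the padding.\<close>

lemma eigenspace_op_abs_dim:
  assumes X: "svd X s v u" and t: "0 < t"
  shows "complex_vector.dim (eigenspace (op_abs X) t) = card {n. s n = t}"
proof -
  note svd = svdD[OF X]
  define N where "N = {n. s n = t}"
  have "finite N"
  proof -
    from order_tendstoD(2)[OF svd(5) t] obtain K where "\<And>m. m \<ge> K \<Longrightarrow> s m < t"
      by (auto simp: eventually_sequentially)
    then have "N \<subseteq> {..<K}" by (force simp: N_def not_le[symmetric])
    then show ?thesis using finite_subset by blast
  qed
  have nz: "v n \<noteq> 0" if "n \<in> N" for n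
    using that t svd(6) by (auto simp: N_def)
  have ortho: "cinner (v n) (v m) = (if n = m then 1 else 0)" if "n \<in> N" for n m
    using nz[OF that] by (simp add: orthosysD[OF svd(1)])
  have inj: "inj_on v N"
    using ortho by (intro inj_onI) (metis zero_neq_one)
  have indep: "complex_vector.independent (v ` N)"
  proof (rule complex_vector.independent_if_scalars_zero)
    fix f w assume *: "(\<Sum>x\<in>v ` N. f x *\<^sub>C x) = 0" "w \<in> v ` N"
    then obtain m where m: "m \<in> N" "w = v m" by blast
    have "(\<Sum>n\<in>N. f (v n) *\<^sub>C v n) = 0"
      using *(1) by (simp add: sum.reindex[OF inj])
    then have "0 = cinner (\<Sum>n\<in>N. f (v n) *\<^sub>C v n) (v m)" by simp
    also have "\<dots> = (\<Sum>n\<in>N. if n = m then f (v n) else 0)"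
      unfolding cinner_sum_left cinner_scaleC_left by (intro sum.cong refl) (simp add: ortho)
    also have "\<dots> = f w" using \<open>finite N\<close> m by simp
    finally show "f w = 0" by simp
  qed (use \<open>finite N\<close> in simp)
  have "eigenspace (op_abs X) t = complex_vector.span (v ` N)"
  proof (intro equalityI)
    show "complex_vector.span (v ` N) \<subseteq> eigenspace (op_abs X) t"
    proof (rule complex_vector.span_minimal)
      note lin = bounded_clinearD[OF dop_clinear[OF svd(1,1,9)]]
      show "v ` N \<subseteq> eigenspace (op_abs X) t"
        unfolding eigenspace_def op_abs_svd[OF X]
        using dop_basis[OF svd(1,1,9)] nz by (auto simp: N_def)
      show "complex_vector.subspace (eigenspace (op_abs X) t)"
        unfolding eigenspace_def op_abs_svd[OF X] complex_vector.subspace_def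
        by (auto simp: lin scaleC_add_right scaleC_scaleC mult.commute simp flip: scaleC_of_real)
    qed
    show "eigenspace (op_abs X) t \<subseteq> complex_vector.span (v ` N)"
    proof
      fix w assume "w \<in> eigenspace (op_abs X) t"
      then have eq: "dop s v v w = t *\<^sub>R w"
        by (simp add: eigenspace_def op_abs_svd[OF X])
      have coeff: "cinner w (v n) = 0" if "n \<notin> N" for n
        using dop_cinner_basis[OF svd(1,1,9), of w n] that
        unfolding eq by (auto simp: cinner_scaleR_left N_def split: if_splits)
      have "dop s v v w = (\<Sum>n\<in>N. (of_real (s n) * cinner w (v n)) *\<^sub>C v n)"
        unfolding dop_def by (rule suminf_finite[OF \<open>finite N\<close>]) (simp add: coeff)
      then have "dop s v v w \<in> complex_vector.span (v ` N)"
        by (simp only:) (intro complex_vector.span_sum complex_vector.span_scale complex_vector.span_base imageI)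
      then have "of_real (1 / t) *\<^sub>C (of_real t *\<^sub>C w) \<in> complex_vector.span (v ` N)"
        unfolding eq scaleC_of_real[symmetric] by (rule complex_vector.span_scale)
      then show "w \<in> complex_vector.span (v ` N)"
        using t by (simp add: scaleC_scaleC)
    qed
  qed
  then show ?thesis
    using complex_vector.dim_span_eq_card_independent[OF indep] card_image[OF inj] by (simp add: N_def)
qed

lemma singular_value_svd:
  assumes X: "svd X s v u"
  shows "singular_value X = s"
  unfolding singular_value_def
proof (rule the_equality)
  show "decseq s \<and> s \<longlonglongrightarrow> 0 \<and>
    (\<forall>t>0. card {n. s n = t} = complex_vector.dim (eigenspace (op_abs X) t))"
    using svdD[OF X] eigenspace_op_abs_dim[OF X] by simp
  fix s' assume "decseq s' \<and> s' \<longlonglongrightarrow> 0 \<and>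
    (\<forall>t>0. card {n. s' n = t} = complex_vector.dim (eigenspace (op_abs X) t))"
  then show "s' = s"
    using svdD[OF X] eigenspace_op_abs_dim[OF X] by (intro decseq_determined_by_level_sizes) auto
qed

text \<open>The \<open>SOME\<close> needs a witness: \<open>U\<close> sends \<open>v n\<close> to
  \<open>u n\<close>. For \<open>y\<close> orthogonal to its kernel, \<open>y\<close> equals its
  projection \<open>z\<close> onto the \<open>v n\<close>, because \<open>y - z\<close> lies in that
  kernel; norm preservation follows since the adjoint of \<open>U\<close> maps \<open>U y\<close> to
  \<open>z\<close>.\<close>

lemma polar_isometry:
  assumes X: "svd X s v u"
  shows "partial_isometry (polar_isometry X)" "X = polar_isometry X \<circ> op_abs X"
proof -
  note svd = svdD[OF X]
  have one: "\<forall>n::nat. \<bar>1\<bar> \<le> (1::real)" by simp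
  define U where "U = dop (\<lambda>n. 1) v u"
  have lin: "bounded_clinear U"
    unfolding U_def by (rule dop_clinear[OF svd(1,2) one])
  have "X = U \<circ> op_abs X"
    unfolding op_abs_svd[OF X] U_def
    by (rule ext) (use dop_dop[OF svd(1,1,9), of u "\<lambda>n. 1"] svd(6,7,8) in simp)
  moreover have "norm (U y) = norm y" if y: "\<And>w. U w = 0 \<Longrightarrow> cinner y w = 0" for y
  proof -
    define z where "z = dop (\<lambda>n. 1) v v y"
    have coeff: "cinner (y - z) (v n) = 0" for n
      unfolding z_def cinner_diff_left dop_cinner_basis[OF svd(1,1) one] by simp
    then have "U (y - z) = 0"
      unfolding U_def dop_def by simp
    then have "cinner y (y - z) = 0" by (rule y)
    moreover have "cinner (y - z) z = 0"
    proof -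
      have "(\<lambda>n. of_real 1 * cinner (v n) y * cinner (y - z) (v n)) sums cinner (y - z) z"
        unfolding z_def by (rule cinner_dop_sums[OF svd(1,1) one])
      then show ?thesis using coeff by (simp add: sums_unique2[OF _ sums_zero])
    qed
    ultimately have "cinner (y - z) (y - z) = 0"
      unfolding cinner_diff_left[of y z "y - z"] using cinner_eq_0_commute by (metis diff_zero)
    then have "y = z" by simp
    have "cinner (U y) (U y) = cinner y (dop (\<lambda>n. 1) u v (U y))"
      unfolding U_def by (rule dop_adjoint[OF svd(1,2) one])
    also have "dop (\<lambda>n. 1) u v (U y) = z"
      unfolding U_def z_def by (use dop_dop[OF svd(1,2) one] svd(6,7) in simp)
    finally have "cinner (U y) (U y) = cinner y y" using \<open>y = z\<close> by simp
    then show ?thesis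
      unfolding cinner_self of_real_eq_iff by (simp add: power2_eq_iff_nonneg)
  qed
  ultimately have "partial_isometry U \<and> X = U \<circ> op_abs X"
    unfolding partial_isometry_def using lin by blast
  then have "partial_isometry (polar_isometry X) \<and> X = polar_isometry X \<circ> op_abs X"
    unfolding polar_isometry_def by (rule someI[of "\<lambda>U. partial_isometry U \<and> X = U \<circ> op_abs X"])
  then show "partial_isometry (polar_isometry X)" "X = polar_isometry X \<circ> op_abs X" by auto
qed

text \<open>Independence of the chosen polar isometry: it must send \<open>v n\<close> to
  \<open>u n\<close> wherever \<open>s n \<noteq> 0\<close>, and the power of |X| only produces
  combinations of those \<open>v n\<close>.\<close>

lemma cinner_polar_power_svd:
  assumes X: "svd X s v u" and r: "0 \<le> r"
  shows "cinner (op_powr (op_abs X) r (cadjoint (polar_isometry X) y)) x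
    = cinner y (dop (\<lambda>n. s n powr r) v u x)"
proof -
  note svd = svdD[OF X]
  define U where "U = polar_isometry X"
  have U: "bounded_clinear U" and XU: "X = U \<circ> op_abs X"
    using polar_isometry[OF X] by (auto simp: U_def partial_isometry_def)
  have Uv: "U (v n) = u n" for n
  proof (cases "s n = 0")
    case False
    have "s n *\<^sub>R u n = X (v n)"
      using dop_basis[OF svd(1,2,9), of n] svd(6,8) False by simp
    also have "\<dots> = U (op_abs X (v n))" using fun_cong[OF XU, of "v n"] by simp
    also have "\<dots> = s n *\<^sub>R U (v n)"
      unfolding op_abs_svd[OF X] dop_basis[OF svd(1,1,9)] using svd(6) False
      by (simp add: bounded_clinearD[OF U])
    finally show ?thesis using False by simp
  next
    case True
    then have "v n = 0" "u n = 0" using svd(6,7) by blast+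
    then show ?thesis using bounded_clinearD(5)[OF U] by simp
  qed
  have "U (dop (\<lambda>n. s n powr r) v v x) = dop (\<lambda>n. s n powr r) v u x"
    using bounded_linear.sums[OF bounded_clinearD(1)[OF U] dop_sums[OF svd(1,1) svd(10)[OF r], of x]]
      dop_sums[OF svd(1,2) svd(10)[OF r], of x]
    by (simp add: bounded_clinearD[OF U] Uv sums_unique2)
  moreover have "cinner (dop (\<lambda>n. s n powr r) v v (cadjoint U y)) x
      = cinner y (U (dop (\<lambda>n. s n powr r) v v x))"
    unfolding dop_adjoint[OF svd(1,1) svd(10)[OF r]]
    by (metis cinner_cadjoint[OF U] cinner_commute)
  ultimately show ?thesis
    unfolding op_powr_op_abs_svd[OF X r] U_def by simp
qed

section \<open>Hoelder's inequality and the trace\<close>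

text \<open>A limit is exchanged with a series without a dominating sequence for the single terms.
  The bound on finite sums by \<open>K\<close> times a power of the sum of \<open>w\<close> makes
  the tails beyond one common index small for all relevant \<open>i\<close> at once.\<close>

lemma tendsto_suminf_uniform_tails:
  fixes h :: "'i \<Rightarrow> nat \<Rightarrow> complex"
  assumes lim: "\<And>n. ((\<lambda>i. h i n) \<longlongrightarrow> l n) G"
    and w: "\<And>n. 0 \<le> w n" "summable w" and \<theta>: "0 < \<theta>" and K: "0 \<le> K"
    and h: "\<forall>\<^sub>F i in G. \<forall>A. finite A \<longrightarrow> (\<Sum>n\<in>A. cmod (h i n)) \<le> K * (\<Sum>n\<in>A. w n) powr \<theta>"
    and l: "\<And>A. finite A \<Longrightarrow> (\<Sum>n\<in>A. cmod (l n)) \<le> K * (\<Sum>n\<in>A. w n) powr \<theta>"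
  shows "((\<lambda>i. \<Sum>n. h i n) \<longlongrightarrow> (\<Sum>n. l n)) G"
proof (rule tendstoI)
  fix \<epsilon> :: real assume \<epsilon>: "0 < \<epsilon>"
  \<comment> \<open>A \<open>w\<close>-tail below this \<delta> bounds the tails of the series by
    \<epsilon>/3; \<open>K + 1\<close> avoids division by zero.\<close>
  define \<delta> where "\<delta> = (\<epsilon> / (3 * (K + 1))) powr (1 / \<theta>)"
  have "0 < \<delta>" using \<epsilon> K by (simp add: \<delta>_def)
  have "K * \<delta> powr \<theta> \<le> \<epsilon> / 3"
    using \<epsilon> K \<theta> by (simp add: \<delta>_def powr_powr field_simps)
  from suminf_exist_split[OF \<open>0 < \<delta>\<close> w(2)] obtain M where M: "norm (\<Sum>n. w (n + M)) < \<delta>"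
    by blast
  have split: "summable g \<and> cmod ((\<Sum>n. g n) - (\<Sum>n<M. g n)) \<le> \<epsilon> / 3"
    if g: "\<And>A. finite A \<Longrightarrow> (\<Sum>n\<in>A. cmod (g n)) \<le> K * (\<Sum>n\<in>A. w n) powr \<theta>" for g
  proof -
    have "(\<Sum>n\<in>A. cmod (g n)) \<le> K * (\<Sum>n. w n) powr \<theta>" if "finite A" for A
      using w \<theta> K that
      by (intro order_trans[OF g] mult_left_mono powr_mono2) (auto intro: sum_nonneg sum_le_suminf)
    then have s: "summable (\<lambda>n. cmod (g n))"
      by (intro summableI_nonneg_bounded) auto
    have tail: "(\<Sum>n<N. cmod (g (n + M))) \<le> \<epsilon> / 3" for N
    proof -
      have reindex: "(\<Sum>n<N. f (n + M)) = (\<Sum>n\<in>(\<lambda>n. n + M) ` {..<N}. f n)" for f :: "nat \<Rightarrow> real"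
        by (simp add: sum.reindex)
      have "(\<Sum>n<N. w (n + M)) \<le> (\<Sum>n. w (n + M))"
        using w by (intro sum_le_suminf) (auto simp: summable_ignore_initial_segment)
      then have "(\<Sum>n<N. w (n + M)) \<le> \<delta>" using M by simp
      then have "K * (\<Sum>n<N. w (n + M)) powr \<theta> \<le> K * \<delta> powr \<theta>"
        using w K \<theta> by (intro mult_left_mono powr_mono2) (auto intro: sum_nonneg)
      then show ?thesis
        using g[of "(\<lambda>n. n + M) ` {..<N}"] \<open>K * \<delta> powr \<theta> \<le> \<epsilon> / 3\<close>
          reindex[of w] reindex[of "\<lambda>n. cmod (g n)"] by simp
    qed
    have s': "summable (\<lambda>n. cmod (g (n + M)))"
      using s summable_ignore_initial_segment[of "\<lambda>n. cmod (g n)"] by simp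
    have "(\<Sum>n. g n) - (\<Sum>n<M. g n) = (\<Sum>n. g (n + M))"
      using suminf_minus_initial_segment[OF summable_norm_cancel[OF s], of M] by simp
    also have "cmod \<dots> \<le> (\<Sum>n. cmod (g (n + M)))"
      by (rule summable_norm[OF s'])
    also have "\<dots> \<le> \<epsilon> / 3"
      by (rule suminf_le_const[OF s' tail])
    finally show ?thesis using summable_norm_cancel[OF s] by simp
  qed
  have "((\<lambda>i. \<Sum>n<M. h i n) \<longlongrightarrow> (\<Sum>n<M. l n)) G"
    by (intro tendsto_sum lim)
  then have "\<forall>\<^sub>F i in G. dist (\<Sum>n<M. h i n) (\<Sum>n<M. l n) < \<epsilon> / 3"
    using \<epsilon> tendstoD[of _ _ G "\<epsilon> / 3"] by simp
  then show "\<forall>\<^sub>F i in G. dist (\<Sum>n. h i n) (\<Sum>n. l n) < \<epsilon>"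
    using h
  proof eventually_elim
    case (elim i)
    then have "cmod ((\<Sum>n. h i n) - (\<Sum>n<M. h i n)) \<le> \<epsilon> / 3" using split[of "h i"] by blast
    moreover have "cmod ((\<Sum>n. l n) - (\<Sum>n<M. l n)) \<le> \<epsilon> / 3" using split[OF l] by blast
    moreover have "(\<Sum>n. h i n) - (\<Sum>n. l n) = ((\<Sum>n. h i n) - (\<Sum>n<M. h i n))
        + ((\<Sum>n<M. h i n) - (\<Sum>n<M. l n)) - ((\<Sum>n. l n) - (\<Sum>n<M. l n))" by simp
    ultimately show ?case
      using elim(1) norm_triangle_ineq4[of "((\<Sum>n. h i n) - (\<Sum>n<M. h i n)) + ((\<Sum>n<M. h i n) - (\<Sum>n<M. l n))" "(\<Sum>n. l n) - (\<Sum>n<M. l n)"]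
        norm_triangle_ineq[of "(\<Sum>n. h i n) - (\<Sum>n<M. h i n)" "(\<Sum>n<M. h i n) - (\<Sum>n<M. l n)"]
      by (simp only: dist_norm)
  qed
qed

text \<open>After normalising by \<open>S\<close> and \<open>T\<close>, Young's inequality splits
  each term. The row sums absorb the weights of the \<sigma> part and the column sums those of the
  \<open>t\<close> part, leaving 1/q + 1/p.\<close>

lemma Holder_doubly_substochastic:
  fixes p q :: real and \<sigma> t :: "_ \<Rightarrow> real"
  assumes pq: "1 < p" "1 < q" "1 / p + 1 / q = 1"
    and fin: "finite A" "finite B"
    and nn: "\<And>k. k \<in> A \<Longrightarrow> 0 \<le> \<sigma> k" "\<And>m. m \<in> B \<Longrightarrow> 0 \<le> t m" "\<And>k m. 0 \<le> w k m"
    and row: "\<And>k. k \<in> A \<Longrightarrow> (\<Sum>m\<in>B. w k m) \<le> 1" and col: "\<And>m. m \<in> B \<Longrightarrow> (\<Sum>k\<in>A. w k m) \<le> 1"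
  shows "(\<Sum>k\<in>A. \<Sum>m\<in>B. \<sigma> k * t m * w k m)
    \<le> (\<Sum>k\<in>A. \<sigma> k powr q) powr (1 / q) * (\<Sum>m\<in>B. t m powr p) powr (1 / p)"
proof -
  define S where "S = (\<Sum>k\<in>A. \<sigma> k powr q) powr (1 / q)"
  define T where "T = (\<Sum>m\<in>B. t m powr p) powr (1 / p)"
  have Sq: "S powr q = (\<Sum>k\<in>A. \<sigma> k powr q)" and Tp: "T powr p = (\<Sum>m\<in>B. t m powr p)"
    using pq by (simp_all add: S_def T_def powr_powr sum_nonneg)
  show ?thesis
  proof (cases "S = 0 \<or> T = 0")
    case True
    then have "(\<forall>k\<in>A. \<sigma> k = 0) \<or> (\<forall>m\<in>B. t m = 0)"
    proof
      assume "S = 0"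
      then have "(\<Sum>k\<in>A. \<sigma> k powr q) = 0" using Sq by simp
      then show ?thesis using fin by (simp add: sum_nonneg_eq_0_iff)
    next
      assume "T = 0"
      then have "(\<Sum>m\<in>B. t m powr p) = 0" using Tp by simp
      then show ?thesis using fin by (simp add: sum_nonneg_eq_0_iff)
    qed
    then have "(\<Sum>k\<in>A. \<Sum>m\<in>B. \<sigma> k * t m * w k m) = 0" by auto
    then show ?thesis by simp
  next
    case False
    then have pos: "0 < S" "0 < T" by (auto simp: S_def T_def)
    have young: "\<sigma> k * t m * w k m / (S * T)
        \<le> (\<sigma> k powr q / S powr q / q) * w k m + (t m powr p / T powr p / p) * w k m"
      if "k \<in> A" "m \<in> B" for k m
    proof -
      have "(\<sigma> k / S) * (t m / T) \<le> (\<sigma> k / S) powr q / q + (t m / T) powr p / p"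
        using pq pos nn(1)[OF that(1)] nn(2)[OF that(2)] by (intro Youngs_inequality) auto
      from mult_right_mono[OF this nn(3)[of k m]] show ?thesis
        using pos nn(1)[OF that(1)] nn(2)[OF that(2)] by (simp add: powr_divide algebra_simps)
    qed
    have "(\<Sum>k\<in>A. \<Sum>m\<in>B. \<sigma> k * t m * w k m) / (S * T) = (\<Sum>k\<in>A. \<Sum>m\<in>B. \<sigma> k * t m * w k m / (S * T))"
      by (simp add: sum_divide_distrib)
    also have "\<dots> \<le> (\<Sum>k\<in>A. \<Sum>m\<in>B. (\<sigma> k powr q / S powr q / q) * w k m + (t m powr p / T powr p / p) * w k m)"
      by (intro sum_mono young)
    also have "\<dots> = (\<Sum>k\<in>A. (\<sigma> k powr q / S powr q / q) * (\<Sum>m\<in>B. w k m))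
        + (\<Sum>m\<in>B. (t m powr p / T powr p / p) * (\<Sum>k\<in>A. w k m))"
      by (simp only: sum.distrib sum_distrib_left) (simp add: sum.swap[of _ B A])
    also have "\<dots> \<le> (\<Sum>k\<in>A. (\<sigma> k powr q / S powr q / q) * 1) + (\<Sum>m\<in>B. (t m powr p / T powr p / p) * 1)"
      using pq by (intro add_mono sum_mono mult_left_mono row col) auto
    also have "\<dots> = 1 / q + 1 / p"
    proof -
      have "(\<Sum>k\<in>A. (\<sigma> k powr q / S powr q / q) * 1) = (\<Sum>k\<in>A. \<sigma> k powr q) / S powr q / q"
        by (simp add: sum_divide_distrib)
      moreover have "(\<Sum>m\<in>B. (t m powr p / T powr p / p) * 1) = (\<Sum>m\<in>B. t m powr p) / T powr p / p"
        by (simp add: sum_divide_distrib)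
      ultimately show ?thesis using pos by (simp add: Sq[symmetric] Tp[symmetric])
    qed
    also have "1 / q + 1 / p = 1"
      using pq(3) by simp
    finally show ?thesis
      using pos by (simp add: divide_le_eq S_def[symmetric] T_def[symmetric])
  qed
qed

text \<open>This makes the weights doubly substochastic: ab \<le> (a^2 + b^2)/2 and Bessel's
  inequality for each system.\<close>

lemma bessel_product_sum_le_1:
  assumes f: "bessel_system f" and g: "bessel_system g" and "finite A" "norm x \<le> 1" "norm y \<le> 1"
  shows "(\<Sum>m\<in>A. cmod (cinner x (f m)) * cmod (cinner y (g m))) \<le> 1"
proof -
  have "a * b \<le> (a\<^sup>2 + b\<^sup>2) / 2" for a b :: real
    using sum_squares_bound[of a b] by (simp add: field_simps)
  then have "(\<Sum>m\<in>A. cmod (cinner x (f m)) * cmod (cinner y (g m)))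
      \<le> (\<Sum>m\<in>A. ((cmod (cinner x (f m)))\<^sup>2 + (cmod (cinner y (g m)))\<^sup>2) / 2)"
    by (intro sum_mono)
  also have "\<dots> = ((\<Sum>m\<in>A. (cmod (cinner x (f m)))\<^sup>2) + (\<Sum>m\<in>A. (cmod (cinner y (g m)))\<^sup>2)) / 2"
    by (simp add: sum.distrib flip: sum_divide_distrib)
  also have "\<dots> \<le> ((norm x)\<^sup>2 + (norm y)\<^sup>2) / 2"
    using f g \<open>finite A\<close> unfolding bessel_system_def by (intro divide_right_mono add_mono) auto
  also have "\<dots> \<le> (1 + 1) / 2"
    using assms by (intro divide_right_mono add_mono power_le_one) auto
  finally show ?thesis by simp
qed

text \<open>Truncating the series of the operator gives a finite double sum. Its row sums are
  bounded by Bessel's inequality for \<open>f\<close> and \<open>g\<close>, its column sums by that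
  for \<open>a\<close> and \<open>b\<close>, which therefore need not be orthogonal.\<close>

lemma dop_Holder:
  fixes p q :: real and a b :: "'i \<Rightarrow> 'a::complex_hilbert"
  assumes pq: "1 < p" "1 < q" "1 / p + 1 / q = 1"
    and fg: "orthosys UNIV f" "orthosys UNIV g"
    and t: "\<And>m. 0 \<le> t m" "\<forall>m. \<bar>t m\<bar> \<le> C" "summable (\<lambda>m. t m powr p)"
    and ab: "bessel_system a" "bessel_system b"
    and A: "finite A" "\<And>k. k \<in> A \<Longrightarrow> 0 \<le> \<sigma> k"
  shows "(\<Sum>k\<in>A. \<sigma> k * cmod (cinner (dop t f g (a k)) (b k)))
    \<le> (\<Sum>k\<in>A. \<sigma> k powr q) powr (1 / q) * (\<Sum>m. t m powr p) powr (1 / p)"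
proof (rule LIMSEQ_le_const2)
  let ?term = "\<lambda>k m. of_real (t m) * cinner (a k) (f m) * cinner (g m) (b k)"
  note bessel = fg[THEN orthosys_imp_bessel_system]
  show "(\<lambda>M. \<Sum>k\<in>A. \<sigma> k * cmod (\<Sum>m<M. ?term k m)) \<longlonglongrightarrow>
      (\<Sum>k\<in>A. \<sigma> k * cmod (cinner (dop t f g (a k)) (b k)))"
    using dop_cinner_sums[OF fg t(2)] unfolding sums_def by (intro tendsto_intros) auto
  have "(\<Sum>k\<in>A. \<sigma> k * cmod (\<Sum>m<M. ?term k m))
      \<le> (\<Sum>k\<in>A. \<sigma> k powr q) powr (1 / q) * (\<Sum>m. t m powr p) powr (1 / p)" for M
  proof -
    let ?w = "\<lambda>k m. cmod (cinner (a k) (f m)) * cmod (cinner (b k) (g m))"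
    have "(\<Sum>k\<in>A. \<sigma> k * cmod (\<Sum>m<M. ?term k m)) \<le> (\<Sum>k\<in>A. \<sigma> k * (\<Sum>m<M. t m * ?w k m))"
    proof (intro sum_mono mult_left_mono A)
      fix k
      show "cmod (\<Sum>m<M. ?term k m) \<le> (\<Sum>m<M. t m * ?w k m)"
        by (rule order_trans[OF norm_sum]) (simp add: norm_mult t(1) cmod_cinner_commute[of "b k"] mult.assoc)
    qed
    also have "\<dots> = (\<Sum>k\<in>A. \<Sum>m<M. \<sigma> k * t m * ?w k m)"
      by (simp add: sum_distrib_left mult.assoc)
    also have "\<dots> \<le> (\<Sum>k\<in>A. \<sigma> k powr q) powr (1 / q) * (\<Sum>m<M. t m powr p) powr (1 / p)"
    proof (intro Holder_doubly_substochastic pq A finite_lessThan t(1))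
      show "(\<Sum>m<M. ?w k m) \<le> 1" for k
        by (intro bessel_product_sum_le_1 bessel finite_lessThan bessel_system_norm ab)
      show "(\<Sum>k\<in>A. ?w k m) \<le> 1" for m
        using bessel_product_sum_le_1[OF ab A(1) bessel_system_norm[OF bessel(1), of m] bessel_system_norm[OF bessel(2), of m]]
        by (simp add: cmod_cinner_commute)
    qed auto
    also have "\<dots> \<le> (\<Sum>k\<in>A. \<sigma> k powr q) powr (1 / q) * (\<Sum>m. t m powr p) powr (1 / p)"
      using pq t by (intro mult_left_mono powr_mono2 sum_le_suminf) (auto intro: sum_nonneg)
    finally show ?thesis .
  qed
  then show "\<exists>N. \<forall>M\<ge>N. (\<Sum>k\<in>A. \<sigma> k * cmod (\<Sum>m<M. ?term k m))
      \<le> (\<Sum>k\<in>A. \<sigma> k powr q) powr (1 / q) * (\<Sum>m. t m powr p) powr (1 / p)" by blast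
qed

text \<open>The projection is self-adjoint and contractive, so it can be moved onto the test
  vector.\<close>

lemma bessel_system_projection:
  fixes v :: "'i \<Rightarrow> 'a::complex_hilbert"
  assumes v: "bessel_system v" and E: "orthosys E (\<lambda>e. e)" and F: "finite F" "F \<subseteq> E"
  shows "bessel_system (\<lambda>n. \<Sum>e\<in>F. cinner (v n) e *\<^sub>C e)"
  unfolding bessel_system_def
proof (intro allI impI)
  fix x and A :: "'i set" assume A: "finite A"
  let ?P = "\<lambda>x. \<Sum>e\<in>F. cinner x e *\<^sub>C e"
  have sym: "cinner x (?P y) = cinner (?P x) y" for y
    unfolding cinner_sum_left cinner_sum_right cinner_scaleC_left cinner_scaleC_right
    by (intro sum.cong refl) (simp add: cinner_commute[of _ y, symmetric] mult.commute)
  have "(norm (?P x))\<^sup>2 = (\<Sum>e\<in>F. (cmod (cinner x e))\<^sup>2)"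
    unfolding orthosys_norm_sum[OF E F] using orthosys_norm[OF E] F
    by (intro sum.cong refl) (auto simp: subset_iff)
  also have "\<dots> \<le> (norm x)\<^sup>2"
    using orthosys_bessel[OF E F, of x] by (metis diff_ge_0_iff_ge zero_le_power2)
  finally have "(norm (?P x))\<^sup>2 \<le> (norm x)\<^sup>2" .
  moreover have "(\<Sum>n\<in>A. (cmod (cinner (?P x) (v n)))\<^sup>2) \<le> (norm (?P x))\<^sup>2"
    using v A unfolding bessel_system_def by blast
  ultimately show "(\<Sum>n\<in>A. (cmod (cinner x (?P (v n))))\<^sup>2) \<le> (norm x)\<^sup>2"
    unfolding sym by linarith
qed

text \<open>With \<open>P\<^sub>F\<close> the projection onto a finite part \<open>F\<close> of the basis, the partial sum over \<open>F\<close> is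
  \<open>\<Sum>n. \<sigma> n * \<langle>Y P\<^sub>F v\<^sub>n, u\<^sub>n\<rangle>\<close>.  The terms converge as \<open>F\<close> grows, and Hoelder's inequality bounds the
  tails uniformly in \<open>F\<close>.\<close>

lemma has_sum_dop_cinner_dop:
  fixes p q :: real
  assumes pq: "1 < p" "1 < q" "1 / p + 1 / q = 1"
    and fg: "orthosys UNIV f" "orthosys UNIV g"
    and t: "\<And>m. 0 \<le> t m" "\<forall>m. \<bar>t m\<bar> \<le> C" "summable (\<lambda>m. t m powr p)"
    and vu: "orthosys UNIV v" "orthosys UNIV u"
    and \<sigma>: "\<And>m. 0 \<le> \<sigma> m" "\<forall>m. \<bar>\<sigma> m\<bar> \<le> D" "summable (\<lambda>m. \<sigma> m powr q)"
    and E: "orthonormal_basis E"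
  shows "((\<lambda>e. cinner (dop t f g e) (dop \<sigma> v u e)) has_sum
    (\<Sum>n. of_real (\<sigma> n) * cinner (dop t f g (v n)) (u n))) E"
proof -
  let ?Y = "dop t f g"
  let ?P = "\<lambda>F x. \<Sum>e\<in>F. cinner x e *\<^sub>C e"
  define K where "K = (\<Sum>m. t m powr p) powr (1 / p)"
  have lin: "bounded_clinear ?Y" by (rule dop_clinear[OF fg t(2)])
  note Y = bounded_clinearD[OF lin]
  note bessel = vu[THEN orthosys_imp_bessel_system]
  note sys = orthonormal_basis_orthosys[OF E]
  have holder: "(\<Sum>n\<in>A. cmod (of_real (\<sigma> n) * cinner (?Y (a n)) (u n))) \<le> K * (\<Sum>n\<in>A. \<sigma> n powr q) powr (1 / q)"
    if "finite A" "bessel_system a" for A a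
    using dop_Holder[OF pq fg t that(2) bessel(2) that(1), of \<sigma>] \<sigma>(1)
    by (simp add: norm_mult K_def mult.commute)
  have "((\<lambda>F. \<Sum>n. of_real (\<sigma> n) * cinner (?Y (?P F (v n))) (u n)) \<longlongrightarrow>
      (\<Sum>n. of_real (\<sigma> n) * cinner (?Y (v n)) (u n))) (finite_subsets_at_top E)"
  proof (rule tendsto_suminf_uniform_tails[where w = "\<lambda>n. \<sigma> n powr q" and \<theta> = "1 / q" and K = K])
    show "((\<lambda>F. of_real (\<sigma> n) * cinner (?Y (?P F (v n))) (u n)) \<longlongrightarrow>
        of_real (\<sigma> n) * cinner (?Y (v n)) (u n)) (finite_subsets_at_top E)" for n
      by (intro tendsto_mult tendsto_const tendsto_cinner_left bounded_linear.tendsto[OF Y(1)]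
          orthonormal_basis_expansion[OF E])
    show "\<forall>\<^sub>F F in finite_subsets_at_top E. \<forall>A. finite A \<longrightarrow>
        (\<Sum>n\<in>A. cmod (of_real (\<sigma> n) * cinner (?Y (?P F (v n))) (u n))) \<le> K * (\<Sum>n\<in>A. \<sigma> n powr q) powr (1 / q)"
      by (rule eventually_finite_subsets_at_top_weakI)
         (intro allI impI holder bessel_system_projection[OF bessel(1) sys])
  qed (use \<sigma> pq holder bessel in \<open>auto simp: K_def\<close>)
  moreover have "(\<Sum>e\<in>F. cinner (?Y e) (dop \<sigma> v u e)) = (\<Sum>n. of_real (\<sigma> n) * cinner (?Y (?P F (v n))) (u n))"
    if F: "finite F" "F \<subseteq> E" for F
  proof (rule sums_unique)
    have "(\<lambda>n. \<Sum>e\<in>F. of_real (\<sigma> n) * cinner (v n) e * cinner (?Y e) (u n)) sums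
        (\<Sum>e\<in>F. cinner (?Y e) (dop \<sigma> v u e))"
      by (intro sums_sum cinner_dop_sums[OF vu \<sigma>(2)])
    moreover have "(\<Sum>e\<in>F. of_real (\<sigma> n) * cinner (v n) e * cinner (?Y e) (u n))
        = of_real (\<sigma> n) * cinner (?Y (?P F (v n))) (u n)" for n
      by (simp add: linear_sum[OF bounded_linear.linear[OF Y(1)]] Y(2) cinner_sum_left cinner_scaleC_left
          sum_distrib_left mult.assoc)
    ultimately show "(\<lambda>n. of_real (\<sigma> n) * cinner (?Y (?P F (v n))) (u n)) sums
        (\<Sum>e\<in>F. cinner (?Y e) (dop \<sigma> v u e))" by simp
  qed
  ultimately show ?thesis
    unfolding has_sum_def
    by (subst tendsto_cong) (auto intro!: eventually_finite_subsets_at_top_weakI)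
qed

section \<open>Schatten classes\<close>

text \<open>The trace factor of \<open>semi_inner\<close> with the arguments exchanged: on the
  Schatten class it is linear in the last one and nonlinear in \<open>X\<close>.\<close>

definition pairing :: "real \<Rightarrow> ('a::complex_hilbert \<Rightarrow> 'a) \<Rightarrow> ('a \<Rightarrow> 'a) \<Rightarrow> complex"
  where "pairing p X Y = trace_op (op_powr (op_abs X) (p - 1) \<circ> cadjoint (polar_isometry X) \<circ> Y)"

lemma schatten_norm_svd:
  assumes "svd X s v u"
  shows "schatten_norm p X = (\<Sum>n. s n powr p) powr (1 / p)"
  unfolding schatten_norm_def singular_value_svd[OF assms] ..

lemma schatten_class_obtain_svd:
  assumes "X \<in> schatten_class p"
  obtains s v u where "svd X s v u" "summable (\<lambda>n. s n powr p)"
proof -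
  from assms have X: "compact_operator X" "summable (\<lambda>n. singular_value X n powr p)"
    by (auto simp: schatten_class_def)
  from compact_operator_svd[OF X(1)] obtain s v u where "svd X s v u" .
  with X(2) singular_value_svd[OF this] show thesis
    by (intro that) auto
qed

lemma schatten_norm_nonneg [simp]: "0 \<le> schatten_norm p X"
  by (simp add: schatten_norm_def)

lemma singular_value_le_schatten_norm:
  assumes "1 < p" "svd X s v u" "summable (\<lambda>n. s n powr p)"
  shows "s n \<le> schatten_norm p X"
proof -
  have "s n powr p \<le> (\<Sum>n. s n powr p)"
    using sum_le_suminf[OF assms(3), of "{n}"] by simp
  then have "(s n powr p) powr (1 / p) \<le> (\<Sum>n. s n powr p) powr (1 / p)"
    using assms(1) by (intro powr_mono2) auto
  then show ?thesis
    using assms(1) svdD(3)[OF assms(2)] by (simp add: schatten_norm_svd[OF assms(2)] powr_powr)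
qed

lemma schatten_norm_pos:
  assumes "1 < p" "X \<in> schatten_class p" "X \<noteq> (\<lambda>v. 0)"
  shows "0 < schatten_norm p X"
proof -
  obtain s v u where svd: "svd X s v u" "summable (\<lambda>n. s n powr p)"
    using schatten_class_obtain_svd[OF assms(2)] by blast
  have "\<exists>n. s n \<noteq> 0"
  proof (rule ccontr)
    assume "\<not> ?thesis"
    then have "X = (\<lambda>v. 0)"
      unfolding svdD(8)[OF svd(1)] dop_def by (intro ext) simp
    with assms(3) show False by simp
  qed
  then obtain n where "0 < s n"
    using svdD(3)[OF svd(1)] by (metis less_eq_real_def)
  with singular_value_le_schatten_norm[OF assms(1) svd, of n] show ?thesis by simp
qed

lemma conjugate_exponent:
  assumes "1 < (p::real)"
  shows "1 < p / (p - 1)" "1 / p + 1 / (p / (p - 1)) = 1" "1 / (p / (p - 1)) + 1 / p = 1"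
    "(p - 1) * (p / (p - 1)) = p" "1 / (p / (p - 1)) = (p - 1) / p"
  using assms by (auto simp: field_simps)

context
  fixes p :: real
  assumes p: "1 < p"
begin

text \<open>The weights are written as powers p - 1, since their power with the conjugate exponent
  p/(p-1) is then \<open>w k powr p\<close>.\<close>

lemma svd_Holder:
  assumes svd: "svd X s v u" "summable (\<lambda>n. s n powr p)"
    and ab: "bessel_system a" "bessel_system b" and A: "finite A" "\<And>k. k \<in> A \<Longrightarrow> 0 \<le> w k"
  shows "(\<Sum>k\<in>A. w k powr (p - 1) * cmod (cinner (X (a k)) (b k)))
    \<le> (\<Sum>k\<in>A. w k powr p) powr ((p - 1) / p) * schatten_norm p X"
  using dop_Holder[OF p conjugate_exponent(1,2)[OF p] svdD(1,2)[OF svd(1)] svdD(3,9)[OF svd(1)] svd(2) ab A(1),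
      of "\<lambda>k. w k powr (p - 1)"]
  unfolding svdD(8)[OF svd(1), symmetric] schatten_norm_svd[OF svd(1), symmetric] powr_powr
    conjugate_exponent[OF p]
  by simp

lemma pairing_summable:
  assumes X: "svd X s v u" "summable (\<lambda>n. s n powr p)" and Y: "Y \<in> schatten_class p"
  shows "summable (\<lambda>n. cmod (of_real (s n powr (p - 1)) * cinner (Y (v n)) (u n)))"
    and "(\<Sum>n. cmod (of_real (s n powr (p - 1)) * cinner (Y (v n)) (u n)))
      \<le> schatten_norm p X powr (p - 1) * schatten_norm p Y"
proof -
  obtain t f g where Y: "svd Y t f g" "summable (\<lambda>n. t n powr p)"
    using schatten_class_obtain_svd[OF Y] by blast
  have NX: "schatten_norm p X powr (p - 1) = (\<Sum>n. s n powr p) powr ((p - 1) / p)"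
    by (simp add: schatten_norm_svd[OF X(1)] powr_powr)
  have le: "(\<Sum>n\<in>A. cmod (of_real (s n powr (p - 1)) * cinner (Y (v n)) (u n)))
      \<le> schatten_norm p X powr (p - 1) * schatten_norm p Y" if "finite A" for A
  proof -
    have "(\<Sum>n\<in>A. cmod (of_real (s n powr (p - 1)) * cinner (Y (v n)) (u n)))
      \<le> (\<Sum>n\<in>A. s n powr p) powr ((p - 1) / p) * schatten_norm p Y"
      using svd_Holder[OF Y svdD(1,2)[OF X(1), THEN orthosys_imp_bessel_system] that, of s] svdD(3)[OF X(1)]
      by (simp add: norm_mult)
    also have "\<dots> \<le> (\<Sum>n. s n powr p) powr ((p - 1) / p) * schatten_norm p Y"
      using p that X(2) by (intro mult_right_mono powr_mono2 sum_le_suminf) (auto intro: sum_nonneg)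
    finally show ?thesis unfolding NX .
  qed
  then show "summable (\<lambda>n. cmod (of_real (s n powr (p - 1)) * cinner (Y (v n)) (u n)))"
    by (intro summableI_nonneg_bounded) auto
  then show "(\<Sum>n. cmod (of_real (s n powr (p - 1)) * cinner (Y (v n)) (u n)))
      \<le> schatten_norm p X powr (p - 1) * schatten_norm p Y"
    using le by (intro suminf_le_const) auto
qed

text \<open>With D = U|X|^(p-1), the two basis sums are conjugate to each other; one is evaluated
  along the singular vectors of \<open>X\<close>, the other along those of \<open>Y\<close>. In the
  second, p and its conjugate exchange roles, and \<open>X\<close> enters only through D, which is
  what a limit in \<open>X\<close> needs.\<close>

lemma pairing_has_sum:
  assumes X: "svd X s v u" "summable (\<lambda>n. s n powr p)" and Y: "svd Y t f g" "summable (\<lambda>n. t n powr p)"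
    and E: "orthonormal_basis E"
  shows "((\<lambda>e. cinner (Y e) (dop (\<lambda>n. s n powr (p - 1)) v u e)) has_sum
      (\<Sum>n. of_real (s n powr (p - 1)) * cinner (Y (v n)) (u n))) E"
    and "((\<lambda>e. cinner (dop (\<lambda>n. s n powr (p - 1)) v u e) (Y e)) has_sum
      (\<Sum>m. of_real (t m) * cinner (dop (\<lambda>n. s n powr (p - 1)) v u (f m)) (g m))) E"
proof -
  have p1: "0 \<le> p - 1" using p by simp
  have s: "summable (\<lambda>n. (s n powr (p - 1)) powr (p / (p - 1)))"
    unfolding powr_powr conjugate_exponent[OF p] by (rule X(2))
  show "((\<lambda>e. cinner (Y e) (dop (\<lambda>n. s n powr (p - 1)) v u e)) has_sum
      (\<Sum>n. of_real (s n powr (p - 1)) * cinner (Y (v n)) (u n))) E"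
    using has_sum_dop_cinner_dop[OF p conjugate_exponent(1,2)[OF p] svdD(1,2)[OF Y(1)] svdD(3,9)[OF Y(1)] Y(2)
      svdD(1,2)[OF X(1)] _ svdD(10)[OF X(1) p1] s E]
    unfolding svdD(8)[OF Y(1), symmetric] by simp
  show "((\<lambda>e. cinner (dop (\<lambda>n. s n powr (p - 1)) v u e) (Y e)) has_sum
      (\<Sum>m. of_real (t m) * cinner (dop (\<lambda>n. s n powr (p - 1)) v u (f m)) (g m))) E"
    using has_sum_dop_cinner_dop[OF conjugate_exponent(1)[OF p] p conjugate_exponent(3)[OF p]
      svdD(1,2)[OF X(1)] _ svdD(10)[OF X(1) p1] s svdD(1,2)[OF Y(1)] svdD(3,9)[OF Y(1)] Y(2) E]
    unfolding svdD(8)[OF Y(1), symmetric] by simp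
qed

lemma pairing_svd:
  assumes X: "svd X s v u" "summable (\<lambda>n. s n powr p)" and Y: "Y \<in> schatten_class p"
  shows "pairing p X Y = (\<Sum>n. of_real (s n powr (p - 1)) * cinner (Y (v n)) (u n))"
proof -
  obtain t f g where Y: "svd Y t f g" "summable (\<lambda>n. t n powr p)"
    using schatten_class_obtain_svd[OF Y] by blast
  have "orthonormal_basis (SOME E::'a set. orthonormal_basis E)"
    by (rule someI_ex[OF orthonormal_basis_exists])
  from infsumI[OF pairing_has_sum(1)[OF X Y this]] show ?thesis
    unfolding pairing_def trace_op_def using p by (simp add: cinner_polar_power_svd[OF X(1)])
qed

lemma pairing_svd_dual:
  assumes X: "svd X s v u" "summable (\<lambda>n. s n powr p)" and Y: "svd Y t f g" "summable (\<lambda>n. t n powr p)"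
    and Y': "Y \<in> schatten_class p"
  shows "pairing p X Y = cnj (\<Sum>m. of_real (t m) * cinner (dop (\<lambda>n. s n powr (p - 1)) v u (f m)) (g m))"
proof -
  obtain E where E: "orthonormal_basis (E::'a set)"
    using orthonormal_basis_exists by blast
  have "((\<lambda>e. cnj (cinner (dop (\<lambda>n. s n powr (p - 1)) v u e) (Y e))) has_sum
      cnj (\<Sum>m. of_real (t m) * cinner (dop (\<lambda>n. s n powr (p - 1)) v u (f m)) (g m))) E"
    using pairing_has_sum(2)[OF X Y E] by (subst has_sum_cnj_iff)
  then show ?thesis
    using has_sum_unique[OF pairing_has_sum(1)[OF X Y E]] pairing_svd[OF X Y']
    by (simp add: cinner_commute[symmetric])
qed

lemma pairing_le:
  assumes "X \<in> schatten_class p" "Y \<in> schatten_class p"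
  shows "cmod (pairing p X Y) \<le> schatten_norm p X powr (p - 1) * schatten_norm p Y"
proof -
  obtain s v u where X: "svd X s v u" "summable (\<lambda>n. s n powr p)"
    using schatten_class_obtain_svd[OF assms(1)] by blast
  show ?thesis
    unfolding pairing_svd[OF X assms(2)]
    by (rule order_trans[OF summable_norm[OF pairing_summable(1)[OF X assms(2)]] pairing_summable(2)[OF X assms(2)]])
qed

lemma pairing_self:
  assumes "X \<in> schatten_class p"
  shows "pairing p X X = of_real (schatten_norm p X powr p)"
proof -
  obtain s v u where X: "svd X s v u" "summable (\<lambda>n. s n powr p)"
    using schatten_class_obtain_svd[OF assms] by blast
  note svd = svdD[OF X(1)]
  have "of_real (s n powr (p - 1)) * cinner (X (v n)) (u n) = complex_of_real (s n powr p)" for n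
  proof (cases "s n = 0")
    case False
    then have "cinner (X (v n)) (u n) = of_real (s n)"
      using svd(6,7) unfolding svd(8) dop_basis[OF svd(1,2,9)]
      by (simp add: cinner_scaleR_left orthosysD[OF svd(2)])
    then show ?thesis
      using svd(3)[of n] False by (simp add: powr_mult_base mult.commute flip: of_real_mult)
  qed simp
  then have "pairing p X X = complex_of_real (\<Sum>n. s n powr p)"
    unfolding pairing_svd[OF X assms] using X(2) by (simp add: suminf_of_real)
  also have "(\<Sum>n. s n powr p) = schatten_norm p X powr p"
    using p X(2) by (simp add: schatten_norm_svd[OF X(1)] powr_powr suminf_nonneg)
  finally show ?thesis .
qed

end

section \<open>Sums and scalar multiples in the Schatten class\<close>

lemma compact_operator_add:
  assumes "compact_operator X" "compact_operator Y"
  shows "compact_operator (op_add X Y)"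
  unfolding compact_operator_def
proof
  show "bounded_clinear (op_add X Y)"
    using assms unfolding op_add_def compact_operator_def by (intro bounded_clinear_add) auto
  let ?K = "{x + y |x y. x \<in> closure (X ` cball 0 1) \<and> y \<in> closure (Y ` cball 0 1)}"
  have K: "compact ?K"
    using assms by (intro compact_sums) (auto simp: compact_operator_def)
  have "op_add X Y ` cball 0 1 \<subseteq> ?K"
    using closure_subset[of "X ` cball 0 1"] closure_subset[of "Y ` cball 0 1"] unfolding op_add_def by blast
  then have "closure (op_add X Y ` cball 0 1) \<subseteq> ?K"
    using K by (intro closure_minimal compact_imp_closed)
  from Int_absorb1[OF this] compact_Int_closed[OF K closed_closure[of "op_add X Y ` cball 0 1"]]
  show "compact (closure (op_add X Y ` cball 0 1))" by (rule subst)
qed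

lemma compact_operator_scale:
  assumes "compact_operator X"
  shows "compact_operator (op_scale a X)"
  unfolding compact_operator_def
proof
  show "bounded_clinear (op_scale a X)"
    using assms unfolding op_scale_def compact_operator_def by (intro bounded_clinear_scaleC) auto
  let ?K = "(\<lambda>x. a *\<^sub>C x) ` closure (X ` cball 0 1)"
  have K: "compact ?K"
    using assms
    by (intro compact_continuous_image linear_continuous_on bounded_linear_scaleC_right) (auto simp: compact_operator_def)
  have "op_scale a X ` cball 0 1 \<subseteq> ?K"
    using closure_subset[of "X ` cball 0 1"] unfolding op_scale_def by blast
  then have "closure (op_scale a X ` cball 0 1) \<subseteq> ?K"
    using K by (intro closure_minimal compact_imp_closed)
  from Int_absorb1[OF this] compact_Int_closed[OF K closed_closure[of "op_scale a X ` cball 0 1"]]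
  show "compact (closure (op_scale a X ` cball 0 1))" by (rule subst)
qed

text \<open>The modulus of \<open>a\<close> goes into the singular values and its phase into
  \<open>u\<close>. For a = 0 the zeros of \<open>v\<close> would in general no longer match those
  of the singular values, so that case is handled through the zero operator.\<close>

lemma svd_scale:
  assumes X: "svd X s v u" and a: "a \<noteq> 0"
  shows "svd (op_scale a X) (\<lambda>n. cmod a * s n) v (\<lambda>n. sgn a *\<^sub>C u n)"
proof -
  note svd = svdD[OF X]
  have sgn: "cnj (sgn a) * sgn a = 1"
    using a by (simp add: complex_norm_square[symmetric] norm_sgn mult.commute[of "cnj _"])
  have u: "orthosys UNIV (\<lambda>n. sgn a *\<^sub>C u n)"
    using a unfolding orthosys_def
    by (simp add: cinner_scaleC_left cinner_scaleC_right orthosysD[OF svd(2)] sgn_zero_iff sgn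
        complex_vector.scale_eq_0_iff mult.assoc[symmetric])
  have bound: "\<forall>n. \<bar>cmod a * s n\<bar> \<le> cmod a * s 0"
    using svd(9) by (auto simp: abs_mult intro!: mult_left_mono)
  have "op_scale a X x = dop (\<lambda>n. cmod a * s n) v (\<lambda>n. sgn a *\<^sub>C u n) x" for x
  proof -
    have "cmod a * sgn a = a"
      using a by (simp add: sgn_eq)
    then have "(of_real (cmod a * s n) * cinner x (v n)) *\<^sub>C sgn a *\<^sub>C u n
        = a *\<^sub>C ((of_real (s n) * cinner x (v n)) *\<^sub>C u n)" for n
      by (simp add: scaleC_scaleC)
    with dop_sums[OF svd(1) u bound, of x] have "(\<lambda>n. a *\<^sub>C ((of_real (s n) * cinner x (v n)) *\<^sub>C u n)) sums
        dop (\<lambda>n. cmod a * s n) v (\<lambda>n. sgn a *\<^sub>C u n) x"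
      by (simp only:)
    moreover have "(\<lambda>n. a *\<^sub>C ((of_real (s n) * cinner x (v n)) *\<^sub>C u n)) sums op_scale a X x"
      unfolding op_scale_def svd(8)
      by (rule bounded_linear.sums[OF bounded_linear_scaleC_right dop_sums[OF svd(1,2,9)]])
    ultimately show ?thesis using sums_unique2 by blast
  qed
  moreover have "decseq (\<lambda>n. cmod a * s n)"
    using svd(4) by (auto simp: decseq_def intro!: mult_left_mono)
  moreover have "(\<lambda>n. cmod a * s n) \<longlonglongrightarrow> 0"
    using tendsto_mult_right_zero[OF svd(5)] .
  ultimately show ?thesis
    unfolding svd_def using svd u a by (auto simp: sgn_zero_iff complex_vector.scale_eq_0_iff)
qed

context
  fixes p :: real
  assumes p: "1 < p"
begin

lemma schatten_scale_nonzero: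
  assumes X: "X \<in> schatten_class p" and a: "a \<noteq> 0"
  shows "op_scale a X \<in> schatten_class p" "schatten_norm p (op_scale a X) = cmod a * schatten_norm p X"
proof -
  obtain s v u where svd: "svd X s v u" "summable (\<lambda>n. s n powr p)"
    using schatten_class_obtain_svd[OF X] by blast
  have eq: "(\<lambda>n. (cmod a * s n) powr p) = (\<lambda>n. cmod a powr p * s n powr p)"
    using svdD(3)[OF svd(1)] by (simp add: powr_mult)
  show "op_scale a X \<in> schatten_class p"
    using X compact_operator_scale unfolding schatten_class_def
    by (auto simp: singular_value_svd[OF svd_scale[OF svd(1) a]] eq intro!: summable_mult svd)
  show "schatten_norm p (op_scale a X) = cmod a * schatten_norm p X"
    unfolding schatten_norm_svd[OF svd_scale[OF svd(1) a]] schatten_norm_svd[OF svd(1)] eq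
    using svd(2) p by (simp add: suminf_mult powr_mult powr_powr suminf_nonneg)
qed

lemma schatten_zero: "(\<lambda>v::'a::complex_hilbert. 0) \<in> schatten_class p" "schatten_norm p (\<lambda>v::'a. 0) = 0"
proof -
  have svd: "svd (\<lambda>v::'a. 0) (\<lambda>n. 0) (\<lambda>n. 0) (\<lambda>n. 0)"
    unfolding svd_def by (auto simp: orthosys_def dop_def)
  have "(\<lambda>v. 0) ` cball (0::'a) 1 = {0::'a}"
    using image_constant[of 0 "cball (0::'a) 1"] by simp
  then have "compact_operator (\<lambda>v::'a. 0)"
    by (simp add: compact_operator_def bounded_clinear_def)
  then show "(\<lambda>v::'a. 0) \<in> schatten_class p"
    by (simp add: schatten_class_def singular_value_svd[OF svd])
  show "schatten_norm p (\<lambda>v::'a. 0) = 0"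
    by (simp add: schatten_norm_svd[OF svd])
qed

lemma schatten_scale:
  assumes X: "X \<in> schatten_class p"
  shows "op_scale a X \<in> schatten_class p" "schatten_norm p (op_scale a X) = cmod a * schatten_norm p X"
proof -
  have "op_scale 0 X = (\<lambda>v. 0)" by (simp add: op_scale_def)
  then have "op_scale a X \<in> schatten_class p \<and> schatten_norm p (op_scale a X) = cmod a * schatten_norm p X"
    using schatten_scale_nonzero[OF X, of a] schatten_zero by (cases "a = 0") auto
  then show "op_scale a X \<in> schatten_class p" "schatten_norm p (op_scale a X) = cmod a * schatten_norm p X"
    by auto
qed

text \<open>Minkowski's inequality by duality: with \<open>W = X + Y = \<Sum>w\<^sub>n \<langle>\<cdot>, a\<^sub>n\<rangle> b\<^sub>n\<close>, partial sums of \<open>\<Sum>w\<^sub>n\<^sup>p\<close> are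
  partial sums of \<open>\<Sum>w\<^sub>n\<^bsup>p-1\<^esup> \<langle>(X + Y) a\<^sub>n, b\<^sub>n\<rangle>\<close>, to which Hoelder applies.\<close>

lemma schatten_add:
  assumes X: "X \<in> schatten_class p" and Y: "Y \<in> schatten_class p"
  shows "op_add X Y \<in> schatten_class p"
    "schatten_norm p (op_add X Y) \<le> schatten_norm p X + schatten_norm p Y"
proof -
  define C where "C = schatten_norm p X + schatten_norm p Y"
  have "0 \<le> C" by (simp add: C_def)
  obtain s v u where svdX: "svd X s v u" "summable (\<lambda>n. s n powr p)"
    using schatten_class_obtain_svd[OF X] by blast
  obtain t f g where svdY: "svd Y t f g" "summable (\<lambda>n. t n powr p)"
    using schatten_class_obtain_svd[OF Y] by blast
  have comp: "compact_operator (op_add X Y)"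
    using X Y by (intro compact_operator_add) (auto simp: schatten_class_def)
  then obtain w a b where svd: "svd (op_add X Y) w a b"
    using compact_operator_svd by blast
  note W = svdD[OF svd]
  note bessel = W(1,2)[THEN orthosys_imp_bessel_system]
  \<comment> \<open>Partial sums are needed because summability is not yet known. For finite S > 0
    the inequality S \<le> S^((p-1)/p) C may be divided by the power of S, leaving S^(1/p) \<le>
    C.\<close>
  have bound: "(\<Sum>k<K. w k powr p) \<le> C powr p" for K
  proof -
    define S where "S = (\<Sum>k<K. w k powr p)"
    have "0 \<le> S" by (simp add: S_def sum_nonneg)
    have summand_le: "w k powr p \<le> w k powr (p - 1) * cmod (cinner (X (a k)) (b k))
        + w k powr (p - 1) * cmod (cinner (Y (a k)) (b k))" for k
    proof (cases "w k = 0")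
      case False
      then have "of_real (w k) = cinner (op_add X Y (a k)) (b k)"
        using W(6,7) unfolding W(8) dop_basis[OF W(1,2,9)]
        by (simp add: cinner_scaleR_left orthosysD[OF W(2)])
      also have "\<dots> = cinner (X (a k)) (b k) + cinner (Y (a k)) (b k)"
        by (simp add: op_add_def cinner_add_left)
      finally have "w k \<le> cmod (cinner (X (a k)) (b k)) + cmod (cinner (Y (a k)) (b k))"
        using norm_triangle_ineq[of "cinner (X (a k)) (b k)" "cinner (Y (a k)) (b k)"] W(3)[of k]
        by (metis norm_of_real abs_of_nonneg)
      then have "w k powr (p - 1) * w k \<le> w k powr (p - 1) * (cmod (cinner (X (a k)) (b k)) + cmod (cinner (Y (a k)) (b k)))"
        by (intro mult_left_mono) auto
      moreover have "w k powr (p - 1) * w k = w k powr p"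
        using W(3)[of k] False by (simp add: powr_mult_base mult.commute)
      ultimately show ?thesis by (simp add: ring_distribs)
    qed simp
    have "S \<le> (\<Sum>k<K. w k powr (p - 1) * cmod (cinner (X (a k)) (b k)))
        + (\<Sum>k<K. w k powr (p - 1) * cmod (cinner (Y (a k)) (b k)))"
      unfolding S_def sum.distrib[symmetric] by (intro sum_mono summand_le)
    also have "\<dots> \<le> S powr ((p - 1) / p) * schatten_norm p X + S powr ((p - 1) / p) * schatten_norm p Y"
      unfolding S_def using W(3)
      by (intro add_mono svd_Holder[OF p svdX bessel finite_lessThan] svd_Holder[OF p svdY bessel finite_lessThan])
    finally have le: "S \<le> S powr ((p - 1) / p) * C"
      by (simp add: C_def ring_distribs)
    show ?thesis
    proof (cases "S = 0")
      case False
      with \<open>0 \<le> S\<close> have "0 < S" by simp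
      have "S powr ((p - 1) / p) * S powr (1 / p) = S powr ((p - 1) / p + 1 / p)"
        by (simp add: powr_add)
      also have "(p - 1) / p + 1 / p = 1" using p by (simp add: field_simps)
      finally have "S powr ((p - 1) / p) * S powr (1 / p) = S"
        using \<open>0 < S\<close> by simp
      with le have "S powr ((p - 1) / p) * S powr (1 / p) \<le> S powr ((p - 1) / p) * C" by simp
      then have "S powr (1 / p) \<le> C"
        using \<open>0 < S\<close> by (simp add: mult_le_cancel_left)
      then have "(S powr (1 / p)) powr p \<le> C powr p"
        using p by (intro powr_mono2) auto
      then show ?thesis
        using p \<open>0 < S\<close> by (simp add: powr_powr S_def)
    qed (simp add: S_def)
  qed
  then have summable: "summable (\<lambda>n. w n powr p)"
    by (intro summableI_nonneg_bounded) auto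
  then show "op_add X Y \<in> schatten_class p"
    using comp by (simp add: schatten_class_def singular_value_svd[OF svd])
  have "(\<Sum>n. w n powr p) powr (1 / p) \<le> (C powr p) powr (1 / p)"
    using p bound summable by (intro powr_mono2 suminf_le_const) (auto intro: suminf_nonneg)
  then show "schatten_norm p (op_add X Y) \<le> schatten_norm p X + schatten_norm p Y"
    using p \<open>0 \<le> C\<close> by (simp add: schatten_norm_svd[OF svd] powr_powr C_def)
qed

section \<open>Linearity and homogeneity of the pairing\<close>

lemma pairing_add:
  assumes X: "X \<in> schatten_class p" and Y: "Y \<in> schatten_class p" and Z: "Z \<in> schatten_class p"
  shows "pairing p X (op_add Y Z) = pairing p X Y + pairing p X Z"
proof -
  obtain s v u where svd: "svd X s v u" "summable (\<lambda>n. s n powr p)"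
    using schatten_class_obtain_svd[OF X] by blast
  show ?thesis
    unfolding pairing_svd[OF p svd Y] pairing_svd[OF p svd Z] pairing_svd[OF p svd schatten_add(1)[OF Y Z]]
      suminf_add[OF pairing_summable(1)[OF p svd Y, THEN summable_norm_cancel] pairing_summable(1)[OF p svd Z, THEN summable_norm_cancel]]
    by (simp add: op_add_def cinner_add_left ring_distribs)
qed

lemma pairing_scale_right:
  assumes X: "X \<in> schatten_class p" and Y: "Y \<in> schatten_class p"
  shows "pairing p X (op_scale a Y) = a * pairing p X Y"
proof -
  obtain s v u where svd: "svd X s v u" "summable (\<lambda>n. s n powr p)"
    using schatten_class_obtain_svd[OF X] by blast
  show ?thesis
    unfolding pairing_svd[OF p svd Y] pairing_svd[OF p svd schatten_scale(1)[OF Y]]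
      suminf_mult[OF pairing_summable(1)[OF p svd Y, THEN summable_norm_cancel], symmetric]
    by (simp add: op_scale_def cinner_scaleC_left mult_ac)
qed

lemma pairing_scale_left:
  assumes X: "X \<in> schatten_class p" and Y: "Y \<in> schatten_class p" and a: "a \<noteq> 0"
  shows "pairing p (op_scale a X) Y = of_real (cmod a powr (p - 1)) * cnj (sgn a) * pairing p X Y"
proof -
  obtain s v u where svd: "svd X s v u" "summable (\<lambda>n. s n powr p)"
    using schatten_class_obtain_svd[OF X] by blast
  have "summable (\<lambda>n. (cmod a * s n) powr p)"
    using svdD(3)[OF svd(1)] svd(2) by (simp add: powr_mult summable_mult)
  from pairing_svd[OF p svd_scale[OF svd(1) a] this Y] show ?thesis
    unfolding pairing_svd[OF p svd Y]
      suminf_mult[OF pairing_summable(1)[OF p svd Y, THEN summable_norm_cancel], symmetric]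
    using svdD(3)[OF svd(1)] by (simp add: powr_mult cinner_scaleC_right mult_ac)
qed

end

section \<open>Smoothness of the Schatten norm\<close>

text \<open>Since y^r = y (y^2)^((r-1)/2), the Weierstrass theorem is applied in z = y^2. For r < 1
  the second factor is unbounded at 0, hence the cut-off at \<delta> with \<delta>^r = \<epsilon>/2:
  below it, both y^r and its replacement lie between 0 and \<epsilon>/2.\<close>

lemma powr_odd_polynomial_approximation:
  fixes r M \<epsilon> :: real
  assumes r: "0 < r" and M: "0 \<le> M" and \<epsilon>: "0 < \<epsilon>"
  obtains c n where "\<And>y. 0 \<le> y \<Longrightarrow> y \<le> M \<Longrightarrow> \<bar>y powr r - y * (\<Sum>i\<le>n. c i * (y\<^sup>2) ^ i)\<bar> \<le> \<epsilon>"
proof -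
  define \<delta> where "\<delta> = (\<epsilon> / 2) powr (1 / r)"
  have \<delta>: "0 < \<delta>" "\<delta> powr r = \<epsilon> / 2"
    using \<epsilon> r by (auto simp: \<delta>_def powr_powr)
  define k where "k z = (max z (\<delta>\<^sup>2)) powr ((r - 1) / 2)" for z
  have "continuous_on {0..M\<^sup>2} k"
    unfolding k_def using \<delta>(1) by (intro continuous_intros) (auto simp: max_def)
  \<comment> \<open>The error is divided by \<open>M + 1\<close> because it will be multiplied by y
    \<le> M.\<close>
  then obtain h where h: "real_polynomial_function h" "\<And>z. z \<in> {0..M\<^sup>2} \<Longrightarrow> \<bar>k z - h z\<bar> < \<epsilon> / (2 * (M + 1))"
    using Stone_Weierstrass_real_polynomial_function[of "{0..M\<^sup>2}" k "\<epsilon> / (2 * (M + 1))"] \<epsilon> M by auto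
  obtain c n where c: "h = (\<lambda>z. \<Sum>i\<le>n. c i * z ^ i)"
    using h(1) unfolding real_polynomial_function_iff_sum by blast
  have k_powr: "y * k (y\<^sup>2) = y * (max y \<delta>) powr (r - 1)" if "0 \<le> y" for y
  proof -
    have "max (y\<^sup>2) (\<delta>\<^sup>2) = (max y \<delta>)\<^sup>2"
      using that \<delta>(1) by (auto simp: max_def power_mono intro!: antisym)
    also have "\<dots> = (max y \<delta>) powr 2"
      using \<delta>(1) by (simp add: powr_numeral)
    finally have "max (y\<^sup>2) (\<delta>\<^sup>2) = max y \<delta> powr 2" .
    moreover have "2 * ((r - 1) / 2) = r - 1" by simp
    ultimately show ?thesis by (simp only: k_def powr_powr)
  qed
  show thesis
  proof (rule that[of c n])
    fix y :: real assume y: "0 \<le> y" "y \<le> M"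
    have "\<bar>y powr r - y * k (y\<^sup>2)\<bar> \<le> \<epsilon> / 2"
    proof (cases "\<delta> \<le> y")
      case True
      then have "y * k (y\<^sup>2) = y powr r"
        using \<delta>(1) by (simp add: k_powr y powr_mult_base max_def)
      then show ?thesis using \<epsilon> by simp
    next
      case False
      have "y * \<delta> powr (r - 1) \<le> \<delta> * \<delta> powr (r - 1)"
        using False by (intro mult_right_mono) auto
      also have "\<dots> = \<epsilon> / 2"
        using \<delta> by (simp add: powr_mult_base)
      finally have "y * k (y\<^sup>2) \<le> \<epsilon> / 2"
        using False by (simp add: k_powr y max_def)
      moreover have "0 \<le> y * k (y\<^sup>2)" using y by (simp add: k_def)
      moreover have "y powr r \<le> \<epsilon> / 2"
        unfolding \<delta>(2)[symmetric] using False y r by (intro powr_mono2) auto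
      ultimately show ?thesis using powr_ge_zero[of y r] by linarith
    qed
    moreover have "\<bar>y * k (y\<^sup>2) - y * h (y\<^sup>2)\<bar> \<le> \<epsilon> / 2"
    proof -
      have "\<bar>y * k (y\<^sup>2) - y * h (y\<^sup>2)\<bar> = y * \<bar>k (y\<^sup>2) - h (y\<^sup>2)\<bar>"
        using y by (simp add: abs_mult flip: right_diff_distrib)
      also have "\<dots> \<le> (M + 1) * (\<epsilon> / (2 * (M + 1)))"
        using y h(2)[of "y\<^sup>2"] by (intro mult_mono) (auto intro: less_imp_le power_mono)
      also have "\<dots> = \<epsilon> / 2" using M by (simp add: field_simps)
      finally show ?thesis .
    qed
    ultimately show "\<bar>y powr r - y * (\<Sum>i\<le>n. c i * (y\<^sup>2) ^ i)\<bar> \<le> \<epsilon>"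
      unfolding c by linarith
  qed
qed

lemma svd_odd_power:
  assumes "svd X s v u"
  shows "X (((cadjoint X \<circ> X) ^^ k) x) = dop (\<lambda>n. s n * ((s n)\<^sup>2) ^ k) v u x"
proof -
  note X = svdD[OF assms]
  have adj: "cadjoint X = dop s u v"
    unfolding X(8) by (rule cadjoint_eqI) (rule dop_adjoint[OF X(1,2,9)])
  have bound: "\<forall>n. \<bar>s n * ((s n)\<^sup>2) ^ k\<bar> \<le> s 0 * ((s 0)\<^sup>2) ^ k" for k
    using X(3,9) by (auto simp: abs_mult power_abs intro!: mult_mono power_mono)
  have XX: "cadjoint X (dop (\<lambda>n. s n * ((s n)\<^sup>2) ^ k) v u x) = dop (\<lambda>n. s n * (s n * ((s n)\<^sup>2) ^ k)) v v x" for k x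
    unfolding adj by (rule dop_dop[OF X(1,2) bound]) (use X(6,7) in simp)
  have bound': "\<forall>n. \<bar>s n * (s n * ((s n)\<^sup>2) ^ k)\<bar> \<le> s 0 * (s 0 * ((s 0)\<^sup>2) ^ k)" for k
    using X(3,9) by (auto simp: abs_mult power_abs intro!: mult_mono power_mono)
  have X_v: "X (dop (\<lambda>n. s n * (s n * ((s n)\<^sup>2) ^ k)) v v x) = dop (\<lambda>n. s n * (s n * (s n * ((s n)\<^sup>2) ^ k))) v u x" for k x
    unfolding X(8) by (rule dop_dop[OF X(1,1) bound']) (use X(6,7) in simp)
  show ?thesis
  proof (induction k)
    case (Suc k)
    have "X (((cadjoint X \<circ> X) ^^ Suc k) x) = X (cadjoint X (X (((cadjoint X \<circ> X) ^^ k) x)))"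
      by simp
    also have "\<dots> = dop (\<lambda>n. s n * ((s n)\<^sup>2) ^ Suc k) v u x"
      unfolding Suc.IH XX X_v by (simp add: power2_eq_square mult_ac)
    finally show ?case .
  qed (use X(8) in simp)
qed

lemma dop_sum_coeff:
  assumes "orthosys UNIV v" "orthosys UNIV u" "\<And>i. i \<in> I \<Longrightarrow> \<forall>n. \<bar>c i n\<bar> \<le> C i"
  shows "dop (\<lambda>n. \<Sum>i\<in>I. a i * c i n) v u x = (\<Sum>i\<in>I. a i *\<^sub>R dop (c i) v u x)"
proof -
  have "(\<lambda>n. \<Sum>i\<in>I. a i *\<^sub>R ((of_real (c i n) * cinner x (v n)) *\<^sub>C u n)) sums (\<Sum>i\<in>I. a i *\<^sub>R dop (c i) v u x)"
    by (rule sums_sum, rule sums_scaleR_right, rule dop_sums[OF assms(1,2) assms(3)])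
  moreover have "(\<Sum>i\<in>I. a i *\<^sub>R ((of_real (c i n) * cinner x (v n)) *\<^sub>C u n))
      = (of_real (\<Sum>i\<in>I. a i * c i n) * cinner x (v n)) *\<^sub>C u n" for n
    by (simp add: scaleC_scaleC sum_distrib_right complex_vector.scale_sum_left mult.assoc flip: scaleC_of_real)
  ultimately show ?thesis
    unfolding dop_def[of "\<lambda>n. \<Sum>i\<in>I. a i * c i n"] by (intro sums_unique[symmetric]) (simp only:)
qed

text \<open>Strong continuity of \<open>X = U|X| \<mapsto> U|X|\<^sup>r\<close>.  On odd polynomials this map is \<open>X \<mapsto> X h(X\<^sup>* X)\<close>, which is
  visibly continuous, and \<open>y\<^sup>r\<close> is a uniform limit of odd polynomials on \<open>[0, M]\<close>.\<close>

lemma tendsto_dop_powr: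
  fixes X :: "'a::complex_hilbert \<Rightarrow> 'a" and W :: "'i \<Rightarrow> 'a \<Rightarrow> 'a"
  assumes r: "0 < r" and X: "svd X s v u" and W: "\<And>i. svd (W i) (s' i) (v' i) (u' i)"
    and M: "s 0 \<le> M" "\<forall>\<^sub>F i in G. s' i 0 \<le> M"
    and conv: "\<And>k x. ((\<lambda>i. W i (((cadjoint (W i) \<circ> W i) ^^ k) x)) \<longlongrightarrow> X (((cadjoint X \<circ> X) ^^ k) x)) G"
  shows "((\<lambda>i. dop (\<lambda>n. s' i n powr r) (v' i) (u' i) x) \<longlongrightarrow> dop (\<lambda>n. s n powr r) v u x) G"
proof (rule tendstoI)
  fix e :: real assume e: "0 < e"
  define \<epsilon> where "\<epsilon> = e / (4 * (norm x + 1))"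
  have \<epsilon>: "0 < \<epsilon>" "\<epsilon> * norm x < e / 3"
  proof -
    show "0 < \<epsilon>" using e by (simp add: \<epsilon>_def add_nonneg_pos)
    have "\<epsilon> * norm x \<le> \<epsilon> * (norm x + 1)" using \<open>0 < \<epsilon>\<close> by simp
    also have "\<dots> = e / 4"
    proof -
      have "e / (4 * d) * d = e / 4" if "0 < d" for d :: real using that by simp
      from this[OF add_nonneg_pos[OF norm_ge_zero zero_less_one, of x]] show ?thesis by (simp only: \<epsilon>_def)
    qed
    also have "\<dots> < e / 3" using e by simp
    finally show "\<epsilon> * norm x < e / 3" .
  qed
  have "0 \<le> M" using M(1) svdD(3)[OF X, of 0] by simp
  then obtain c n where approx: "\<And>y. 0 \<le> y \<Longrightarrow> y \<le> M \<Longrightarrow> \<bar>y powr r - y * (\<Sum>i\<le>n. c i * (y\<^sup>2) ^ i)\<bar> \<le> \<epsilon>"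
    using powr_odd_polynomial_approximation[OF r _ \<epsilon>(1)] by metis
  \<comment> \<open>The same polynomial serves \<open>X\<close> and eventually every
    \<open>W i\<close>, because all their singular values lie in [0, M].\<close>
  define T where "T X = (\<Sum>i\<le>n. c i *\<^sub>R X (((cadjoint X \<circ> X) ^^ i) x))" for X :: "'a \<Rightarrow> 'a"
  have T: "norm (dop (\<lambda>n. s n powr r) v u x - T X) < e / 3" if X: "svd X s v u" "s 0 \<le> M" for X s v u
  proof -
    note svd = svdD[OF X(1)]
    have bound: "\<forall>n. \<bar>s n * ((s n)\<^sup>2) ^ k\<bar> \<le> s 0 * ((s 0)\<^sup>2) ^ k" for k
      using svd(3,9) by (auto simp: abs_mult power_abs intro!: mult_mono power_mono)
    have le: "s n \<le> M" for n
      using spec[OF svd(9), of n] svd(3)[of n] X(2) by simp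
    have "T X = dop (\<lambda>m. \<Sum>i\<le>n. c i * (s m * ((s m)\<^sup>2) ^ i)) v u x"
      unfolding T_def svd_odd_power[OF X(1)] by (rule dop_sum_coeff[OF svd(1,2) bound, symmetric])
    also have "(\<lambda>m. \<Sum>i\<le>n. c i * (s m * ((s m)\<^sup>2) ^ i)) = (\<lambda>m. s m * (\<Sum>i\<le>n. c i * ((s m)\<^sup>2) ^ i))"
      by (simp add: sum_distrib_left mult_ac)
    finally have TX: "T X = dop (\<lambda>m. s m * (\<Sum>i\<le>n. c i * ((s m)\<^sup>2) ^ i)) v u x" .
    have "\<forall>m. \<bar>s m powr r - s m * (\<Sum>i\<le>n. c i * ((s m)\<^sup>2) ^ i)\<bar> \<le> \<epsilon>"
      using approx svd(3) le by blast
    note diff = norm_dop_le[OF svd(1,2) this, of x]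
    have bound2: "\<forall>m. \<bar>s m * (\<Sum>i\<le>n. c i * ((s m)\<^sup>2) ^ i)\<bar> \<le> s 0 powr r + \<epsilon>"
    proof
      fix m
      show "\<bar>s m * (\<Sum>i\<le>n. c i * ((s m)\<^sup>2) ^ i)\<bar> \<le> s 0 powr r + \<epsilon>"
        using approx[OF svd(3)[of m] le[of m]] svd(10)[of r] r by (smt (verit))
    qed
    have "dop (\<lambda>m. s m powr r - s m * (\<Sum>i\<le>n. c i * ((s m)\<^sup>2) ^ i)) v u x = dop (\<lambda>n. s n powr r) v u x - T X"
      unfolding TX dop_def[of "\<lambda>m. s m powr r - s m * (\<Sum>i\<le>n. c i * ((s m)\<^sup>2) ^ i)"]
      using sums_diff[OF dop_sums[OF svd(1,2) svd(10)[OF less_imp_le[OF r]], of x] dop_sums[OF svd(1,2) bound2, of x]]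
      by (intro sums_unique[symmetric]) (simp add: left_diff_distrib complex_vector.scale_left_diff_distrib)
    with diff \<epsilon>(2) show ?thesis by simp
  qed
  have "((\<lambda>i. T (W i)) \<longlongrightarrow> T X) G"
    unfolding T_def by (intro tendsto_intros conv)
  then have "\<forall>\<^sub>F i in G. dist (T (W i)) (T X) < e / 3"
    using e tendstoD by (metis divide_pos_pos zero_less_numeral)
  then show "\<forall>\<^sub>F i in G. dist (dop (\<lambda>n. s' i n powr r) (v' i) (u' i) x) (dop (\<lambda>n. s n powr r) v u x) < e"
    using M(2)
  proof eventually_elim
    case (elim i)
    have "norm (dop (\<lambda>n. s' i n powr r) (v' i) (u' i) x - T (W i)) < e / 3"
      by (rule T[OF W elim(2)])
    moreover have "norm (dop (\<lambda>n. s n powr r) v u x - T X) < e / 3"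
      by (rule T[OF X M(1)])
    ultimately show ?case
      using elim(1) norm_triangle_ineq4[of "dop (\<lambda>n. s' i n powr r) (v' i) (u' i) x - T (W i) + (T (W i) - T X)" "dop (\<lambda>n. s n powr r) v u x - T X"]
        norm_triangle_ineq[of "dop (\<lambda>n. s' i n powr r) (v' i) (u' i) x - T (W i)" "T (W i) - T X"]
      by (simp add: dist_norm)
  qed
qed

text \<open>Both \<open>W r\<close> and its adjoint are affine in \<open>r\<close> with bounded
  coefficients, so they preserve convergence of their arguments, and induction on \<open>k\<close>
  iterates this.\<close>

lemma tendsto_gram_powers:
  fixes X Y :: "'a::complex_hilbert \<Rightarrow> 'a"
  assumes X: "bounded_clinear X" and Y: "bounded_clinear Y"
  defines "W \<equiv> \<lambda>r. op_add X (op_scale (complex_of_real r) Y)"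
  shows "((\<lambda>r. ((cadjoint (W r) \<circ> W r) ^^ k) x) \<longlongrightarrow> ((cadjoint X \<circ> X) ^^ k) x) (at_right 0)"
    and "((\<lambda>r. W r (((cadjoint (W r) \<circ> W r) ^^ k) x)) \<longlongrightarrow> X (((cadjoint X \<circ> X) ^^ k) x)) (at_right 0)"
proof -
  have adj: "bounded_linear (cadjoint A)" if A: "bounded_clinear A" for A :: "'a \<Rightarrow> 'a"
  proof -
    have add: "cadjoint A (y + z) = cadjoint A y + cadjoint A z" for y z
      by (rule cinner_right_eqI) (simp add: cinner_add_right cinner_cadjoint[OF A, symmetric])
    have scale: "cadjoint A (r *\<^sub>R y) = r *\<^sub>R cadjoint A y" for r y
      by (rule cinner_right_eqI) (simp add: cinner_scaleR_right cinner_cadjoint[OF A, symmetric])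
    have "norm (cadjoint A y) \<le> norm y * onorm A" for y
    proof (cases "cadjoint A y = 0")
      case False
      have "(norm (cadjoint A y))\<^sup>2 = cmod (cinner (cadjoint A y) (cadjoint A y))"
        by (simp add: cinner_self norm_power)
      also have "\<dots> = cmod (cinner (A (cadjoint A y)) y)"
        by (simp add: cinner_cadjoint[OF A])
      also have "\<dots> \<le> norm (A (cadjoint A y)) * norm y"
        by (rule cinner_norm_le)
      also have "\<dots> \<le> (onorm A * norm (cadjoint A y)) * norm y"
        by (intro mult_right_mono bounded_clinear_onorm[OF A]) simp
      finally show ?thesis
        using False by (simp add: power2_eq_square mult_ac)
    qed (simp add: onorm_pos_le[OF bounded_clinearD(1)[OF A]])
    then show ?thesis
      by (intro bounded_linear_intro[where K = "onorm A"]) (simp_all add: add scale)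
  qed
  have W_adj: "cadjoint (W r) y = cadjoint X y + r *\<^sub>R cadjoint Y y" for r y
  proof -
    have "cadjoint (W r) = (\<lambda>y. cadjoint X y + r *\<^sub>R cadjoint Y y)"
      by (rule cadjoint_eqI)
         (simp add: W_def op_add_def op_scale_def scaleC_of_real cinner_add_left cinner_add_right
           cinner_scaleR_left cinner_scaleR_right cinner_cadjoint[OF X] cinner_cadjoint[OF Y])
    then show ?thesis by simp
  qed
  have r0: "((\<lambda>r. r) \<longlongrightarrow> 0) (at_right (0::real))" by (rule tendsto_ident_at)
  have perturb: "((\<lambda>r. A (y r) + r *\<^sub>R B (y r)) \<longlongrightarrow> A z) (at_right 0)"
    if "bounded_linear A" "bounded_linear B" "(y \<longlongrightarrow> z) (at_right 0)" for A B :: "'a \<Rightarrow> 'a" and y z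
    using tendsto_add[OF bounded_linear.tendsto[OF that(1,3)]
      tendsto_scaleR[OF r0 bounded_linear.tendsto[OF that(2,3)]]] by simp
  have W_tendsto: "((\<lambda>r. W r (y r)) \<longlongrightarrow> X z) (at_right 0)" if "(y \<longlongrightarrow> z) (at_right 0)" for y z
    unfolding W_def op_add_def op_scale_def scaleC_of_real
    by (rule perturb[OF bounded_clinearD(1)[OF X] bounded_clinearD(1)[OF Y] that])
  show *: "((\<lambda>r. ((cadjoint (W r) \<circ> W r) ^^ k) x) \<longlongrightarrow> ((cadjoint X \<circ> X) ^^ k) x) (at_right 0)"
  proof (induction k)
    case (Suc k)
    show ?case
      using perturb[OF adj[OF X] adj[OF Y] W_tendsto[OF Suc]] by (simp add: W_adj comp_def)
  qed simp
  show "((\<lambda>r. W r (((cadjoint (W r) \<circ> W r) ^^ k) x)) \<longlongrightarrow> X (((cadjoint X \<circ> X) ^^ k) x)) (at_right 0)"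
    by (rule W_tendsto[OF *])
qed

context
  fixes p :: real
  assumes p: "1 < p"
begin

text \<open>The singular vectors of \<open>W r\<close> need not converge, so the expansion along the
  fixed SVD of \<open>Y\<close> is used. Each term converges by strong continuity of the power, and
  the tails are controlled by those of the series of \<open>t m powr p\<close>.\<close>

lemma tendsto_pairing:
  assumes X: "X \<in> schatten_class p" and Y: "Y \<in> schatten_class p"
  defines "W \<equiv> \<lambda>r. op_add X (op_scale (complex_of_real r) Y)"
  shows "((\<lambda>r. pairing p (W r) Y) \<longlongrightarrow> pairing p X Y) (at_right 0)"
proof -
  define M where "M = schatten_norm p X + schatten_norm p Y"
  have W: "W r \<in> schatten_class p" for r
    unfolding W_def by (intro schatten_add(1) schatten_scale(1) p X Y)
  have NW: "schatten_norm p (W r) \<le> M" if "0 \<le> r" "r \<le> 1" for r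
  proof -
    have "schatten_norm p (W r) \<le> schatten_norm p X + \<bar>r\<bar> * schatten_norm p Y"
      using schatten_add(2)[OF p X schatten_scale(1)[OF p Y, of "of_real r"]] schatten_scale(2)[OF p Y, of "of_real r"]
      unfolding W_def by simp
    also have "\<bar>r\<bar> * schatten_norm p Y \<le> 1 * schatten_norm p Y"
      using that by (intro mult_right_mono) auto
    finally show ?thesis by (simp add: M_def)
  qed
  have small: "\<forall>\<^sub>F r in at_right 0. 0 \<le> r \<and> r \<le> (1::real)"
    using eventually_at_right_real[of 0 "1::real"] by (auto elim: eventually_mono)
  obtain s v u where sX: "svd X s v u" "summable (\<lambda>n. s n powr p)"
    using schatten_class_obtain_svd[OF X] by blast
  obtain t f g where sY: "svd Y t f g" "summable (\<lambda>n. t n powr p)"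
    using schatten_class_obtain_svd[OF Y] by blast
  have "\<exists>s v u. svd (W r) s v u \<and> summable (\<lambda>n. s n powr p)" for r
    using schatten_class_obtain_svd[OF W[of r]] by metis
  then obtain s' v' u' where sW: "\<And>r. svd (W r) (s' r) (v' r) (u' r)" "\<And>r. summable (\<lambda>n. s' r n powr p)"
    by metis
  \<comment> \<open>The exponents are exchanged here: the operator U|Z|^(p-1) belongs to the
    conjugate exponent, and its norm is the (p-1)-th power of that of \<open>Z\<close>.\<close>
  have holder: "(\<Sum>m\<in>A. cmod (of_real (t m) * cinner (dop (\<lambda>n. s n powr (p - 1)) v u (f m)) (g m)))
      \<le> M powr (p - 1) * (\<Sum>m\<in>A. t m powr p) powr (1 / p)"
    if svd: "svd Z s v u" "summable (\<lambda>n. s n powr p)" and Z: "schatten_norm p Z \<le> M" and A: "finite A" for Z s v u A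
  proof -
    have s: "summable (\<lambda>n. (s n powr (p - 1)) powr (p / (p - 1)))"
      unfolding powr_powr conjugate_exponent[OF p] by (rule svd(2))
    have "(\<Sum>m\<in>A. t m * cmod (cinner (dop (\<lambda>n. s n powr (p - 1)) v u (f m)) (g m)))
      \<le> (\<Sum>m\<in>A. t m powr p) powr (1 / p) * (\<Sum>n. (s n powr (p - 1)) powr (p / (p - 1))) powr (1 / (p / (p - 1)))"
      using p svdD(3)[OF sY(1)]
      by (intro dop_Holder[OF conjugate_exponent(1)[OF p] p conjugate_exponent(3)[OF p] svdD(1,2)[OF svd(1)] _ svdD(10)[OF svd(1)] s
            svdD(1,2)[OF sY(1), THEN orthosys_imp_bessel_system] A]) auto
    also have "(\<Sum>n. (s n powr (p - 1)) powr (p / (p - 1))) powr (1 / (p / (p - 1))) = schatten_norm p Z powr (p - 1)"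
      unfolding powr_powr conjugate_exponent[OF p] schatten_norm_svd[OF svd(1)] by simp
    also have "(\<Sum>m\<in>A. t m powr p) powr (1 / p) * \<dots> \<le> (\<Sum>m\<in>A. t m powr p) powr (1 / p) * M powr (p - 1)"
      using p Z by (intro mult_left_mono powr_mono2) auto
    finally show ?thesis
      using svdD(3)[OF sY(1)] by (simp add: norm_mult mult.commute)
  qed
  have "((\<lambda>r. \<Sum>m. of_real (t m) * cinner (dop (\<lambda>n. s' r n powr (p - 1)) (v' r) (u' r) (f m)) (g m)) \<longlongrightarrow>
      (\<Sum>m. of_real (t m) * cinner (dop (\<lambda>n. s n powr (p - 1)) v u (f m)) (g m))) (at_right 0)"
  proof (rule tendsto_suminf_uniform_tails[where w = "\<lambda>m. t m powr p" and \<theta> = "1 / p" and K = "M powr (p - 1)"])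
    have "s 0 \<le> M"
      using singular_value_le_schatten_norm[OF p sX, of 0] schatten_norm_nonneg[of p Y] unfolding M_def by linarith
    moreover have "\<forall>\<^sub>F r in at_right 0. s' r 0 \<le> M"
      using small
      by eventually_elim (use singular_value_le_schatten_norm[OF p sW] NW in \<open>blast intro: order_trans\<close>)
    moreover have "((\<lambda>r. W r (((cadjoint (W r) \<circ> W r) ^^ k) x)) \<longlongrightarrow> X (((cadjoint X \<circ> X) ^^ k) x)) (at_right 0)" for k x
      unfolding W_def by (rule tendsto_gram_powers(2)[OF svdD(11)[OF sX(1)] svdD(11)[OF sY(1)]])
    ultimately have "((\<lambda>r. dop (\<lambda>n. s' r n powr (p - 1)) (v' r) (u' r) x) \<longlongrightarrow> dop (\<lambda>n. s n powr (p - 1)) v u x) (at_right 0)" for x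
      using p by (intro tendsto_dop_powr[OF _ sX(1) sW(1)]) auto
    then show "((\<lambda>r. of_real (t m) * cinner (dop (\<lambda>n. s' r n powr (p - 1)) (v' r) (u' r) (f m)) (g m)) \<longlongrightarrow>
      of_real (t m) * cinner (dop (\<lambda>n. s n powr (p - 1)) v u (f m)) (g m)) (at_right 0)" for m
      by (intro tendsto_mult tendsto_const tendsto_cinner_left)
    show "\<forall>\<^sub>F r in at_right 0. \<forall>A. finite A \<longrightarrow>
        (\<Sum>m\<in>A. cmod (of_real (t m) * cinner (dop (\<lambda>n. s' r n powr (p - 1)) (v' r) (u' r) (f m)) (g m)))
        \<le> M powr (p - 1) * (\<Sum>m\<in>A. t m powr p) powr (1 / p)"
      using small by eventually_elim (intro allI impI holder[OF sW] NW, auto)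
    show "(\<Sum>m\<in>A. cmod (of_real (t m) * cinner (dop (\<lambda>n. s n powr (p - 1)) v u (f m)) (g m)))
        \<le> M powr (p - 1) * (\<Sum>m\<in>A. t m powr p) powr (1 / p)" if "finite A" for A
      by (rule holder[OF sX _ that]) (simp add: M_def)
  qed (use sY p in auto)
  then show ?thesis
    unfolding pairing_svd_dual[OF p sX sY Y] pairing_svd_dual[OF p sW sY Y] by (rule tendsto_cnj)
qed

text \<open>The right derivative of the norm is bounded without differentiating it: for \<open>W = X + r Y\<close>,
  expanding the pairing of \<open>W\<close> with itself gives \<open>\<parallel>W\<parallel>\<^sub>p\<^bsup>p-1\<^esup> (\<parallel>W\<parallel>\<^sub>p - \<parallel>X\<parallel>\<^sub>p) \<le> r Re (pairing p W Y)\<close>, and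
  \<open>pairing p W Y\<close> tends to \<open>pairing p X Y\<close>.\<close>

lemma pairing_ge_right_slope:
  assumes X: "X \<in> schatten_class p" "X \<noteq> (\<lambda>v. 0)" and Y: "Y \<in> schatten_class p"
    and c: "\<And>r. 0 < r \<Longrightarrow> r < 1 \<Longrightarrow>
      schatten_norm p X + r * c \<le> schatten_norm p (op_add X (op_scale (complex_of_real r) Y))"
  shows "c * schatten_norm p X powr (p - 1) \<le> Re (pairing p X Y)"
proof -
  define W where "W r = op_add X (op_scale (complex_of_real r) Y)" for r
  let ?N = "schatten_norm p"
  have W: "W r \<in> schatten_class p" for r
    unfolding W_def by (intro schatten_add(1) schatten_scale(1) p X Y)
  have "((\<lambda>r. ?N (W r)) \<longlongrightarrow> ?N X) (at_right 0)"
  proof (rule tendsto_sandwich)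
    have upper: "?N (W r) \<le> ?N X + \<bar>r\<bar> * ?N Y" for r
      using schatten_add(2)[OF p X(1) schatten_scale(1)[OF p Y, of "of_real r"]] schatten_scale(2)[OF p Y, of "of_real r"]
      unfolding W_def by simp
    have lower: "?N X - \<bar>r\<bar> * ?N Y \<le> ?N (W r)" for r
    proof -
      have "op_add (W r) (op_scale (complex_of_real (- r)) Y) = X"
        by (simp add: W_def op_add_def op_scale_def)
      then show ?thesis
        using schatten_add(2)[OF p W[of r] schatten_scale(1)[OF p Y, of "complex_of_real (- r)"]]
          schatten_scale(2)[OF p Y, of "complex_of_real (- r)"] by simp
    qed
    show "\<forall>\<^sub>F r in at_right 0. ?N (W r) \<le> ?N X + \<bar>r\<bar> * ?N Y" "\<forall>\<^sub>F r in at_right 0. ?N X - \<bar>r\<bar> * ?N Y \<le> ?N (W r)"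
      using upper lower by auto
    have "((\<lambda>r. r) \<longlongrightarrow> 0) (at_right (0::real))" by (rule tendsto_ident_at)
    then have "((\<lambda>r. \<bar>r\<bar>) \<longlongrightarrow> 0) (at_right (0::real))" by (rule tendsto_rabs_zero)
    then have "((\<lambda>r. \<bar>r\<bar> * ?N Y) \<longlongrightarrow> 0) (at_right (0::real))" by (rule tendsto_mult_left_zero)
    from tendsto_diff[OF tendsto_const this] tendsto_add[OF tendsto_const this]
    show "((\<lambda>r. ?N X - \<bar>r\<bar> * ?N Y) \<longlongrightarrow> ?N X) (at_right 0)" "((\<lambda>r. ?N X + \<bar>r\<bar> * ?N Y) \<longlongrightarrow> ?N X) (at_right 0)"
      by simp_all
  qed
  then have lim: "((\<lambda>r. c * ?N (W r) powr (p - 1)) \<longlongrightarrow> c * ?N X powr (p - 1)) (at_right 0)"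
    using schatten_norm_pos[OF p X] by (intro tendsto_intros) auto
  have "((\<lambda>r. Re (pairing p (W r) Y)) \<longlongrightarrow> Re (pairing p X Y)) (at_right 0)"
    unfolding W_def by (intro tendsto_Re tendsto_pairing X Y)
  moreover have "\<forall>\<^sub>F r in at_right 0. c * ?N (W r) powr (p - 1) \<le> Re (pairing p (W r) Y)"
    using eventually_at_right_real[of 0 "1::real"]
  proof (rule eventually_mono)
    fix r :: real assume "r \<in> {0<..<1}"
    then have r: "0 < r" "r < 1" by auto
    have "(?N X + r * c) * ?N (W r) powr (p - 1) \<le> ?N (W r) * ?N (W r) powr (p - 1)"
      using c[OF r] unfolding W_def by (intro mult_right_mono) auto
    also have "\<dots> = Re (pairing p (W r) (W r))"
      unfolding pairing_self[OF p W] by (simp add: powr_mult_base)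
    also have "pairing p (W r) (W r) = pairing p (W r) X + of_real r * pairing p (W r) Y"
      using pairing_add[OF p W[of r] X(1) schatten_scale(1)[OF p Y, of "of_real r"]]
      unfolding pairing_scale_right[OF p W Y] W_def[of r, symmetric] .
    also have "Re \<dots> \<le> ?N (W r) powr (p - 1) * ?N X + r * Re (pairing p (W r) Y)"
      using order_trans[OF complex_Re_le_cmod pairing_le[OF p W X(1)]] by simp
    finally have "r * (c * ?N (W r) powr (p - 1)) \<le> r * Re (pairing p (W r) Y)"
      by (simp add: ring_distribs mult_ac)
    then show "c * ?N (W r) powr (p - 1) \<le> Re (pairing p (W r) Y)"
      using r by simp
  qed simp
  ultimately show ?thesis
    by (intro tendsto_le[OF _ _ lim]) auto
qed

end

section \<open>The angle\<close>

context
  fixes p :: real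
  assumes p: "1 < p"
begin

lemma cmod_alpha:
  assumes "X \<in> schatten_class p" "X \<noteq> (\<lambda>v. 0)"
  shows "cmod (alpha p Y X) = cmod (pairing p X Y) / (schatten_norm p X powr (p - 1) * schatten_norm p Y)"
proof -
  have pos: "0 < schatten_norm p X" by (rule schatten_norm_pos[OF p assms])
  have "schatten_norm p X powr (2 - p) * schatten_norm p X powr (p - 1) = schatten_norm p X"
    using pos by (simp flip: powr_add)
  then have "schatten_norm p X powr (2 - p) / schatten_norm p X = 1 / schatten_norm p X powr (p - 1)"
    using pos by (simp add: field_simps)
  moreover have "cmod (alpha p Y X)
      = schatten_norm p X powr (2 - p) / schatten_norm p X * (cmod (pairing p X Y) / schatten_norm p Y)"
    unfolding alpha_def semi_inner_def pairing_def[symmetric]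
    by (simp add: norm_divide norm_mult)
  ultimately show ?thesis by simp
qed

lemma cmod_alpha_le_1:
  assumes "X \<in> schatten_class p" "X \<noteq> (\<lambda>v. 0)" "Y \<in> schatten_class p" "Y \<noteq> (\<lambda>v. 0)"
  shows "cmod (alpha p Y X) \<le> 1"
  unfolding cmod_alpha[OF assms(1,2)]
  using pairing_le[OF p assms(1,3)] schatten_norm_pos[OF p assms(1,2)] schatten_norm_pos[OF p assms(3,4)]
  by simp

lemma cmod_alpha_scale:
  assumes X: "X \<in> schatten_class p" "X \<noteq> (\<lambda>v. 0)" and Y: "Y \<in> schatten_class p" and ab: "a \<noteq> 0" "b \<noteq> 0"
  shows "cmod (alpha p (op_scale b Y) (op_scale a X)) = cmod (alpha p Y X)"
proof -
  have "op_scale a X \<noteq> (\<lambda>v. 0)"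
    using X(2) ab by (auto simp: op_scale_def fun_eq_iff complex_vector.scale_eq_0_iff)
  note alpha = cmod_alpha[OF schatten_scale(1)[OF p X(1)] this]
  show ?thesis
    unfolding alpha cmod_alpha[OF X] pairing_scale_left[OF p X(1) schatten_scale(1)[OF p Y] ab(1)]
      pairing_scale_right[OF p X(1) Y] schatten_scale(2)[OF p X(1)] schatten_scale(2)[OF p Y]
    using ab by (simp add: norm_mult norm_sgn powr_mult)
qed

text \<open>Orthogonality is the slope bound with c = 0 in every direction \<theta>Y. Conversely, if
  the pairing vanishes, adding \<gamma>Y leaves the pairing with \<open>X\<close> at its value for
  \<open>X\<close> itself, and Hoelder's inequality bounds the norm from below.\<close>

lemma birkhoff_james_iff_pairing:
  assumes X: "X \<in> schatten_class p" "X \<noteq> (\<lambda>v. 0)" and Y: "Y \<in> schatten_class p"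
  shows "birkhoff_james p X Y \<longleftrightarrow> pairing p X Y = 0"
proof
  assume bj: "birkhoff_james p X Y"
  \<comment> \<open>In this direction the pairing is minus the square of its modulus, so
    nonnegativity forces it to vanish.\<close>
  define \<theta> where "\<theta> = - cnj (pairing p X Y)"
  have "0 * schatten_norm p X powr (p - 1) \<le> Re (pairing p X (op_scale \<theta> Y))"
  proof (rule pairing_ge_right_slope[OF p X schatten_scale(1)[OF p Y]])
    fix r :: real
    have "op_scale (of_real r) (op_scale \<theta> Y) = op_scale (of_real r * \<theta>) Y"
      by (simp add: op_scale_def scaleC_scaleC)
    then show "schatten_norm p X + r * 0 \<le> schatten_norm p (op_add X (op_scale (of_real r) (op_scale \<theta> Y)))"
      using bj unfolding birkhoff_james_def by simp
  qed
  also have "\<dots> = - (cmod (pairing p X Y))\<^sup>2"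
    unfolding pairing_scale_right[OF p X(1) Y] \<theta>_def cmod_power2
    by (simp add: power2_eq_square)
  finally show "pairing p X Y = 0" by simp
next
  assume zero: "pairing p X Y = 0"
  let ?N = "schatten_norm p"
  show "birkhoff_james p X Y"
    unfolding birkhoff_james_def
  proof
    fix \<gamma>
    let ?W = "op_add X (op_scale \<gamma> Y)"
    have "pairing p X ?W = pairing p X X"
      unfolding pairing_add[OF p X(1,1) schatten_scale(1)[OF p Y]] pairing_scale_right[OF p X(1) Y] zero by simp
    then have "?N X powr p \<le> ?N X powr (p - 1) * ?N ?W"
      using pairing_le[OF p X(1) schatten_add(1)[OF p X(1) schatten_scale(1)[OF p Y]], of \<gamma>]
      by (simp add: pairing_self[OF p X(1)])
    moreover have "?N X powr p = ?N X powr (p - 1) * ?N X"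
      using schatten_norm_pos[OF p X] by (simp add: powr_mult_base mult.commute)
    ultimately show "?N X \<le> ?N ?W"
      using schatten_norm_pos[OF p X] by simp
  qed
qed

lemma norm_parallel_sym:
  assumes X: "X \<in> schatten_class p" and Y: "Y \<in> schatten_class p" and par: "norm_parallel p X Y"
  shows "norm_parallel p Y X"
proof -
  obtain \<gamma> where \<gamma>: "cmod \<gamma> = 1"
    and eq: "schatten_norm p (op_add X (op_scale \<gamma> Y)) = schatten_norm p X + schatten_norm p Y"
    using par unfolding norm_parallel_def by blast
  have "cnj \<gamma> * \<gamma> = 1"
    using \<gamma> complex_norm_square[of \<gamma>] by (simp add: mult.commute)
  then have "op_add Y (op_scale (cnj \<gamma>) X) = op_scale (cnj \<gamma>) (op_add X (op_scale \<gamma> Y))"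
    by (simp add: op_add_def op_scale_def scaleC_add_right scaleC_scaleC add.commute)
  then have "schatten_norm p (op_add Y (op_scale (cnj \<gamma>) X)) = schatten_norm p Y + schatten_norm p X"
    using \<gamma> eq schatten_scale(2)[OF p schatten_add(1)[OF p X schatten_scale(1)[OF p Y, of \<gamma>]], of "cnj \<gamma>"] by simp
  then show ?thesis
    unfolding norm_parallel_def using \<gamma> by (intro exI[of _ "cnj \<gamma>"]) simp
qed

text \<open>Equality in the triangle inequality at r = 1 persists for smaller r, so the norm grows
  with slope \<open>schatten_norm p Y\<close> towards \<open>Z\<close>; the slope bound then meets
  Hoelder's upper bound.\<close>

lemma norm_parallel_cmod_alpha:
  assumes X: "X \<in> schatten_class p" "X \<noteq> (\<lambda>v. 0)" and Y: "Y \<in> schatten_class p" "Y \<noteq> (\<lambda>v. 0)"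
    and par: "norm_parallel p X Y"
  shows "cmod (alpha p Y X) = 1"
proof -
  let ?N = "schatten_norm p"
  obtain \<gamma> where \<gamma>: "cmod \<gamma> = 1" and eq: "?N (op_add X (op_scale \<gamma> Y)) = ?N X + ?N Y"
    using par unfolding norm_parallel_def by blast
  define Z where "Z = op_scale \<gamma> Y"
  have Z: "Z \<in> schatten_class p" "?N Z = ?N Y"
    using schatten_scale[OF p Y(1), of \<gamma>] \<gamma> by (auto simp: Z_def)
  have "?N Y * ?N X powr (p - 1) \<le> Re (pairing p X Z)"
  proof (rule pairing_ge_right_slope[OF p X Z(1)])
    fix r :: real assume r: "0 < r" "r < 1"
    \<comment> \<open>Splitting off (1 - r) Z, whose norm is known, leaves at least
      \<open>?N X + r * ?N Y\<close> for the norm of X + r Z.\<close>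
    have "op_add X Z = op_add (op_add X (op_scale (of_real r) Z)) (op_scale (of_real (1 - r)) Z)"
      by (simp add: op_add_def op_scale_def scaleC_add_left[symmetric] add.assoc)
    then have "?N X + ?N Y \<le> ?N (op_add X (op_scale (of_real r) Z)) + ?N (op_scale (of_real (1 - r)) Z)"
      using eq schatten_add(2)[OF p schatten_add(1)[OF p X(1) schatten_scale(1)[OF p Z(1), of "of_real r"]]
        schatten_scale(1)[OF p Z(1), of "of_real (1 - r)"]]
      by (simp add: Z_def)
    moreover have "?N (op_scale (of_real (1 - r)) Z) = (1 - r) * ?N Y"
      using schatten_scale(2)[OF p Z(1), of "of_real (1 - r)"] r Z(2) by (simp del: of_real_diff)
    ultimately show "?N X + r * ?N Y \<le> ?N (op_add X (op_scale (of_real r) Z))"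
      by (simp add: algebra_simps)
  qed
  also have "\<dots> \<le> cmod (pairing p X Y)"
    using complex_Re_le_cmod[of "pairing p X Z"] \<gamma>
    unfolding Z_def pairing_scale_right[OF p X(1) Y(1)] norm_mult by simp
  finally have "cmod (pairing p X Y) = ?N X powr (p - 1) * ?N Y"
    using pairing_le[OF p X(1) Y(1)] by (simp add: mult.commute)
  then show ?thesis
    unfolding cmod_alpha[OF X] using schatten_norm_pos[OF p X] schatten_norm_pos[OF p Y] by simp
qed

lemma linearly_dependent_norm_parallel:
  assumes X: "X \<in> schatten_class p" "X \<noteq> (\<lambda>v. 0)" and Y: "Y \<noteq> (\<lambda>v. 0)"
    and cd: "c \<noteq> 0 \<or> d \<noteq> 0" and zero: "op_add (op_scale c X) (op_scale d Y) = (\<lambda>v. 0)"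
  shows "norm_parallel p X Y"
proof -
  have eq: "c *\<^sub>C X v + d *\<^sub>C Y v = 0" for v
    using fun_cong[OF zero, of v] by (simp add: op_add_def op_scale_def)
  have "d \<noteq> 0"
    using eq cd X(2) by (auto simp: fun_eq_iff complex_vector.scale_eq_0_iff)
  have "c \<noteq> 0"
    using eq cd Y by (auto simp: fun_eq_iff complex_vector.scale_eq_0_iff)
  define a where "a = - c / d"
  have "a \<noteq> 0" using \<open>c \<noteq> 0\<close> \<open>d \<noteq> 0\<close> by (simp add: a_def)
  have "Y v = a *\<^sub>C X v" for v
  proof -
    have "(1 / d) *\<^sub>C (d *\<^sub>C Y v) = (1 / d) *\<^sub>C (- (c *\<^sub>C X v))"
      using eq[of v] by (metis add.commute add_eq_0_iff)
    then show ?thesis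
      using \<open>d \<noteq> 0\<close> by (simp add: scaleC_scaleC a_def)
  qed
  then have Y: "Y = op_scale a X" by (auto simp: op_scale_def)
  \<comment> \<open>This phase turns \<gamma>Y into |a| X, so both summands are nonnegative
    multiples of \<open>X\<close> and their norms add.\<close>
  define \<gamma> where "\<gamma> = cnj (sgn a)"
  have "cmod \<gamma> = 1" using \<open>a \<noteq> 0\<close> by (simp add: \<gamma>_def norm_sgn)
  have "\<gamma> * a = of_real (cmod a)"
    using \<open>a \<noteq> 0\<close> complex_norm_square[of a]
    by (simp add: \<gamma>_def sgn_eq field_simps power2_eq_square)
  then have "op_add X (op_scale \<gamma> Y) = op_scale (of_real (1 + cmod a)) X"
    by (simp add: Y op_add_def op_scale_def scaleC_scaleC scaleC_add_left)
  then have "schatten_norm p (op_add X (op_scale \<gamma> Y)) = schatten_norm p X + schatten_norm p Y"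
    using schatten_scale(2)[OF p X(1), of "of_real (1 + cmod a)"] schatten_scale(2)[OF p X(1), of a]
    by (simp add: Y ring_distribs del: of_real_add)
  with \<open>cmod \<gamma> = 1\<close> show ?thesis unfolding norm_parallel_def by blast
qed

end

theorem theorem4p3:
  fixes X Y :: "'a::complex_hilbert \<Rightarrow> 'a" and p :: real
  assumes "separable_space (euclidean :: 'a topology)"
    and "p > 1"
    and "X \<in> schatten_class p" and "Y \<in> schatten_class p"
    and "X \<noteq> (\<lambda>v. 0)" and "Y \<noteq> (\<lambda>v. 0)"
  shows "(0 \<le> p_angle p X Y \<and> p_angle p X Y \<le> pi / 2) \<and>
    p_angle p X Y = p_angle p Y X \<and>
    (\<forall>a b. a \<noteq> 0 \<longrightarrow> b \<noteq> 0 \<longrightarrow>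
       p_angle p (op_scale a X) (op_scale b Y) = p_angle p X Y) \<and>
    (p_angle p X Y = pi / 2 \<longleftrightarrow> birkhoff_james p X Y \<and> birkhoff_james p Y X) \<and>
    ((norm_parallel p X Y \<longleftrightarrow> norm_parallel p Y X) \<and>
     (norm_parallel p X Y \<longrightarrow> p_angle p X Y = 0) \<and>
     ((\<exists>c d. (c \<noteq> 0 \<or> d \<noteq> 0) \<and> op_add (op_scale c X) (op_scale d Y) = (\<lambda>v. 0))
        \<longrightarrow> p_angle p X Y = 0)) \<and>
    p_angle p X Y \<le> gg_angle p X Y"
proof -
  note p = assms(2) and X = assms(3,5) and Y = assms(4,6)
  define x where "x = cmod (alpha p Y X)"
  define y where "y = cmod (alpha p X Y)"
  have x: "0 \<le> x" "x \<le> 1"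
    using cmod_alpha_le_1[OF p X Y] by (auto simp: x_def)
  have y: "0 \<le> y" "y \<le> 1"
    using cmod_alpha_le_1[OF p Y X] by (auto simp: y_def)
  have angle: "p_angle p X Y = arccos ((x + y) / 2)"
    by (simp add: p_angle_def x_def y_def)
  have one: "0 \<le> p_angle p X Y \<and> p_angle p X Y \<le> pi / 2"
    unfolding angle using x y by (intro conjI arccos_lbound arccos_le_pi2) auto
  have two: "p_angle p X Y = p_angle p Y X"
    by (simp add: p_angle_def add.commute)
  have three: "p_angle p (op_scale a X) (op_scale b Y) = p_angle p X Y" if "a \<noteq> 0" "b \<noteq> 0" for a b
    unfolding p_angle_def cmod_alpha_scale[OF p X Y(1) that] cmod_alpha_scale[OF p Y X(1) that(2,1)] ..
  have pos: "0 < schatten_norm p X" "0 < schatten_norm p Y"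
    using schatten_norm_pos[OF p X] schatten_norm_pos[OF p Y] .
  have "p_angle p X Y = pi / 2 \<longleftrightarrow> arccos ((x + y) / 2) = arccos 0"
    unfolding angle by simp
  also have "\<dots> \<longleftrightarrow> x + y = 0"
    using x y by (subst arccos_eq_iff) auto
  also have "\<dots> \<longleftrightarrow> x = 0 \<and> y = 0"
    using x y by (simp add: add_nonneg_eq_0_iff)
  also have "\<dots> \<longleftrightarrow> pairing p X Y = 0 \<and> pairing p Y X = 0"
    unfolding x_def y_def cmod_alpha[OF p X] cmod_alpha[OF p Y] using pos by simp
  also have "\<dots> \<longleftrightarrow> birkhoff_james p X Y \<and> birkhoff_james p Y X"
    unfolding birkhoff_james_iff_pairing[OF p X Y(1)] birkhoff_james_iff_pairing[OF p Y X(1)] ..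
  finally have four: "p_angle p X Y = pi / 2 \<longleftrightarrow> birkhoff_james p X Y \<and> birkhoff_james p Y X" .
  have sym: "norm_parallel p X Y \<longleftrightarrow> norm_parallel p Y X"
    using norm_parallel_sym[OF p X(1) Y(1)] norm_parallel_sym[OF p Y(1) X(1)] by blast
  have five: "p_angle p X Y = 0" if "norm_parallel p X Y"
    unfolding p_angle_def norm_parallel_cmod_alpha[OF p X Y that]
      norm_parallel_cmod_alpha[OF p Y X that[unfolded sym]] by simp
  have dependent: "p_angle p X Y = 0"
    if "(c \<noteq> 0 \<or> d \<noteq> 0) \<and> op_add (op_scale c X) (op_scale d Y) = (\<lambda>v. 0)" for c d
    using that by (intro five linearly_dependent_norm_parallel[OF p X Y(2)]) auto
  \<comment> \<open>Passing to real parts decreases the moduli and the geometric mean is at most the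
    arithmetic one; \<open>arccos\<close> reverses the order.\<close>
  have "\<bar>beta p Y X\<bar> \<le> x" "\<bar>beta p X Y\<bar> \<le> y"
    by (simp_all add: beta_def x_def y_def abs_Re_le_cmod)
  then have "\<bar>beta p Y X\<bar> * \<bar>beta p X Y\<bar> \<le> x * y"
    using x by (intro mult_mono) auto
  then have "sqrt (\<bar>beta p Y X\<bar> * \<bar>beta p X Y\<bar>) \<le> sqrt (x * y)"
    by (rule real_sqrt_le_mono)
  also have "\<dots> \<le> (x + y) / 2"
    by (rule arith_geo_mean_sqrt[OF x(1) y(1)])
  finally have "p_angle p X Y \<le> gg_angle p X Y"
    unfolding angle gg_angle_def using x y by (intro arccos_le_arccos) (auto intro: order_trans[of _ 0])
  with one two three four sym five dependent show ?thesis by blast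
qed

end
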